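(* Let $(\rho,v)$ be an equivariant representation of $\Sigma$ on a Hilbert $A$-module $X$ and let $x,y\in X$. Define $T:G\times A\to A$ by $T(g,a)=\langle x,\rho(a)v(g)y\rangle$. Then $T\in M_0A(\Sigma)$ with $|||T|||=\|M_T\|\le\|M_T\|_{cb}\le\|x\|\,\|y\|$; thus $M_T:C_r^*(\Sigma)\to C_r^*(\Sigma)$ satisfies $M_T(a\lambda_\Sigma(g))=\langle x,\rho(a)v(g)y\rangle\lambda_\Sigma(g)$ for all $a\in A$, $g\in G$. If $x=y$, then $M_T$ is completely positive and $|||T|||=\|M_T\|=\|M_T\|_{cb}=\|x\|^2$.
   Context: Standing setup. All C*-algebras are unital. A twisted (unital, discrete) C*-dynamical system is a quadruple $\Sigma=(A,G,\alpha,\sigma)$, where $A$ is a unital C*-algebra, $G$ a discrete group with identity $e$, $\alpha:G\to\mathrm{Aut}(A)$ and $\sigma:G\times G\to\mathcal U(A)$ satisfy $\alpha_g\alpha_h=\mathrm{Ad}(\sigma(g,h))\alpha_{gh}$, $\sigma(g,h)\sigma(gh,k)=\alpha_g(\sigma(h,k))\sigma(g,hk)$, $\sigma(g,e)=\sigma(e,g)=1$. Let $A^\Sigma$ be the set of $\xi:G\to A$ such that $\sum_g\alpha_g^{-1}(\xi(g)^*\xi(g))$ converges (unconditionally) in norm; a right Hilbert $A$-module with $(\xi\times a)(g)=\xi(g)\alpha_g(a)$, $\langle\xi,\eta\rangle_\alpha=\sum_g\alpha_g^{-1}(\xi(g)^*\eta(g))$. $A$ acts by $(a\xi)(h)=a\xi(h)$,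 and $(\lambda_\Sigma(g)\xi)(h)=\alpha_g(\xi(g^{-1}h))\sigma(g,g^{-1}h)$. $C_r^*(\Sigma)$ is the C*-subalgebra of $\mathcal L(A^\Sigma)$ generated by $A$ and $\lambda_\Sigma(G)$. $C_c(\Sigma)$: finitely supported $G\to A$, $\Lambda_\Sigma(f)=\sum_g f(g)\lambda_\Sigma(g)$. Hilbert modules are right modules with inner products linear in the second variable. Multipliers: for $T:G\times A\to A$ linear in the second variable write $T_g(a)=T(g,a)$ and $(T\cdot f)(g)=T_g(f(g))$. $T\in MA(\Sigma)$ if there is a bounded linear $M_T:C_r^*(\Sigma)\to C_r^*(\Sigma)$ with $M_T(\Lambda_\Sigma(f))=\Lambda_\Sigma(T\cdot f)$ for all $f\in C_c(\Sigma)$; $|||T|||:=\|M_T\|$. $T\in M_0A(\Sigma)$ if moreover $M_T$ is completely bounded. Equivariant representations: an equivariant representation of $\Sigma$ on a Hilbert $A$-module $X$ is a pair $(\rho,v)$ where $\rho:A\to\mathcal L(X)$ is a unital *-homomorphism and $v$ maps $G$ into the group of $\mathbb C$-linear bounded invertible maps $X\to X$, such that for all $g,h\in G$, $a\in A$, $x,x'\in X$: (i) $\rho(\alpha_g(a))=v(g)\rho(a)v(g)^{-1}$; (ii) $v(g)v(h)=\mathrm{ad}_\rho(\sigma(g,h))v(gh)$, where $\mathrm{ad}_\rho(u)x=(\rho(u)x)\cdot u^*$; (iii) $\alpha_g(\langle x,x'\rangle)=\langle v(g)x,v(g)x'\rangle$; (iv) $v(g)(x\cdot a)=(v(g)x)\cdot\alpha_g(a)$.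 *)

theory Defs
  imports "HOL-Analysis.Analysis" "HOL-Library.Function_Algebras"
begin

text \<open>A unital (complex) C*-algebra: a real unital Banach algebra with an involution and
  a central element iu with iu*iu = -1 giving the complex structure; complex scalar
  multiplication is cscale below.  The norm is complex-homogeneous and satisfies the
  C*-identity.\<close>

class cstar = real_normed_algebra_1 + banach +
  fixes invol :: "'a \<Rightarrow> 'a"
    and iu :: 'a
  assumes invol_invol: "invol (invol a) = a"
    and invol_add: "invol (a + b) = invol a + invol b"
    and invol_scaleR: "invol (scaleR r a) = scaleR r (invol a)"
    and invol_mult: "invol (a * b) = invol b * invol a"
    and iu_central: "iu * a = a * iu"
    and iu_sq: "iu * iu = - 1"
    and invol_iu: "invol iu = - iu"
    and norm_cscale: "norm (scaleR s a + scaleR t (iu * a)) = cmod (Complex s t) * norm a"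
    and cstar_identity: "norm (invol a * a) = (norm a)\<^sup>2"

definition cscale :: "complex \<Rightarrow> 'a::cstar \<Rightarrow> 'a" where
  "cscale c a = scaleR (Re c) a + scaleR (Im c) (iu * a)"

definition cpos :: "'a::cstar \<Rightarrow> bool" where
  "cpos a \<longleftrightarrow> (\<exists>b. a = invol b * b)"

definition unitary :: "'a::cstar \<Rightarrow> bool" where
  "unitary u \<longleftrightarrow> invol u * u = 1 \<and> u * invol u = 1"

definition is_aut :: "('a::cstar \<Rightarrow> 'a) \<Rightarrow> bool" where
  "is_aut f \<longleftrightarrow> bij f \<and> (\<forall>a b. f (a + b) = f a + f b) \<and> (\<forall>a b. f (a * b) = f a * f b)
     \<and> (\<forall>a. f (invol a) = invol (f a)) \<and> (\<forall>c a. f (cscale c a) = cscale c (f a))"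

text \<open>The discrete group G is a type of class group_add, written additively
  (not assumed commutative): identity 0, product g + h, inverse - g.\<close>

definition twisted_system :: "('g::group_add \<Rightarrow> 'a::cstar \<Rightarrow> 'a) \<Rightarrow> ('g \<Rightarrow> 'g \<Rightarrow> 'a) \<Rightarrow> bool" where
  "twisted_system \<alpha> \<sigma> \<longleftrightarrow>
     (\<forall>g. is_aut (\<alpha> g)) \<and> (\<forall>g h. unitary (\<sigma> g h)) \<and>
     (\<forall>g h a. \<alpha> g (\<alpha> h a) = \<sigma> g h * \<alpha> (g + h) a * invol (\<sigma> g h)) \<and>
     (\<forall>g h k. \<sigma> g h * \<sigma> (g + h) k = \<alpha> g (\<sigma> h k) * \<sigma> g (h + k)) \<and>
     (\<forall>g. \<sigma> g 0 = 1 \<and> \<sigma> 0 g = 1)"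

definition hnorm :: "('x \<Rightarrow> 'x \<Rightarrow> 'a::cstar) \<Rightarrow> 'x \<Rightarrow> real" where
  "hnorm ip x = sqrt (norm (ip x x))"

text \<open>Right Hilbert A-module with carrier X, right action rm and A-valued inner product ip
  (linear in the second variable).  The complex structure is x \<mapsto> rm x (cscale c 1).\<close>
definition hilbert_module :: "'x::ab_group_add set \<Rightarrow> ('x \<Rightarrow> 'a::cstar \<Rightarrow> 'x) \<Rightarrow> ('x \<Rightarrow> 'x \<Rightarrow> 'a) \<Rightarrow> bool" where
  "hilbert_module X rm ip \<longleftrightarrow>
     0 \<in> X \<and> (\<forall>x\<in>X. \<forall>y\<in>X. x + y \<in> X) \<and> (\<forall>x\<in>X. - x \<in> X) \<and> (\<forall>x\<in>X. \<forall>a. rm x a \<in> X) \<and>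
     (\<forall>x\<in>X. \<forall>y\<in>X. \<forall>a. rm (x + y) a = rm x a + rm y a) \<and>
     (\<forall>x\<in>X. \<forall>a b. rm x (a + b) = rm x a + rm x b) \<and>
     (\<forall>x\<in>X. \<forall>a b. rm (rm x a) b = rm x (a * b)) \<and>
     (\<forall>x\<in>X. rm x 1 = x) \<and>
     (\<forall>x\<in>X. \<forall>y\<in>X. \<forall>z\<in>X. ip x (y + z) = ip x y + ip x z) \<and>
     (\<forall>x\<in>X. \<forall>y\<in>X. \<forall>a. ip x (rm y a) = ip x y * a) \<and>
     (\<forall>x\<in>X. \<forall>y\<in>X. invol (ip x y) = ip y x) \<and>
     (\<forall>x\<in>X. cpos (ip x x)) \<and>
     (\<forall>x\<in>X. ip x x = 0 \<longrightarrow> x = 0) \<and>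
     (\<forall>s::nat \<Rightarrow> 'x. (\<forall>n. s n \<in> X) \<and> (\<forall>e>0. \<exists>N. \<forall>m\<ge>N. \<forall>n\<ge>N. hnorm ip (s m - s n) < e)
          \<longrightarrow> (\<exists>l\<in>X. \<forall>e>0. \<exists>N. \<forall>n\<ge>N. hnorm ip (s n - l) < e))"

text \<open>Operators on X are represented by functions that vanish off X.\<close>
definition restr :: "'x set \<Rightarrow> ('x \<Rightarrow> 'x::zero) \<Rightarrow> 'x \<Rightarrow> 'x" where
  "restr X T = (\<lambda>x. if x \<in> X then T x else 0)"

definition adjointable :: "'x set \<Rightarrow> ('x \<Rightarrow> 'x \<Rightarrow> 'a) \<Rightarrow> ('x \<Rightarrow> 'x) \<Rightarrow> bool" where
  "adjointable X ip T \<longleftrightarrow> (\<forall>x\<in>X. T x \<in> X) \<and>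
     (\<exists>S. (\<forall>x\<in>X. S x \<in> X) \<and> (\<forall>x\<in>X. \<forall>y\<in>X. ip (T x) y = ip x (S y)))"

definition opnorm :: "'x set \<Rightarrow> ('x \<Rightarrow> 'x \<Rightarrow> 'a::cstar) \<Rightarrow> ('x \<Rightarrow> 'x) \<Rightarrow> real" where
  "opnorm X ip T = Sup ((\<lambda>x. hnorm ip (T x)) ` {x\<in>X. hnorm ip x \<le> 1})"

definition op_add :: "'x set \<Rightarrow> ('x \<Rightarrow> 'x::ab_group_add) \<Rightarrow> ('x \<Rightarrow> 'x) \<Rightarrow> 'x \<Rightarrow> 'x" where
  "op_add X T S = restr X (\<lambda>x. T x + S x)"

definition op_diff :: "'x set \<Rightarrow> ('x \<Rightarrow> 'x::ab_group_add) \<Rightarrow> ('x \<Rightarrow> 'x) \<Rightarrow> 'x \<Rightarrow> 'x" where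
  "op_diff X T S = restr X (\<lambda>x. T x - S x)"

definition op_comp :: "'x set \<Rightarrow> ('x \<Rightarrow> 'x::zero) \<Rightarrow> ('x \<Rightarrow> 'x) \<Rightarrow> 'x \<Rightarrow> 'x" where
  "op_comp X T S = restr X (\<lambda>x. T (S x))"

definition op_smul :: "'x set \<Rightarrow> ('x \<Rightarrow> 'a::cstar \<Rightarrow> 'x) \<Rightarrow> complex \<Rightarrow> ('x \<Rightarrow> 'x::zero) \<Rightarrow> 'x \<Rightarrow> 'x" where
  "op_smul X rm c T = restr X (\<lambda>x. rm (T x) (cscale c 1))"

definition op_adj :: "'x set \<Rightarrow> ('x \<Rightarrow> 'x \<Rightarrow> 'a) \<Rightarrow> ('x \<Rightarrow> 'x::zero) \<Rightarrow> 'x \<Rightarrow> 'x" where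
  "op_adj X ip T = (SOME S. restr X S = S \<and> (\<forall>x\<in>X. S x \<in> X) \<and>
                            (\<forall>x\<in>X. \<forall>y\<in>X. ip (T x) y = ip x (S y)))"

definition cstar_subalg :: "'x::ab_group_add set \<Rightarrow> ('x \<Rightarrow> 'a::cstar \<Rightarrow> 'x) \<Rightarrow> ('x \<Rightarrow> 'x \<Rightarrow> 'a)
    \<Rightarrow> ('x \<Rightarrow> 'x) set \<Rightarrow> bool" where
  "cstar_subalg X rm ip S \<longleftrightarrow>
     S \<subseteq> {T. adjointable X ip T \<and> restr X T = T} \<and>
     (\<forall>T\<in>S. \<forall>T'\<in>S. op_add X T T' \<in> S \<and> op_comp X T T' \<in> S) \<and>
     (\<forall>T\<in>S. \<forall>c. op_smul X rm c T \<in> S) \<and>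
     (\<forall>T\<in>S. \<exists>T'\<in>S. \<forall>x\<in>X. \<forall>y\<in>X. ip (T x) y = ip x (T' y)) \<and>
     (\<forall>T (u::nat \<Rightarrow> 'x \<Rightarrow> 'x). (\<forall>n. u n \<in> S) \<and> adjointable X ip T \<and> restr X T = T \<and>
            (\<lambda>n. opnorm X ip (op_diff X (u n) T)) \<longlonglongrightarrow> 0 \<longrightarrow> T \<in> S)"

definition generated_cstar :: "'x::ab_group_add set \<Rightarrow> ('x \<Rightarrow> 'a::cstar \<Rightarrow> 'x) \<Rightarrow> ('x \<Rightarrow> 'x \<Rightarrow> 'a)
    \<Rightarrow> ('x \<Rightarrow> 'x) set \<Rightarrow> ('x \<Rightarrow> 'x) set" where
  "generated_cstar X rm ip Gen = \<Inter>{S. cstar_subalg X rm ip S \<and> Gen \<subseteq> S}"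

definition equivariant_rep :: "('g::group_add \<Rightarrow> 'a::cstar \<Rightarrow> 'a) \<Rightarrow> ('g \<Rightarrow> 'g \<Rightarrow> 'a)
    \<Rightarrow> 'x::ab_group_add set \<Rightarrow> ('x \<Rightarrow> 'a \<Rightarrow> 'x) \<Rightarrow> ('x \<Rightarrow> 'x \<Rightarrow> 'a)
    \<Rightarrow> ('a \<Rightarrow> 'x \<Rightarrow> 'x) \<Rightarrow> ('g \<Rightarrow> 'x \<Rightarrow> 'x) \<Rightarrow> bool" where
  "equivariant_rep \<alpha> \<sigma> X rm ip \<rho> v \<longleftrightarrow>
     \<comment> \<open>\<rho> is a unital *-homomorphism A \<rightarrow> L(X)\<close>
     (\<forall>a. adjointable X ip (\<rho> a)) \<and>
     (\<forall>a b. \<forall>x\<in>X. \<rho> (a + b) x = \<rho> a x + \<rho> b x) \<and>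
     (\<forall>a b. \<forall>x\<in>X. \<rho> (a * b) x = \<rho> a (\<rho> b x)) \<and>
     (\<forall>x\<in>X. \<rho> 1 x = x) \<and>
     (\<forall>c a. \<forall>x\<in>X. \<rho> (cscale c a) x = rm (\<rho> a x) (cscale c 1)) \<and>
     (\<forall>a. \<forall>x\<in>X. \<forall>y\<in>X. ip (\<rho> a x) y = ip x (\<rho> (invol a) y)) \<and>
     \<comment> \<open>each v g is a bounded invertible complex-linear map X \<rightarrow> X with bounded inverse\<close>
     (\<forall>g. bij_betw (v g) X X) \<and>
     (\<forall>g. \<forall>x\<in>X. \<forall>y\<in>X. v g (x + y) = v g x + v g y) \<and>
     (\<forall>g c. \<forall>x\<in>X. v g (rm x (cscale c 1)) = rm (v g x) (cscale c 1)) \<and>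
     (\<forall>g. \<exists>K. \<forall>x\<in>X. hnorm ip (v g x) \<le> K * hnorm ip x) \<and>
     (\<forall>g. \<exists>K. \<forall>x\<in>X. hnorm ip (inv_into X (v g) x) \<le> K * hnorm ip x) \<and>
     \<comment> \<open>(i)\<close>
     (\<forall>g a. \<forall>x\<in>X. \<rho> (\<alpha> g a) x = v g (\<rho> a (inv_into X (v g) x))) \<and>
     \<comment> \<open>(ii)\<close>
     (\<forall>g h. \<forall>x\<in>X. v g (v h x) = rm (\<rho> (\<sigma> g h) (v (g + h) x)) (invol (\<sigma> g h))) \<and>
     \<comment> \<open>(iii)\<close>
     (\<forall>g. \<forall>x\<in>X. \<forall>x'\<in>X. \<alpha> g (ip x x') = ip (v g x) (v g x')) \<and>
     \<comment> \<open>(iv)\<close>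
     (\<forall>g a. \<forall>x\<in>X. v g (rm x a) = rm (v g x) (\<alpha> g a))"

definition ASig :: "('g \<Rightarrow> 'a::cstar \<Rightarrow> 'a) \<Rightarrow> ('g \<Rightarrow> 'a) set" where
  "ASig \<alpha> = {\<xi>. (\<lambda>g. inv (\<alpha> g) (invol (\<xi> g) * \<xi> g)) summable_on UNIV}"

definition as_rm :: "('g \<Rightarrow> 'a::cstar \<Rightarrow> 'a) \<Rightarrow> ('g \<Rightarrow> 'a) \<Rightarrow> 'a \<Rightarrow> 'g \<Rightarrow> 'a" where
  "as_rm \<alpha> \<xi> a = (\<lambda>g. \<xi> g * \<alpha> g a)"

definition as_ip :: "('g \<Rightarrow> 'a::cstar \<Rightarrow> 'a) \<Rightarrow> ('g \<Rightarrow> 'a) \<Rightarrow> ('g \<Rightarrow> 'a) \<Rightarrow> 'a" where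
  "as_ip \<alpha> \<xi> \<eta> = infsum (\<lambda>g. inv (\<alpha> g) (invol (\<xi> g) * \<eta> g)) UNIV"

definition leftop :: "('g \<Rightarrow> 'a::cstar \<Rightarrow> 'a) \<Rightarrow> 'a \<Rightarrow> ('g \<Rightarrow> 'a) \<Rightarrow> 'g \<Rightarrow> 'a" where
  "leftop \<alpha> a = restr (ASig \<alpha>) (\<lambda>\<xi> h. a * \<xi> h)"

definition lam :: "('g::group_add \<Rightarrow> 'a::cstar \<Rightarrow> 'a) \<Rightarrow> ('g \<Rightarrow> 'g \<Rightarrow> 'a) \<Rightarrow> 'g \<Rightarrow> ('g \<Rightarrow> 'a) \<Rightarrow> 'g \<Rightarrow> 'a" where
  "lam \<alpha> \<sigma> g = restr (ASig \<alpha>) (\<lambda>\<xi> h. \<alpha> g (\<xi> (- g + h)) * \<sigma> g (- g + h))"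

definition Cr :: "('g::group_add \<Rightarrow> 'a::cstar \<Rightarrow> 'a) \<Rightarrow> ('g \<Rightarrow> 'g \<Rightarrow> 'a) \<Rightarrow> (('g \<Rightarrow> 'a) \<Rightarrow> 'g \<Rightarrow> 'a) set" where
  "Cr \<alpha> \<sigma> = generated_cstar (ASig \<alpha>) (as_rm \<alpha>) (as_ip \<alpha>)
               (range (leftop \<alpha>) \<union> range (lam \<alpha> \<sigma>))"

definition Lambda :: "('g::group_add \<Rightarrow> 'a::cstar \<Rightarrow> 'a) \<Rightarrow> ('g \<Rightarrow> 'g \<Rightarrow> 'a) \<Rightarrow> ('g \<Rightarrow> 'a) \<Rightarrow> ('g \<Rightarrow> 'a) \<Rightarrow> 'g \<Rightarrow> 'a" where
  "Lambda \<alpha> \<sigma> f = restr (ASig \<alpha>) (\<lambda>\<xi> h. \<Sum>g\<in>{g. f g \<noteq> 0}. f g * lam \<alpha> \<sigma> g \<xi> h)"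

definition msum_norm :: "('x \<Rightarrow> 'x \<Rightarrow> 'a::cstar) \<Rightarrow> nat \<Rightarrow> (nat \<Rightarrow> 'x) \<Rightarrow> real" where
  "msum_norm ip n \<xi> = sqrt (norm (\<Sum>i<n. ip (\<xi> i) (\<xi> i)))"

definition mat_apply :: "nat \<Rightarrow> (nat \<Rightarrow> nat \<Rightarrow> 'x \<Rightarrow> 'x::comm_monoid_add) \<Rightarrow> (nat \<Rightarrow> 'x) \<Rightarrow> nat \<Rightarrow> 'x" where
  "mat_apply n M \<xi> = (\<lambda>i. \<Sum>j<n. M i j (\<xi> j))"

text \<open>Norm of an n\<times>n operator matrix, as an operator on X^n (= norm in M_n(L(X)) = L(X^n)).\<close>
definition matnorm :: "'x::comm_monoid_add set \<Rightarrow> ('x \<Rightarrow> 'x \<Rightarrow> 'a::cstar) \<Rightarrow> nat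
    \<Rightarrow> (nat \<Rightarrow> nat \<Rightarrow> 'x \<Rightarrow> 'x) \<Rightarrow> real" where
  "matnorm X ip n M = Sup ((\<lambda>\<xi>. msum_norm ip n (mat_apply n M \<xi>)) `
                          {\<xi>. (\<forall>i<n. \<xi> i \<in> X) \<and> msum_norm ip n \<xi> \<le> 1})"

definition bounded_lin_on :: "'x::ab_group_add set \<Rightarrow> ('x \<Rightarrow> 'a::cstar \<Rightarrow> 'x) \<Rightarrow> ('x \<Rightarrow> 'x \<Rightarrow> 'a)
    \<Rightarrow> ('x \<Rightarrow> 'x) set \<Rightarrow> (('x \<Rightarrow> 'x) \<Rightarrow> ('x \<Rightarrow> 'x)) \<Rightarrow> bool" where
  "bounded_lin_on X rm ip C M \<longleftrightarrow>
     (\<forall>T\<in>C. M T \<in> C) \<and>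
     (\<forall>T\<in>C. \<forall>S\<in>C. M (op_add X T S) = op_add X (M T) (M S)) \<and>
     (\<forall>c. \<forall>T\<in>C. M (op_smul X rm c T) = op_smul X rm c (M T)) \<and>
     (\<exists>K. \<forall>T\<in>C. opnorm X ip (M T) \<le> K * opnorm X ip T)"

definition map_norm :: "'x set \<Rightarrow> ('x \<Rightarrow> 'x \<Rightarrow> 'a::cstar) \<Rightarrow> ('x \<Rightarrow> 'x) set
    \<Rightarrow> (('x \<Rightarrow> 'x) \<Rightarrow> ('x \<Rightarrow> 'x)) \<Rightarrow> real" where
  "map_norm X ip C M = Sup ((\<lambda>T. opnorm X ip (M T)) ` {T\<in>C. opnorm X ip T \<le> 1})"

definition cb_set :: "'x::comm_monoid_add set \<Rightarrow> ('x \<Rightarrow> 'x \<Rightarrow> 'a::cstar) \<Rightarrow> ('x \<Rightarrow> 'x) set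
    \<Rightarrow> (('x \<Rightarrow> 'x) \<Rightarrow> ('x \<Rightarrow> 'x)) \<Rightarrow> real set" where
  "cb_set X ip C M = {matnorm X ip n (\<lambda>i j. M (Mat i j)) | n Mat.
      n \<ge> 1 \<and> (\<forall>i<n. \<forall>j<n. Mat i j \<in> C) \<and> matnorm X ip n Mat \<le> 1}"

definition cbounded :: "'x::comm_monoid_add set \<Rightarrow> ('x \<Rightarrow> 'x \<Rightarrow> 'a::cstar) \<Rightarrow> ('x \<Rightarrow> 'x) set
    \<Rightarrow> (('x \<Rightarrow> 'x) \<Rightarrow> ('x \<Rightarrow> 'x)) \<Rightarrow> bool" where
  "cbounded X ip C M \<longleftrightarrow> bdd_above (cb_set X ip C M)"

definition cb_norm :: "'x::comm_monoid_add set \<Rightarrow> ('x \<Rightarrow> 'x \<Rightarrow> 'a::cstar) \<Rightarrow> ('x \<Rightarrow> 'x) set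
    \<Rightarrow> (('x \<Rightarrow> 'x) \<Rightarrow> ('x \<Rightarrow> 'x)) \<Rightarrow> real" where
  "cb_norm X ip C M = Sup (cb_set X ip C M)"

definition matpos :: "'x::comm_monoid_add set \<Rightarrow> ('x \<Rightarrow> 'x \<Rightarrow> 'a::cstar) \<Rightarrow> ('x \<Rightarrow> 'x) set \<Rightarrow> nat
    \<Rightarrow> (nat \<Rightarrow> nat \<Rightarrow> 'x \<Rightarrow> 'x) \<Rightarrow> bool" where
  "matpos X ip C n Mat \<longleftrightarrow> (\<exists>B. (\<forall>i<n. \<forall>j<n. B i j \<in> C) \<and>
      (\<forall>i<n. \<forall>j<n. Mat i j = restr X (\<lambda>x. \<Sum>k<n. op_adj X ip (B k i) (B k j x))))"

definition comp_pos :: "'x::comm_monoid_add set \<Rightarrow> ('x \<Rightarrow> 'x \<Rightarrow> 'a::cstar) \<Rightarrow> ('x \<Rightarrow> 'x) set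
    \<Rightarrow> (('x \<Rightarrow> 'x) \<Rightarrow> ('x \<Rightarrow> 'x)) \<Rightarrow> bool" where
  "comp_pos X ip C M \<longleftrightarrow> (\<forall>n\<ge>1. \<forall>Mat. (\<forall>i<n. \<forall>j<n. Mat i j \<in> C) \<and> matpos X ip C n Mat
        \<longrightarrow> matpos X ip C n (\<lambda>i j. M (Mat i j)))"

definition mult_map :: "('g::group_add \<Rightarrow> 'a::cstar \<Rightarrow> 'a) \<Rightarrow> ('g \<Rightarrow> 'g \<Rightarrow> 'a) \<Rightarrow> ('g \<Rightarrow> 'a \<Rightarrow> 'a)
    \<Rightarrow> ((('g \<Rightarrow> 'a) \<Rightarrow> 'g \<Rightarrow> 'a) \<Rightarrow> (('g \<Rightarrow> 'a) \<Rightarrow> 'g \<Rightarrow> 'a)) \<Rightarrow> bool" where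
  "mult_map \<alpha> \<sigma> T M \<longleftrightarrow> bounded_lin_on (ASig \<alpha>) (as_rm \<alpha>) (as_ip \<alpha>) (Cr \<alpha> \<sigma>) M \<and>
     (\<forall>f. finite {g. f g \<noteq> 0} \<longrightarrow> M (Lambda \<alpha> \<sigma> f) = Lambda \<alpha> \<sigma> (\<lambda>g. T g (f g)))"

definition in_MA :: "('g::group_add \<Rightarrow> 'a::cstar \<Rightarrow> 'a) \<Rightarrow> ('g \<Rightarrow> 'g \<Rightarrow> 'a) \<Rightarrow> ('g \<Rightarrow> 'a \<Rightarrow> 'a) \<Rightarrow> bool" where
  "in_MA \<alpha> \<sigma> T \<longleftrightarrow> (\<exists>M. mult_map \<alpha> \<sigma> T M)"

definition in_M0A :: "('g::group_add \<Rightarrow> 'a::cstar \<Rightarrow> 'a) \<Rightarrow> ('g \<Rightarrow> 'g \<Rightarrow> 'a) \<Rightarrow> ('g \<Rightarrow> 'a \<Rightarrow> 'a) \<Rightarrow> bool" where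
  "in_M0A \<alpha> \<sigma> T \<longleftrightarrow> (\<exists>M. mult_map \<alpha> \<sigma> T M \<and> cbounded (ASig \<alpha>) (as_ip \<alpha>) (Cr \<alpha> \<sigma>) M)"

definition triple_norm :: "('g::group_add \<Rightarrow> 'a::cstar \<Rightarrow> 'a) \<Rightarrow> ('g \<Rightarrow> 'g \<Rightarrow> 'a) \<Rightarrow> ('g \<Rightarrow> 'a \<Rightarrow> 'a) \<Rightarrow> real" where
  "triple_norm \<alpha> \<sigma> T = map_norm (ASig \<alpha>) (as_ip \<alpha>) (Cr \<alpha> \<sigma>) (SOME M. mult_map \<alpha> \<sigma> T M)"

end

theory Submission
  imports Defs
begin

text \<open>
  In the basis \<open>\<delta>\<^sub>h\<close> of the module \<open>A\<^sup>\<Sigma>\<close> an operator \<open>S\<close> in the reduced crossed product has a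
  matrix \<open>c\<^sub>h\<^sub>k = \<langle>\<delta>\<^sub>h, S \<delta>\<^sub>k\<rangle>\<close> over \<open>A\<close>, and for \<open>S = \<Lambda>(f)\<close> the equivariance relations show that
  \<open>\<Lambda>(T \<cdot> f)\<close> has the matrix \<open>\<langle>x\<^sub>h, \<rho>(c\<^sub>h\<^sub>k) y\<^sub>k\<rangle>\<close> with \<open>x\<^sub>h = v(h)\<^sup>-\<^sup>1 x\<close> and \<open>y\<^sub>k = v(k)\<^sup>-\<^sup>1 y\<close>; since
  \<open>\<parallel>x\<^sub>h\<parallel> = \<parallel>x\<parallel>\<close> and \<open>\<parallel>y\<^sub>k\<parallel> = \<parallel>y\<parallel>\<close>, everything reduces to the Schur-type map \<open>c\<^sub>h\<^sub>k \<mapsto> \<langle>x\<^sub>h, \<rho>(c\<^sub>h\<^sub>k) y\<^sub>k\<rangle>\<close>.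
  It is bounded by \<open>\<parallel>x\<parallel> \<parallel>y\<parallel>\<close> by the Cauchy--Schwarz inequality, because \<open>(\<rho>(c\<^sub>h\<^sub>k))\<close> has norm at most \<open>\<parallel>S\<parallel>\<close>:
  writing \<open>\<parallel>S\<parallel>\<^sup>2 - S\<^sup>* S = Q\<^sup>2\<close>, this is the positivity of the form
  \<open>\<Sum> \<langle>\<zeta>\<^sub>m, \<rho>(\<langle>Q \<delta>\<^sub>m, Q \<delta>\<^sub>n\<rangle>) \<zeta>\<^sub>n\<rangle>\<close>.  For \<open>x = y\<close> the same positivity, applied to \<open>S = B\<^sup>* B\<close>, gives
  complete positivity after taking a square root in the matrices over the reduced crossed product.
  Matrix amplifications only enlarge the index set from \<open>G\<close> to \<open>{..<n} \<times> G\<close>.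
\<close>

section \<open>Positivity in C*-algebras\<close>

text \<open>The natural setting is the interior tensor product of \<open>ASig \<alpha>\<close> and
  \<open>X\<close> along \<rho>, on which \<open>S\<close> acts as S tensor 1. It is never formed:
  only finite Gram sums of its vectors occur, and \<open>schur_row_bound\<close> is the estimate for
  S tensor 1 in these terms. The operator Q used there requires square roots of operators on a
  carrier set. Such operators are not a type of class \<open>cstar\<close>, so one iteration is run
  twice, once in the algebra and once through estimates on vectors. In the algebra the obstacle is
  positivity in the form \<open>invol b * b\<close>, from which closure under sums cannot be read
  off. The norm inequality of Kelley and Vaught gives sums, and the work lies in showing that the
  two cones agree. On the reduced crossed product the relation \<open>rel\<close> between matrices
  governs the multiplier. Entries determine an operator, so linearity, uniqueness and bounds come
  from entries, for every map satisfying \<open>mult_map\<close>. The lower bound for x = y comes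
  from the unit, which is sent to left multiplication by \<open>ip x x\<close>.\<close>

lemma invol_zero [simp]: "invol (0::'a::cstar) = 0"
  using invol_add[of "0::'a" 0] by simp

lemma invol_minus: "invol (- a) = - invol (a::'a::cstar)"
  using invol_scaleR[of "-1" a] by simp

lemma invol_diff: "invol (a - b) = invol a - invol (b::'a::cstar)"
  using invol_add[of a "- b"] by (simp add: invol_minus)

lemma invol_one [simp]: "invol (1::'a::cstar) = 1"
proof -
  have "invol (invol (1::'a) * 1) = invol 1 * invol (invol 1)" by (rule invol_mult)
  then show ?thesis by (simp add: invol_invol)
qed

lemma invol_sum: "invol (\<Sum>i\<in>I. f i) = (\<Sum>i\<in>I. invol (f i :: 'a::cstar))"
  by (induction I rule: infinite_finite_induct) (auto simp: invol_add)

text \<open>The C*-identity with submultiplicativity gives one inequality; applied to the adjoint it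
  gives the other.\<close>

lemma norm_invol [simp]: "norm (invol a) = norm (a::'a::cstar)"
proof -
  have le: "norm b \<le> norm (invol b)" for b :: 'a
  proof (cases "b = 0")
    case False
    have "norm b * norm b \<le> norm (invol b) * norm b"
      using norm_mult_ineq[of "invol b" b] cstar_identity[of b] by (simp add: power2_eq_square)
    then show ?thesis using False by simp
  qed simp
  show ?thesis using le[of a] le[of "invol a"] by (simp add: invol_invol)
qed

lemma bounded_linear_invol: "bounded_linear (invol :: 'a::cstar \<Rightarrow> 'a)"
  by (rule bounded_linear_intro[of _ 1]) (auto simp: invol_add invol_scaleR)

lemmas tendsto_invol = bounded_linear.tendsto[OF bounded_linear_invol]

lemma norm_mult_self_adjoint: "invol a = a \<Longrightarrow> norm (a * a) = (norm (a::'a::cstar))\<^sup>2"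
  using cstar_identity[of a] by simp

lemma invol_mult_eq_0: "invol a * a = 0 \<Longrightarrow> (a::'a::cstar) = 0"
  using cstar_identity[of a] by simp

text \<open>The iterates tend to \<open>1 - sqrt (1 - x)\<close>, the fixed point of \<open>y \<mapsto> (x + y\<^sup>2) / 2\<close>. As polynomials in
  \<open>x\<close> they and their differences have nonnegative coefficients, so the scalar case \<open>x = 1\<close> dominates.\<close>

primrec sqrt_iter :: "'a::real_normed_algebra_1 \<Rightarrow> nat \<Rightarrow> 'a" where
  "sqrt_iter x 0 = 0"
| "sqrt_iter x (Suc n) = (1/2) *\<^sub>R (x + sqrt_iter x n * sqrt_iter x n)"

lemma sqrt_iter_real_bounds: "0 \<le> sqrt_iter (1::real) n \<and> sqrt_iter (1::real) n \<le> 1"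
proof (induction n)
  case (Suc n)
  then have "sqrt_iter (1::real) n * sqrt_iter 1 n \<le> 1 * 1" by (intro mult_mono) auto
  then show ?case using Suc by simp
qed simp

text \<open>For the iterate t the increment is (1 - t)^2 / 2.\<close>

lemma sqrt_iter_real_step: "sqrt_iter (1::real) n \<le> sqrt_iter 1 (Suc n)"
proof -
  have "0 \<le> (1 - sqrt_iter (1::real) n)\<^sup>2" by simp
  then show ?thesis by (simp add: power2_eq_square algebra_simps)
qed

lemma Cauchy_sqrt_iter_real: "Cauchy (sqrt_iter (1::real))"
proof -
  have "incseq (sqrt_iter (1::real))" by (rule incseq_SucI) (rule sqrt_iter_real_step)
  moreover have "sqrt_iter (1::real) n \<le> 1" for n using sqrt_iter_real_bounds by blast
  ultimately have "convergent (sqrt_iter (1::real))" using incseq_convergent by (metis convergent_def)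
  then show ?thesis by (rule convergent_Cauchy)
qed

lemma sqrt_iter_commute: "z * x = x * z \<Longrightarrow> z * sqrt_iter x n = sqrt_iter x n * z"
proof (induction n)
  case (Suc n)
  have "z * (sqrt_iter x n * sqrt_iter x n) = (sqrt_iter x n * sqrt_iter x n) * z"
    using Suc by (metis mult.assoc)
  then show ?case using Suc.prems by (simp add: distrib_left distrib_right)
qed simp

lemma norm_sqrt_iter_le: "norm x \<le> 1 \<Longrightarrow> norm (sqrt_iter x n) \<le> sqrt_iter (1::real) n"
proof (induction n)
  case (Suc n)
  have "norm (sqrt_iter x n * sqrt_iter x n) \<le> sqrt_iter (1::real) n * sqrt_iter 1 n"
    using Suc by (intro order_trans[OF norm_mult_ineq] mult_mono) (auto simp: sqrt_iter_real_bounds)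
  then have "norm (x + sqrt_iter x n * sqrt_iter x n) \<le> 1 + sqrt_iter (1::real) n * sqrt_iter 1 n"
    using Suc.prems by (intro order_trans[OF norm_triangle_ineq]) auto
  then show ?case by simp
qed simp

text \<open>Iterates commute, so each increment is half the product of the preceding increment and
  the sum of the two preceding iterates. The scalar iterates satisfy the same identity with
  nonnegative factors, hence dominate.\<close>

lemma norm_sqrt_iter_step:
  "norm x \<le> 1 \<Longrightarrow>
    norm (sqrt_iter x (Suc n) - sqrt_iter x n) \<le> sqrt_iter (1::real) (Suc n) - sqrt_iter 1 n"
proof (induction n)
  case (Suc n)
  let ?y = "sqrt_iter x" and ?t = "sqrt_iter (1::real)"
  have comm: "?y n * ?y (Suc n) = ?y (Suc n) * ?y n"
    by (rule sqrt_iter_commute, rule sym, rule sqrt_iter_commute) simp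
  have "?y (Suc (Suc n)) - ?y (Suc n) = (1/2) *\<^sub>R (?y (Suc n) * ?y (Suc n) - ?y n * ?y n)"
    unfolding arg_cong2[where f = minus, OF sqrt_iter.simps(2)[of x "Suc n"] sqrt_iter.simps(2)[of x n]]
    by (simp only: scaleR_right_diff_distrib scaleR_right_distrib) simp
  also have "\<dots> = (1/2) *\<^sub>R ((?y (Suc n) - ?y n) * (?y (Suc n) + ?y n))"
    using comm by (simp del: sqrt_iter.simps add: algebra_simps)
  finally have "norm (?y (Suc (Suc n)) - ?y (Suc n))
      \<le> (1/2) * (norm (?y (Suc n) - ?y n) * norm (?y (Suc n) + ?y n))"
    by (simp del: sqrt_iter.simps add: norm_mult_ineq)
  also have "\<dots> \<le> (1/2) * ((?t (Suc n) - ?t n) * (?t (Suc n) + ?t n))"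
    using Suc.IH[OF Suc.prems] norm_sqrt_iter_le[OF Suc.prems, of n] norm_sqrt_iter_le[OF Suc.prems, of "Suc n"]
      sqrt_iter_real_step[of n]
    by (intro mult_left_mono mult_mono order_trans[OF norm_triangle_ineq] add_mono)
      (auto simp del: sqrt_iter.simps)
  also have "\<dots> = ?t (Suc (Suc n)) - ?t (Suc n)"
    by (subst (3 4) sqrt_iter.simps(2)) (simp del: sqrt_iter.simps add: field_simps)
  finally show ?case .
qed simp

lemma norm_sqrt_iter_diff:
  assumes "norm x \<le> 1" "m \<le> n"
  shows "norm (sqrt_iter x n - sqrt_iter x m) \<le> sqrt_iter (1::real) n - sqrt_iter 1 m"
  using assms(2)
proof (induction n rule: dec_induct)
  case (step n)
  have "norm (sqrt_iter x (Suc n) - sqrt_iter x m)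
     \<le> norm (sqrt_iter x (Suc n) - sqrt_iter x n) + norm (sqrt_iter x n - sqrt_iter x m)"
    using norm_triangle_ineq[of "sqrt_iter x (Suc n) - sqrt_iter x n" "sqrt_iter x n - sqrt_iter x m"] by simp
  then show ?case using step norm_sqrt_iter_step[OF assms(1), of n] by linarith
qed simp

text \<open>The root is \<open>1 - y\<close> for the limit \<open>y\<close> of the iterates. The
  bound on \<open>1 - s\<close> will make the root positive in the sense of \<open>kv_pos\<close>,
  and the commutation clause does the work of a functional calculus.\<close>

lemma sqrt_one_minus:
  fixes x :: "'a::cstar"
  assumes x: "norm x \<le> 1"
  obtains s where "s * s = 1 - x" "norm (1 - s) \<le> 1" "invol x = x \<Longrightarrow> invol s = s"
    "\<And>z. z * x = x * z \<Longrightarrow> z * s = s * z"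
proof -
  let ?y = "sqrt_iter x" and ?t = "sqrt_iter (1::real)"
  have "Cauchy ?y"
  proof (rule CauchyI)
    fix e :: real assume "0 < e"
    then obtain N where N: "\<And>m n. m \<ge> N \<Longrightarrow> n \<ge> N \<Longrightarrow> norm (?t m - ?t n) < e"
      using CauchyD[OF Cauchy_sqrt_iter_real] by meson
    have main: "norm (?y n - ?y m) < e" if "N \<le> m" "m \<le> n" for m n
      using norm_sqrt_iter_diff[OF x that(2)] N[of n m] that by auto
    have "norm (?y m - ?y n) < e" if "N \<le> m" "N \<le> n" for m n
      using main[of m n] main[of n m] that by (cases "m \<le> n") (auto simp: norm_minus_commute)
    then show "\<exists>M. \<forall>m\<ge>M. \<forall>n\<ge>M. norm (?y m - ?y n) < e" by blast
  qed
  then obtain y where y: "?y \<longlonglongrightarrow> y" using Cauchy_convergent convergent_def by blast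
  have lim: "(\<lambda>n. ?y (Suc n)) \<longlonglongrightarrow> (1/2) *\<^sub>R (x + y * y)"
    by (simp, intro tendsto_intros y)
  have "(\<lambda>n. ?y (Suc n)) \<longlonglongrightarrow> y" using y by (rule LIMSEQ_Suc)
  then have fix_eq: "y = (1/2) *\<^sub>R (x + y * y)" using lim LIMSEQ_unique by blast
  have "2 *\<^sub>R y = x + y * y" by (subst fix_eq) simp
  then have 1: "(1 - y) * (1 - y) = 1 - x"
    by (simp add: algebra_simps scaleR_2)
  have "norm (?y n) \<le> 1" for n
    using norm_sqrt_iter_le[OF x, of n] sqrt_iter_real_bounds[of n] by linarith
  then have 2: "norm (1 - (1 - y)) \<le> 1"
    using Lim_bounded[OF tendsto_norm[OF y], of 0 1] by simp
  have 3: "invol (1 - y) = 1 - y" if "invol x = x"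
  proof -
    have "invol (?y n) = ?y n" for n
      by (induction n) (auto simp: that invol_scaleR invol_add invol_mult)
    then have "invol y = y" using LIMSEQ_unique[OF tendsto_invol[OF y]] y by simp
    then show ?thesis by (simp add: invol_diff)
  qed
  have 4: "z * (1 - y) = (1 - y) * z" if "z * x = x * z" for z
  proof -
    have "z * ?y n = ?y n * z" for n using sqrt_iter_commute[OF that] .
    moreover have "(\<lambda>n. z * ?y n) \<longlonglongrightarrow> z * y" "(\<lambda>n. ?y n * z) \<longlonglongrightarrow> y * z"
      by (intro tendsto_intros y)+
    ultimately have "z * y = y * z" using LIMSEQ_unique by auto
    then show ?thesis by (simp add: algebra_simps)
  qed
  show thesis using that[OF 1 2 3 4] .
qed

section \<open>Positive elements without spectral theory\<close>

lemma iu_mult_iu_mult: "iu * a * (iu * b) = - (a * b :: 'a::cstar)"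
proof -
  have "iu * a * (iu * b) = a * (iu * iu) * b" by (simp only: iu_central[of a] mult.assoc)
  then show ?thesis by (simp add: iu_sq)
qed

text \<open>The element \<open>u = c + iu * d\<close> is normal with
  \<open>invol u * u = c * c + d * d\<close>, and \<open>c\<close> is its real part, so its norm is
  at most that of \<open>u\<close>.\<close>

lemma norm_self_adjoint_le_sum_squares:
  fixes c d :: "'a::cstar"
  assumes c: "invol c = c" and d: "invol d = d" and comm: "c * d = d * c"
  shows "(norm c)\<^sup>2 \<le> norm (c * c + d * d)"
proof -
  define u where "u = c + iu * d"
  have invol_u: "invol u = c - iu * d"
    by (simp add: u_def invol_add invol_mult c d invol_iu flip: iu_central)
  have "c * (iu * d) = iu * (d * c)" by (metis comm iu_central mult.assoc)
  then have "invol u * u = c * c + d * d"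
    unfolding invol_u using iu_mult_iu_mult[of d d]
    by (simp add: u_def distrib_left left_diff_distrib mult.assoc)
  then have "(norm u)\<^sup>2 = norm (c * c + d * d)" using cstar_identity[of u] by simp
  moreover have "u + invol u = 2 *\<^sub>R c" unfolding invol_u by (simp add: u_def scaleR_2)
  then have "norm (2 *\<^sub>R c) \<le> norm u + norm u" by (metis norm_invol norm_triangle_ineq)
  then have "norm c \<le> norm u" by simp
  then have "(norm c)\<^sup>2 \<le> (norm u)\<^sup>2" by (simp add: power_mono)
  ultimately show ?thesis by simp
qed

text \<open>With a self-adjoint root \<open>s\<close> of \<open>1 - h * h\<close> that commutes with
  \<open>h\<close>, the squares of \<open>s\<close> and \<open>h\<close> add up to 1.\<close>

lemma norm_one_minus_square_le:
  fixes h :: "'a::cstar"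
  assumes h: "invol h = h" "norm h \<le> 1"
  shows "norm (1 - h * h) \<le> 1"
proof -
  have "norm (h * h) \<le> 1" using h by (simp add: norm_mult_self_adjoint abs_square_le_1 power_le_one)
  then obtain s where s: "s * s = 1 - h * h" "invol (h * h) = h * h \<Longrightarrow> invol s = s"
    "\<And>z. z * (h * h) = (h * h) * z \<Longrightarrow> z * s = s * z" using sqrt_one_minus by metis
  have inv_s: "invol s = s" using s(2) h by (simp add: invol_mult)
  have comm: "h * s = s * h" using s(3)[of h] by (simp add: mult.assoc)
  have "(norm s)\<^sup>2 \<le> norm (s * s + h * h)"
    by (rule norm_self_adjoint_le_sum_squares[OF inv_s h(1) comm[symmetric]])
  then show ?thesis using s(1) norm_mult_self_adjoint[OF inv_s] by simp
qed

text \<open>The Kelley--Vaught description of the positive cone, for which additivity is immediate.\<close>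

definition kv_pos :: "'a::cstar \<Rightarrow> bool" where
  "kv_pos a \<longleftrightarrow> invol a = a \<and> (\<exists>t\<ge>0. norm (t *\<^sub>R 1 - a) \<le> t)"

text \<open>After division by the witness \<open>t\<close>, the element \<open>1 - a / t\<close> is
  a contraction and \<open>sqrt_one_minus\<close> applies. The rescaled root satisfies the defining
  inequality of \<open>kv_pos\<close> with witness \<open>sqrt t\<close>.\<close>

lemma kv_pos_sqrt:
  fixes a :: "'a::cstar"
  assumes "kv_pos a"
  obtains s where "invol s = s" "s * s = a" "kv_pos s" "\<And>z. z * a = a * z \<Longrightarrow> z * s = s * z"
proof -
  obtain t where t: "t \<ge> 0" "norm (t *\<^sub>R 1 - a) \<le> t" and inv_a: "invol a = a"
    using assms by (auto simp: kv_pos_def)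
  show thesis
  proof (cases "t = 0")
    case True
    then have "a = 0" using t by simp
    then show thesis using that[of 0] by (auto simp: kv_pos_def intro: exI[of _ 0])
  next
    case False
    with t have tp: "t > 0" by simp
    define x where "x = 1 - (1/t) *\<^sub>R a"
    have "x = (1/t) *\<^sub>R (t *\<^sub>R 1 - a)" using tp by (simp add: x_def algebra_simps)
    then have "norm x \<le> 1" using t tp by simp
    then obtain s where s: "s * s = 1 - x" "norm (1 - s) \<le> 1" "invol x = x \<Longrightarrow> invol s = s"
      "\<And>z. z * x = x * z \<Longrightarrow> z * s = s * z" using sqrt_one_minus by metis
    have inv_s: "invol s = s" using s(3) inv_a by (simp add: x_def invol_diff invol_scaleR)
    show thesis
    proof (rule that[of "sqrt t *\<^sub>R s"])
      show "invol (sqrt t *\<^sub>R s) = sqrt t *\<^sub>R s" by (simp add: invol_scaleR inv_s)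
      show "sqrt t *\<^sub>R s * sqrt t *\<^sub>R s = a" using tp by (simp add: s(1) x_def)
      have "norm (sqrt t *\<^sub>R 1 - sqrt t *\<^sub>R s) = sqrt t * norm (1 - s)"
        using tp by (simp flip: scaleR_right_diff_distrib)
      also have "\<dots> \<le> sqrt t" using s(2) tp by (simp add: mult_left_le)
      finally show "kv_pos (sqrt t *\<^sub>R s)" unfolding kv_pos_def
        using tp by (auto simp: invol_scaleR inv_s intro!: exI[of _ "sqrt t"])
      show "z * sqrt t *\<^sub>R s = sqrt t *\<^sub>R s * z" if "z * a = a * z" for z
        using s(4)[of z] that by (simp add: x_def algebra_simps)
    qed
  qed
qed

lemma norm_diff_square_le:
  fixes h :: "'a::cstar"
  assumes h: "invol h = h" "(norm h)\<^sup>2 \<le> t"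
  shows "norm (t *\<^sub>R 1 - h * h) \<le> t"
proof (cases "t > 0")
  case True
  define k where "k = (1 / sqrt t) *\<^sub>R h"
  have "norm h \<le> sqrt t" using h(2) by (rule real_le_rsqrt)
  then have "norm (1 - k * k) \<le> 1"
    using True h(1) by (intro norm_one_minus_square_le) (auto simp: k_def invol_scaleR field_simps)
  moreover have "t *\<^sub>R 1 - h * h = t *\<^sub>R (1 - k * k)"
    using True by (simp add: k_def scaleR_right_diff_distrib)
  ultimately show ?thesis using True by (simp add: mult_left_le)
next
  case False
  then have "(norm h)\<^sup>2 \<le> 0" using h(2) by linarith
  then have "h = 0" by simp
  then show ?thesis using False h(2) by simp
qed

lemma kv_pos_square: "invol h = h \<Longrightarrow> kv_pos (h * h :: 'a::cstar)"
  unfolding kv_pos_def using norm_diff_square_le[of h "(norm h)\<^sup>2"]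
  by (auto simp: invol_mult intro!: exI[of _ "(norm h)\<^sup>2"])

text \<open>Passing through a square root upgrades the defining inequality from one unknown witness
  to every \<open>t\<close> above the norm; this makes the cone closed.\<close>

lemma kv_pos_bound: "kv_pos a \<Longrightarrow> norm a \<le> t \<Longrightarrow> norm (t *\<^sub>R 1 - a) \<le> t"
  by (metis kv_pos_sqrt norm_diff_square_le norm_mult_self_adjoint)

lemma kv_pos_add: "kv_pos a \<Longrightarrow> kv_pos b \<Longrightarrow> kv_pos (a + b)"
proof -
  assume "kv_pos a" "kv_pos b"
  then obtain s t where "s \<ge> 0" "norm (s *\<^sub>R 1 - a) \<le> s" "t \<ge> 0" "norm (t *\<^sub>R 1 - b) \<le> t"
    and inv: "invol a = a" "invol b = b" by (auto simp: kv_pos_def)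
  then have "norm ((s *\<^sub>R 1 - a) + (t *\<^sub>R 1 - b)) \<le> s + t"
    by (intro order_trans[OF norm_triangle_ineq]) auto
  moreover have "(s *\<^sub>R 1 - a) + (t *\<^sub>R 1 - b) = (s + t) *\<^sub>R 1 - (a + b)" by (simp add: algebra_simps)
  ultimately show "kv_pos (a + b)" unfolding kv_pos_def
    using \<open>s \<ge> 0\<close> \<open>t \<ge> 0\<close> inv by (auto simp: invol_add intro!: exI[of _ "s + t"])
qed

lemma kv_pos_norm_diff: "invol a = a \<Longrightarrow> norm a \<le> t \<Longrightarrow> kv_pos (t *\<^sub>R 1 - a)"
  unfolding kv_pos_def by (auto simp: invol_diff invol_scaleR order_trans[OF norm_ge_zero] intro!: exI[of _ t])

text \<open>For \<open>B\<close> above the norm of \<open>b\<close>, the element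
  \<open>B - a = (B - b) + (b - a)\<close> is positive. The roots of \<open>a\<close> and
  \<open>B - a\<close> commute and their squares add up to \<open>B\<close>.\<close>

lemma kv_pos_norm_mono:
  fixes a :: "'a::cstar"
  assumes a: "kv_pos a" and ba: "kv_pos (b - a)"
  shows "norm a \<le> norm b"
proof -
  have bound: "norm a \<le> B" if "norm b \<le> B" "B > 0" for B
  proof -
    have "invol b = b" using a ba invol_add[of a "b - a"] by (auto simp: kv_pos_def)
    then have "kv_pos (B *\<^sub>R 1 - b)" using that(1) by (rule kv_pos_norm_diff)
    from kv_pos_add[OF this ba] have *: "kv_pos (B *\<^sub>R 1 - a)" by simp
    obtain c where c: "invol c = c" "c * c = a" "\<And>z. z * a = a * z \<Longrightarrow> z * c = c * z"
      using kv_pos_sqrt[OF a] by metis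
    obtain d where d: "invol d = d" "d * d = B *\<^sub>R 1 - a"
        "\<And>z. z * (B *\<^sub>R 1 - a) = (B *\<^sub>R 1 - a) * z \<Longrightarrow> z * d = d * z"
      using kv_pos_sqrt[OF *] by metis
    have "c * a = a * c" by (simp add: c(2)[symmetric] mult.assoc)
    then have comm: "c * d = d * c" by (intro d(3)) (simp add: algebra_simps)
    have "(norm c)\<^sup>2 \<le> norm (c * c + d * d)"
      by (rule norm_self_adjoint_le_sum_squares[OF c(1) d(1) comm])
    then show ?thesis using that norm_mult_self_adjoint[OF c(1)] unfolding c(2) d(2) by simp
  qed
  show ?thesis
  proof (rule field_le_epsilon)
    fix e :: real assume "e > 0"
    then show "norm a \<le> norm b + e" using bound[of "norm b + e"] by (simp add: add_nonneg_pos)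
  qed
qed

lemma kv_pos_antisym: "kv_pos a \<Longrightarrow> kv_pos (- a) \<Longrightarrow> a = (0::'a::cstar)"
  using kv_pos_norm_mono[of a 0] by simp

text \<open>Twice this element is the sum of the squares of the self-adjoint elements
  \<open>e + invol e\<close> and \<open>iu * (e - invol e)\<close>.\<close>

lemma kv_pos_real_imag:
  fixes e :: "'a::cstar"
  shows "kv_pos (invol e * e + e * invol e)"
proof -
  define r s where "r = e + invol e" and "s = iu * (e - invol e)"
  have inv: "invol r = r" "invol s = s"
    by (simp_all add: r_def s_def invol_add invol_mult invol_diff invol_invol invol_iu left_diff_distrib
        right_diff_distrib iu_central add.commute)
  have "s * s = - ((e - invol e) * (e - invol e))"
    unfolding s_def by (rule iu_mult_iu_mult)
  then have "r * r + s * s = 2 *\<^sub>R (invol e * e + e * invol e)"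
    by (simp add: r_def algebra_simps scaleR_2)
  then have "invol e * e + e * invol e = ((1/sqrt 2) *\<^sub>R r) * ((1/sqrt 2) *\<^sub>R r) + ((1/sqrt 2) *\<^sub>R s) * ((1/sqrt 2) *\<^sub>R s)"
    by (simp flip: scaleR_right_distrib)
  moreover have "kv_pos (((1/sqrt 2) *\<^sub>R z) * ((1/sqrt 2) *\<^sub>R z))" if "invol z = z" for z :: 'a
    using that by (intro kv_pos_square) (simp add: invol_scaleR)
  ultimately show ?thesis using kv_pos_add inv by metis
qed

text \<open>The usual proof compares the spectra of \<open>invol c * c\<close> and
  \<open>c * invol c\<close>. Here, for a root \<open>d\<close> of \<open>- (invol c * c)\<close>
  and \<open>e = c * d\<close>, both \<open>invol e * e\<close> and \<open>e * invol e\<close> are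
  negatives of squares, while their sum is positive by \<open>kv_pos_real_imag\<close>; hence all
  vanish.\<close>

lemma neg_invol_mult_eq_0:
  fixes c :: "'a::cstar"
  assumes "kv_pos (- (invol c * c))"
  shows "c = 0"
proof -
  obtain d where d: "invol d = d" "d * d = - (invol c * c)" using kv_pos_sqrt[OF assms] by metis
  define e k where "e = c * d" and "k = c * invol c"
  have ee': "e * invol e = - (k * k)"
  proof -
    have "e * invol e = c * (d * d) * invol c" unfolding e_def invol_mult by (simp add: d(1) mult.assoc)
    then show ?thesis by (simp add: d(2) k_def mult.assoc)
  qed
  have e'e: "invol e * e = - ((d * d) * (d * d))"
  proof -
    have "invol e * e = d * (invol c * c) * d" unfolding e_def invol_mult by (simp add: d(1) mult.assoc)
    also have "invol c * c = - (d * d)" using d(2) by simp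
    finally show ?thesis by (simp add: mult.assoc)
  qed
  have inv: "invol k = k" "invol (d * d) = d * d" by (simp_all add: k_def invol_mult invol_invol d(1))
  have 1: "kv_pos (- (e * invol e))" "kv_pos (- (invol e * e))"
    unfolding ee' e'e using kv_pos_square[OF inv(1)] kv_pos_square[OF inv(2)] by simp_all
  have "kv_pos (- (invol e * e + e * invol e))" using kv_pos_add[OF 1] by (simp add: algebra_simps)
  then have "invol e * e + e * invol e = 0" using kv_pos_antisym kv_pos_real_imag by blast
  then have "invol e * e = - (e * invol e)" by (simp add: add_eq_0_iff2)
  then have "invol e * e = 0" using 1 kv_pos_antisym by metis
  then have "(d * d) * (d * d) = 0" using e'e by simp
  then have "d * d = 0" using inv(2) norm_mult_self_adjoint[of "d * d"] by simp
  then show ?thesis using d invol_mult_eq_0 by simp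
qed

text \<open>With \<open>h = b\<^sup>* b\<close>, \<open>p = \<bar>h\<bar>\<close>, \<open>m = p - h\<close> (twice the negative part of \<open>h\<close>) one has
  \<open>(b m)\<^sup>* (b m) = - p m\<^sup>2 \<le> 0\<close>, which forces \<open>m = 0\<close>.\<close>

lemma kv_pos_invol_mult: "kv_pos (invol b * b :: 'a::cstar)"
proof -
  define h where "h = invol b * b"
  have inv_h: "invol h = h" by (simp add: h_def invol_mult invol_invol)
  obtain p where p: "invol p = p" "p * p = h * h" "kv_pos p" "\<And>z. z * (h * h) = (h * h) * z \<Longrightarrow> z * p = p * z"
    using kv_pos_sqrt[OF kv_pos_square[OF inv_h]] by metis
  obtain q where q: "invol q = q" "q * q = p" "\<And>z. z * p = p * z \<Longrightarrow> z * q = q * z"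
    using kv_pos_sqrt[OF p(3)] by metis
  have hp: "h * p = p * h" by (rule p(4)) (simp add: mult.assoc)
  define m where "m = p - h"
  have inv_m: "invol m = m" by (simp add: m_def invol_diff p inv_h)
  have mp: "m * p = p * m" by (simp add: m_def algebra_simps hp)
  have mq: "m * q = q * m" by (rule q(3)[OF mp])
  have mm: "m * m = 2 *\<^sub>R (p * m)" and hm: "h * m = - (p * m)"
    by (simp_all add: m_def algebra_simps hp p(2) scaleR_2)
  have "invol (b * m) * (b * m) = m * (h * m)" by (simp add: invol_mult inv_m h_def mult.assoc)
  also have "\<dots> = - ((q * m) * (q * m))" unfolding hm using mq q(2) by (simp add: mult.assoc) (metis mult.assoc)
  finally have eq: "invol (b * m) * (b * m) = - ((q * m) * (q * m))" .
  have inv_qm: "invol (q * m) = q * m" by (simp add: invol_mult inv_m q mq)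
  have "b * m = 0" using neg_invol_mult_eq_0[of "b * m"] eq kv_pos_square[OF inv_qm] by simp
  then have "(q * m) * (q * m) = 0" using eq by simp
  then have "q * m = 0" using inv_qm norm_mult_self_adjoint[of "q * m"] by simp
  then have "p * m = 0" using q(2) mult.assoc[of q q m] by simp
  then have "m * m = 0" using mm by simp
  then have "m = 0" using inv_m norm_mult_self_adjoint[of m] by simp
  then show ?thesis using p(3) by (simp add: m_def h_def)
qed

section \<open>Order properties of the positive cone\<close>

lemma cpos_iff_kv_pos: "cpos a \<longleftrightarrow> kv_pos a"
  by (metis cpos_def kv_pos_invol_mult kv_pos_sqrt)

lemma cpos_invol: "cpos a \<Longrightarrow> invol a = a"
  by (auto simp: cpos_def invol_mult invol_invol)

lemma cpos_0 [simp]: "cpos 0"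
  by (auto simp: cpos_def intro: exI[of _ 0])

lemma cpos_invol_mult [simp]: "cpos (invol b * b)"
  by (auto simp: cpos_def)

lemma cpos_add: "cpos a \<Longrightarrow> cpos b \<Longrightarrow> cpos (a + b)"
  by (simp add: cpos_iff_kv_pos kv_pos_add)

lemma cpos_sum: "(\<And>i. i \<in> I \<Longrightarrow> cpos (f i)) \<Longrightarrow> cpos (\<Sum>i\<in>I. f i)"
  by (induction I rule: infinite_finite_induct) (auto intro: cpos_add)

lemma cpos_conj: "cpos a \<Longrightarrow> cpos (invol c * a * c)"
proof -
  assume "cpos a"
  then obtain b where "a = invol b * b" by (auto simp: cpos_def)
  then have "invol c * a * c = invol (b * c) * (b * c)" by (simp add: invol_mult mult.assoc)
  then show ?thesis by simp
qed

lemma cpos_scaleR: "cpos a \<Longrightarrow> r \<ge> 0 \<Longrightarrow> cpos (r *\<^sub>R a)"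
  using cpos_conj[of a "sqrt r *\<^sub>R 1"] by (simp add: invol_scaleR)

lemma cpos_norm_diff: "invol a = a \<Longrightarrow> norm a \<le> t \<Longrightarrow> cpos (t *\<^sub>R 1 - a)"
  by (simp add: cpos_iff_kv_pos kv_pos_norm_diff)

lemma cpos_norm_mono: "cpos a \<Longrightarrow> cpos (b - a) \<Longrightarrow> norm a \<le> norm b"
  by (simp add: cpos_iff_kv_pos kv_pos_norm_mono)

lemma cpos_norm_conj_diff:
  assumes "cpos a" "norm a \<le> t" shows "cpos (t *\<^sub>R (invol c * c) - invol c * a * c)"
  using cpos_conj[OF cpos_norm_diff[OF cpos_invol[OF assms(1)] assms(2)], of c]
  by (simp add: algebra_simps)

text \<open>By \<open>kv_pos_bound\<close> the witness may be taken to be the norm of the element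
  itself, and the resulting inequality passes to limits.\<close>

lemma cpos_tendsto:
  assumes lim: "(u \<longlongrightarrow> a) F" and F: "F \<noteq> bot" and pos: "eventually (\<lambda>n. cpos (u n)) F"
  shows "cpos a"
proof -
  have "((\<lambda>n. invol (u n)) \<longlongrightarrow> a) F"
    using lim by (rule Lim_transform_eventually) (use pos in eventually_elim, simp add: cpos_invol)
  then have inv: "invol a = a" using tendsto_unique[OF F tendsto_invol[OF lim]] by blast
  have "((\<lambda>n. norm (norm (u n) *\<^sub>R 1 - u n)) \<longlongrightarrow> norm (norm a *\<^sub>R 1 - a)) F"
    by (intro tendsto_intros lim)
  moreover have "eventually (\<lambda>n. norm (norm (u n) *\<^sub>R 1 - u n) \<le> norm (u n)) F"
    using pos by eventually_elim (simp add: cpos_iff_kv_pos kv_pos_bound)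
  ultimately have "norm (norm a *\<^sub>R 1 - a) \<le> norm a"
    using tendsto_le[OF F tendsto_norm[OF lim]] by blast
  then show ?thesis using inv by (auto simp: cpos_iff_kv_pos kv_pos_def intro: exI[of _ "norm a"])
qed

lemma cpos_LIMSEQ: "u \<longlonglongrightarrow> a \<Longrightarrow> (\<And>n. cpos (u n)) \<Longrightarrow> cpos a"
  by (rule cpos_tendsto) auto

text \<open>Positivity of \<open>\<langle>x a + y, x a + y\<rangle>\<close> at \<open>a = - \<langle>x, y\<rangle> / t\<close>.\<close>

lemma cauchy_schwarz_cstar:
  fixes p q r :: "'a::cstar"
  assumes p: "cpos p" and pos: "\<And>a. cpos (invol a * p * a + invol a * q + invol q * a + r)"
  shows "(norm q)\<^sup>2 \<le> norm p * norm r"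
proof -
  \<comment> \<open>Strict inequality makes \<open>t\<close> positive even for \<open>p = 0\<close>,
    so that division by \<open>t\<close> is possible.\<close>
  have bound: "(norm q)\<^sup>2 \<le> t * norm r" if t: "norm p < t" for t
  proof -
    have tp: "t > 0" using t norm_ge_zero[of p] by linarith
    have 1: "cpos (r + (1/t\<^sup>2) *\<^sub>R (invol q * p * q) - (2/t) *\<^sub>R (invol q * q))"
      using pos[of "- (1/t) *\<^sub>R q"] by (simp add: invol_minus invol_scaleR power2_eq_square algebra_simps flip: scaleR_left_distrib)
    have 2: "cpos ((1/t\<^sup>2) *\<^sub>R (t *\<^sub>R (invol q * q) - invol q * p * q))"
      using cpos_norm_conj_diff[OF p, of t q] t by (intro cpos_scaleR) auto
    have "(1/t\<^sup>2) *\<^sub>R (t *\<^sub>R (invol q * q) - invol q * p * q) = (1/t) *\<^sub>R (invol q * q) - (1/t\<^sup>2) *\<^sub>R (invol q * p * q)"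
      using tp by (simp add: scaleR_right_diff_distrib power2_eq_square)
    moreover have "(2/t) *\<^sub>R (invol q * q) = (1/t) *\<^sub>R (invol q * q) + (1/t) *\<^sub>R (invol q * q)"
      by (simp flip: scaleR_left_distrib)
    ultimately have "r + (1/t\<^sup>2) *\<^sub>R (invol q * p * q) - (2/t) *\<^sub>R (invol q * q)
        + (1/t\<^sup>2) *\<^sub>R (t *\<^sub>R (invol q * q) - invol q * p * q) = r - (1/t) *\<^sub>R (invol q * q)" by (simp only:) simp
    then have "cpos (r - (1/t) *\<^sub>R (invol q * q))" using cpos_add[OF 1 2] by (simp only:)
    moreover have "cpos ((1/t) *\<^sub>R (invol q * q))" using tp by (intro cpos_scaleR) auto
    ultimately have "norm ((1/t) *\<^sub>R (invol q * q)) \<le> norm r" by (rule cpos_norm_mono[rotated])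
    then show ?thesis using tp by (simp add: cstar_identity field_simps)
  qed
  show ?thesis
  proof (rule field_le_epsilon)
    fix e :: real assume e: "e > 0"
    define d where "d = e / (norm r + 1)"
    have d: "d > 0" using e by (simp add: d_def add_nonneg_pos)
    have "d * norm r \<le> d * (norm r + 1)" using d by simp
    also have "\<dots> = e" using add_nonneg_pos[OF norm_ge_zero[of r] zero_less_one] by (simp add: d_def)
    finally show "(norm q)\<^sup>2 \<le> norm p * norm r + e" using bound[of "norm p + d"] d
      by (simp add: algebra_simps)
  qed
qed

section \<open>Hilbert modules\<close>

lemma cscale_of_real_one: "cscale (complex_of_real r) 1 = r *\<^sub>R (1::'a::cstar)"
  by (simp add: cscale_def)

lemma inverse_one_minus:
  fixes y :: "'a::{real_normed_algebra_1,banach}"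
  assumes "norm y < 1"
  obtains z where "z * (1 - y) = 1" "(1 - y) * z = 1"
proof -
  have s: "summable (\<lambda>n. y ^ n)" by (rule complete_algebra_summable_geometric[OF assms])
  have tail: "(\<Sum>n. y ^ Suc n) = (\<Sum>n. y ^ n) - 1" using suminf_split_head[OF s] by simp
  have "(\<Sum>n. y ^ n) * y = (\<Sum>n. y ^ Suc n)" "y * (\<Sum>n. y ^ n) = (\<Sum>n. y ^ Suc n)"
    using suminf_mult2[OF s, of y] suminf_mult[OF s, of y] by (simp_all add: power_commutes)
  then show thesis using tail by (intro that[of "\<Sum>n. y ^ n"]) (simp_all add: algebra_simps)
qed

text \<open>With \<open>t = norm p + e\<close> one has \<open>p + e = t (1 - y)\<close> where
  \<open>y\<close> has norm at most \<open>norm p / t < 1\<close>, so a Neumann series inverts it.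
  If \<open>w\<close> inverts \<open>s * s\<close>, then \<open>w * s\<close> inverts
  \<open>s\<close>.\<close>

lemma cpos_inverse_sqrt:
  fixes p :: "'a::cstar"
  assumes p: "cpos p" and e: "e > 0"
  obtains h s where "invol h = h" "invol s = s" "s * s = p + e *\<^sub>R 1" "h * s = 1" "s * h = 1"
proof -
  define t where "t = norm p + e"
  have t: "t > 0" using e by (simp add: t_def add_nonneg_pos)
  define y where "y = (1/t) *\<^sub>R (norm p *\<^sub>R 1 - p)"
  have "norm (norm p *\<^sub>R 1 - p) \<le> norm p" using p by (intro kv_pos_bound) (auto simp: cpos_iff_kv_pos)
  then have "norm y < 1" using t e by (simp add: y_def t_def)
  then obtain z where z: "z * (1 - y) = 1" "(1 - y) * z = 1" using inverse_one_minus by metis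
  have pe: "p + e *\<^sub>R 1 = t *\<^sub>R (1 - y)"
    using t by (simp add: y_def scaleR_right_diff_distrib) (simp add: t_def algebra_simps)
  have "cpos (e *\<^sub>R (1::'a))" using cpos_scaleR[of "1::'a" e] cpos_invol_mult[of 1] e by simp
  then have "cpos (p + e *\<^sub>R 1)" using p by (rule cpos_add[rotated])
  then obtain s where s: "invol s = s" "s * s = p + e *\<^sub>R 1"
    using kv_pos_sqrt cpos_iff_kv_pos by metis
  define w where "w = (1/t) *\<^sub>R z"
  have w: "w * (s * s) = 1" "(s * s) * w = 1" using t z by (simp_all add: s pe w_def)
  have hs: "(w * s) * s = 1" "s * (s * w) = 1" using w by (simp_all add: mult.assoc)
  then have eq: "w * s = s * w" by (metis mult.assoc mult_1_left mult_1_right)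
  have "invol (w * s) = invol (w * s) * (s * (w * s))" using hs eq by simp
  also have "\<dots> = invol (s * (w * s)) * (w * s)" by (simp add: invol_mult s mult.assoc)
  also have "\<dots> = w * s" using hs eq by simp
  finally show thesis using that[of "w * s" s] s hs eq by simp
qed

section \<open>Vector calculus in a Hilbert module\<close>

locale hmod =
  fixes X :: "'x::ab_group_add set" and rm :: "'x \<Rightarrow> 'a::cstar \<Rightarrow> 'x" and ip :: "'x \<Rightarrow> 'x \<Rightarrow> 'a"
  assumes hm: "hilbert_module X rm ip"
begin

abbreviation "hn \<equiv> hnorm ip"

abbreviation "nrm \<equiv> opnorm X ip"

lemma zero_mem [simp]: "0 \<in> X"
  and add_mem [simp]: "x \<in> X \<Longrightarrow> y \<in> X \<Longrightarrow> x + y \<in> X"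
  and minus_mem [simp]: "x \<in> X \<Longrightarrow> - x \<in> X"
  and rm_mem [simp]: "x \<in> X \<Longrightarrow> rm x a \<in> X"
  and rm_add_left: "x \<in> X \<Longrightarrow> y \<in> X \<Longrightarrow> rm (x + y) a = rm x a + rm y a"
  and rm_add_right: "x \<in> X \<Longrightarrow> rm x (a + b) = rm x a + rm x b"
  and rm_rm: "x \<in> X \<Longrightarrow> rm (rm x a) b = rm x (a * b)"
  and rm_one [simp]: "x \<in> X \<Longrightarrow> rm x 1 = x"
  and ip_add_right: "x \<in> X \<Longrightarrow> y \<in> X \<Longrightarrow> z \<in> X \<Longrightarrow> ip x (y + z) = ip x y + ip x z"
  and ip_rm_right: "x \<in> X \<Longrightarrow> y \<in> X \<Longrightarrow> ip x (rm y a) = ip x y * a"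
  and invol_ip: "x \<in> X \<Longrightarrow> y \<in> X \<Longrightarrow> invol (ip x y) = ip y x"
  and cpos_ip [simp]: "x \<in> X \<Longrightarrow> cpos (ip x x)"
  using hm unfolding hilbert_module_def by (elim conjE; simp; fail)+

lemma ip_self_eq_0: "x \<in> X \<Longrightarrow> ip x x = 0 \<Longrightarrow> x = 0"
proof -
  have "\<forall>x\<in>X. ip x x = 0 \<longrightarrow> x = 0" using hm unfolding hilbert_module_def by (elim conjE)
  then show "x \<in> X \<Longrightarrow> ip x x = 0 \<Longrightarrow> x = 0" by (auto dest: bspec)
qed

lemma complete:
  assumes "\<And>n. s n \<in> X" "\<And>e. e > 0 \<Longrightarrow> \<exists>N. \<forall>m\<ge>N. \<forall>n\<ge>N. hn (s m - s n) < e"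
  obtains l where "l \<in> X" "(\<lambda>n. hn (s n - l)) \<longlonglongrightarrow> 0"
proof -
  have "(\<forall>n. s n \<in> X) \<and> (\<forall>e>0. \<exists>N. \<forall>m\<ge>N. \<forall>n\<ge>N. hn (s m - s n) < e)" using assms by blast
  moreover have "\<forall>s::nat \<Rightarrow> 'x. (\<forall>n. s n \<in> X) \<and> (\<forall>e>0. \<exists>N. \<forall>m\<ge>N. \<forall>n\<ge>N. hn (s m - s n) < e)
          \<longrightarrow> (\<exists>l\<in>X. \<forall>e>0. \<exists>N. \<forall>n\<ge>N. hn (s n - l) < e)"
    using hm unfolding hilbert_module_def by (elim conjE)
  ultimately have "\<exists>l\<in>X. \<forall>e>0. \<exists>N. \<forall>n\<ge>N. hn (s n - l) < e" 
    by (rule mp[OF spec[of _ s], rotated])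
  then obtain l where l: "l \<in> X" "\<forall>e>0. \<exists>N. \<forall>n\<ge>N. hn (s n - l) < e" by (rule bexE)
  have "(\<lambda>n. hn (s n - l)) \<longlonglongrightarrow> 0"
    unfolding LIMSEQ_iff using l(2) by (simp add: hnorm_def)
  then show thesis using l(1) that by blast
qed

lemma diff_mem [simp]: "x \<in> X \<Longrightarrow> y \<in> X \<Longrightarrow> x - y \<in> X"
  using add_mem[of x "- y"] by simp

lemma sum_mem [simp]: "(\<And>i. i \<in> I \<Longrightarrow> f i \<in> X) \<Longrightarrow> (\<Sum>i\<in>I. f i) \<in> X"
  by (induction I rule: infinite_finite_induct) auto

lemma rm_zero_left [simp]: "rm 0 a = 0"
  using rm_add_left[of 0 0 a] by simp

lemma rm_zero_right [simp]: "x \<in> X \<Longrightarrow> rm x 0 = 0"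
  using rm_add_right[of x 0 0] by simp

lemma rm_minus_left: "x \<in> X \<Longrightarrow> rm (- x) a = - rm x a"
  using rm_add_left[of x "- x" a] by (simp add: eq_neg_iff_add_eq_0 add.commute)

lemma rm_diff_left: "x \<in> X \<Longrightarrow> y \<in> X \<Longrightarrow> rm (x - y) a = rm x a - rm y a"
  using rm_add_left[of x "- y" a] by (simp add: rm_minus_left)

lemma rm_minus_right: "x \<in> X \<Longrightarrow> rm x (- a) = - rm x a"
  using rm_add_right[of x a "- a"] by (simp add: eq_neg_iff_add_eq_0 add.commute)

lemma ip_zero_right [simp]: "x \<in> X \<Longrightarrow> ip x 0 = 0"
  using ip_add_right[of x 0 0] by simp

lemma ip_minus_right: "x \<in> X \<Longrightarrow> y \<in> X \<Longrightarrow> ip x (- y) = - ip x y"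
  using ip_add_right[of x y "- y"] by (simp add: eq_neg_iff_add_eq_0 add.commute)

lemma ip_diff_right: "x \<in> X \<Longrightarrow> y \<in> X \<Longrightarrow> z \<in> X \<Longrightarrow> ip x (y - z) = ip x y - ip x z"
  using ip_add_right[of x y "- z"] by (simp add: ip_minus_right)

lemma ip_sum_right: "x \<in> X \<Longrightarrow> (\<And>i. i \<in> I \<Longrightarrow> f i \<in> X) \<Longrightarrow> ip x (\<Sum>i\<in>I. f i) = (\<Sum>i\<in>I. ip x (f i))"
  by (induction I rule: infinite_finite_induct) (auto simp: ip_add_right)

lemma ip_add_left: "x \<in> X \<Longrightarrow> y \<in> X \<Longrightarrow> z \<in> X \<Longrightarrow> ip (x + y) z = ip x z + ip y z"
  by (metis add_mem invol_add invol_ip ip_add_right)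

lemma ip_rm_left: "x \<in> X \<Longrightarrow> y \<in> X \<Longrightarrow> ip (rm x a) y = invol a * ip x y"
  by (metis invol_ip invol_mult ip_rm_right rm_mem)

lemma ip_zero_left [simp]: "x \<in> X \<Longrightarrow> ip 0 x = 0"
  by (metis invol_ip invol_zero ip_zero_right zero_mem)

lemma ip_minus_left: "x \<in> X \<Longrightarrow> y \<in> X \<Longrightarrow> ip (- x) y = - ip x y"
  by (metis invol_ip invol_minus ip_minus_right minus_mem)

lemma ip_diff_left: "x \<in> X \<Longrightarrow> y \<in> X \<Longrightarrow> z \<in> X \<Longrightarrow> ip (x - y) z = ip x z - ip y z"
  by (metis diff_mem invol_diff invol_ip ip_diff_right)

lemma ip_sum_left: "x \<in> X \<Longrightarrow> (\<And>i. i \<in> I \<Longrightarrow> f i \<in> X) \<Longrightarrow> ip (\<Sum>i\<in>I. f i) x = (\<Sum>i\<in>I. ip (f i) x)"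
  by (induction I rule: infinite_finite_induct) (auto simp: ip_add_left)

lemma eq_if_ip_eq:
  assumes "x \<in> X" "y \<in> X" "\<And>z. z \<in> X \<Longrightarrow> ip z x = ip z y" shows "x = y"
  using ip_self_eq_0[of "x - y"] assms by (simp add: ip_diff_right)

lemma hn_nonneg [simp]: "hn x \<ge> 0"
  by (simp add: hnorm_def)

lemma hn_square: "(hn x)\<^sup>2 = norm (ip x x)"
  by (simp add: hnorm_def)

lemma hn_zero [simp]: "hn 0 = 0"
  by (simp add: hnorm_def)

lemma hn_eq_0: "x \<in> X \<Longrightarrow> hn x = 0 \<Longrightarrow> x = 0"
  by (simp add: hnorm_def ip_self_eq_0)

lemma norm_ip_le: "x \<in> X \<Longrightarrow> y \<in> X \<Longrightarrow> norm (ip x y) \<le> hn x * hn y"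
proof -
  assume xy: "x \<in> X" "y \<in> X"
  have "cpos (invol a * ip x x * a + invol a * ip x y + invol (ip x y) * a + ip y y)" for a
    using cpos_ip[of "rm x a + y"] xy
    by (simp add: ip_add_left ip_add_right ip_rm_left ip_rm_right invol_ip algebra_simps)
  then have "(norm (ip x y))\<^sup>2 \<le> norm (ip x x) * norm (ip y y)"
    using xy by (intro cauchy_schwarz_cstar) auto
  then have "(norm (ip x y))\<^sup>2 \<le> (hn x * hn y)\<^sup>2" by (simp add: hn_square power_mult_distrib)
  then show ?thesis by (rule power2_le_imp_le) simp
qed

lemma hn_triangle: "x \<in> X \<Longrightarrow> y \<in> X \<Longrightarrow> hn (x + y) \<le> hn x + hn y"
proof -
  assume xy: "x \<in> X" "y \<in> X"
  have "(hn (x + y))\<^sup>2 = norm ((ip x x + ip y y) + (ip x y + ip y x))"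
    using xy by (simp add: hn_square ip_add_left ip_add_right algebra_simps)
  also have "\<dots> \<le> (norm (ip x x) + norm (ip y y)) + (norm (ip x y) + norm (ip y x))"
    by (meson add_mono norm_triangle_ineq order_trans)
  also have "\<dots> \<le> ((hn x)\<^sup>2 + (hn y)\<^sup>2) + (hn x * hn y + hn y * hn x)"
    using xy by (intro add_mono) (auto simp: hn_square norm_ip_le)
  also have "\<dots> = (hn x + hn y)\<^sup>2" by (simp add: power2_sum)
  finally show ?thesis by (rule power2_le_imp_le) simp
qed

lemma hn_minus [simp]: "x \<in> X \<Longrightarrow> hn (- x) = hn x"
  by (simp add: hnorm_def ip_minus_left ip_minus_right)

lemma hn_diff_commute: "x \<in> X \<Longrightarrow> y \<in> X \<Longrightarrow> hn (x - y) = hn (y - x)"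
  using hn_minus[of "x - y"] by simp

lemma hn_diff_triangle: "x \<in> X \<Longrightarrow> y \<in> X \<Longrightarrow> z \<in> X \<Longrightarrow> hn (x - z) \<le> hn (x - y) + hn (y - z)"
  using hn_triangle[of "x - y" "y - z"] by simp

lemma hn_le_diff: "x \<in> X \<Longrightarrow> y \<in> X \<Longrightarrow> hn x \<le> hn (x - y) + hn y"
  using hn_triangle[of "x - y" y] by simp

lemma hn_rm_le: "x \<in> X \<Longrightarrow> hn (rm x a) \<le> hn x * norm a"
proof -
  assume x: "x \<in> X"
  have "(hn (rm x a))\<^sup>2 = norm (invol a * ip x x * a)"
    using x by (simp add: hn_square ip_rm_left ip_rm_right mult.assoc)
  also have "\<dots> \<le> norm a * norm (ip x x) * norm a"
    by (intro order_trans[OF norm_mult_ineq] mult_right_mono) (auto intro: order_trans[OF norm_mult_ineq])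
  also have "\<dots> = (hn x * norm a)\<^sup>2" by (simp add: hn_square[symmetric] power_mult_distrib) (simp add: power2_eq_square)
  finally show ?thesis by (rule power2_le_imp_le) simp
qed

lemma hn_rm_scaleR: "x \<in> X \<Longrightarrow> hn (rm x (r *\<^sub>R 1)) = \<bar>r\<bar> * hn x"
  by (simp add: hnorm_def ip_rm_left ip_rm_right invol_scaleR real_sqrt_mult)

text \<open>The carrier has no topology of its own, so convergence in the module is throughout
  expressed by \<open>hn\<close> of the difference tending to 0.\<close>

lemma tendsto_ip:
  assumes u: "\<And>n. u n \<in> X" "l \<in> X" "(\<lambda>n. hn (u n - l)) \<longlonglongrightarrow> 0"
    and w: "\<And>n. w n \<in> X" "m \<in> X" "(\<lambda>n. hn (w n - m)) \<longlonglongrightarrow> 0"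
  shows "(\<lambda>n. ip (u n) (w n)) \<longlonglongrightarrow> ip l m"
proof (rule LIM_zero_cancel, rule tendsto_norm_zero_cancel, rule tendsto_sandwich[OF _ _ tendsto_const])
  let ?b = "\<lambda>n. hn (u n - l) * (hn (w n - m) + hn m) + hn l * hn (w n - m)"
  have "norm (ip (u n) (w n) - ip l m) \<le> ?b n" for n
  proof -
    have "ip (u n) (w n) - ip l m = ip (u n - l) (w n) + ip l (w n - m)"
      using u w by (simp add: ip_diff_left ip_diff_right)
    also have "norm \<dots> \<le> hn (u n - l) * hn (w n) + hn l * hn (w n - m)"
      using u w by (intro order_trans[OF norm_triangle_ineq] add_mono norm_ip_le) auto
    also have "\<dots> \<le> ?b n" using hn_le_diff[of "w n" m] w by (intro add_mono mult_left_mono) auto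
    finally show ?thesis .
  qed
  then show "\<forall>\<^sub>F n in sequentially. norm (ip (u n) (w n) - ip l m) \<le> ?b n" by simp
  have "?b \<longlonglongrightarrow> 0 * (0 + hn m) + hn l * 0" by (intro tendsto_intros u w)
  then show "?b \<longlonglongrightarrow> 0" by simp
qed auto

lemma LIMSEQ_hn_unique:
  assumes "\<And>n. u n \<in> X" "l \<in> X" "m \<in> X" "(\<lambda>n. hn (u n - l)) \<longlonglongrightarrow> 0" "(\<lambda>n. hn (u n - m)) \<longlonglongrightarrow> 0"
  shows "l = m"
proof -
  have "(\<lambda>n. hn (u n - l) + hn (u n - m)) \<longlonglongrightarrow> 0 + 0" by (intro tendsto_intros assms)
  moreover have "hn (l - m) \<le> hn (u n - l) + hn (u n - m)" for n
    using hn_diff_triangle[of l "u n" m] hn_diff_commute[of l "u n"] assms by simp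
  ultimately have "hn (l - m) \<le> 0 + 0" by (intro LIMSEQ_le_const) auto
  then show ?thesis using hn_eq_0[of "l - m"] assms hn_nonneg[of "l - m"] by simp
qed

text \<open>A relational adjoint: \<open>S\<close> is constrained only on \<open>X\<close>, so
  formulas that make sense off the carrier can serve as adjoints directly.\<close>

definition adj_pair :: "('x \<Rightarrow> 'x) \<Rightarrow> ('x \<Rightarrow> 'x) \<Rightarrow> bool" where
  "adj_pair T S \<longleftrightarrow> (\<forall>x\<in>X. T x \<in> X) \<and> (\<forall>x\<in>X. S x \<in> X) \<and> (\<forall>x\<in>X. \<forall>y\<in>X. ip (T x) y = ip x (S y))"

lemma adjointable_iff: "adjointable X ip T \<longleftrightarrow> (\<exists>S. adj_pair T S)"
  by (auto simp: adjointable_def adj_pair_def)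

lemma adj_pair_sym: "adj_pair T S \<Longrightarrow> adj_pair S T"
  unfolding adj_pair_def by (metis invol_ip)

lemma adj_pairD:
  assumes "adj_pair T S"
  shows "x \<in> X \<Longrightarrow> T x \<in> X" "x \<in> X \<Longrightarrow> S x \<in> X" "x \<in> X \<Longrightarrow> y \<in> X \<Longrightarrow> ip (T x) y = ip x (S y)"
    "x \<in> X \<Longrightarrow> y \<in> X \<Longrightarrow> ip x (T y) = ip (S x) y"
  using assms adj_pair_sym[OF assms] by (auto simp: adj_pair_def)

text \<open>Adjointability does not include linearity. It follows by moving the operator across the
  inner product and comparing against all vectors.\<close>

lemma adjointable_linear:
  assumes "adjointable X ip T"
  shows "x \<in> X \<Longrightarrow> T x \<in> X" "x \<in> X \<Longrightarrow> y \<in> X \<Longrightarrow> T (x + y) = T x + T y"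
    "x \<in> X \<Longrightarrow> T (rm x a) = rm (T x) a" "T 0 = 0"
    "x \<in> X \<Longrightarrow> y \<in> X \<Longrightarrow> T (x - y) = T x - T y"
    "(\<And>i. i \<in> I \<Longrightarrow> f i \<in> X) \<Longrightarrow> T (\<Sum>i\<in>I. f i) = (\<Sum>i\<in>I. T (f i))"
proof -
  obtain S where S: "adj_pair T S" using assms adjointable_iff by blast
  note D = adj_pairD[OF S]
  show mem: "x \<in> X \<Longrightarrow> T x \<in> X" for x by (rule D)
  show add: "x \<in> X \<Longrightarrow> y \<in> X \<Longrightarrow> T (x + y) = T x + T y" for x y
    by (rule eq_if_ip_eq) (auto simp: D ip_add_right)
  show "x \<in> X \<Longrightarrow> T (rm x a) = rm (T x) a"
    by (rule eq_if_ip_eq) (auto simp: D ip_rm_right)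
  show zero: "T 0 = 0" using add[of 0 0] by simp
  show "x \<in> X \<Longrightarrow> y \<in> X \<Longrightarrow> T (x - y) = T x - T y"
    by (rule eq_if_ip_eq) (auto simp: D ip_diff_right)
  show "(\<And>i. i \<in> I \<Longrightarrow> f i \<in> X) \<Longrightarrow> T (\<Sum>i\<in>I. f i) = (\<Sum>i\<in>I. T (f i))"
    by (induction I rule: infinite_finite_induct) (auto simp: zero add)
qed

text \<open>The square of \<open>hn (S y)\<close> is the norm of \<open>ip (T (S y)) y\<close>. An
  arbitrary constant \<open>K\<close> is kept so that the lemma also transfers Cauchy and
  approximation estimates from operators to their adjoints.\<close>

lemma adj_pair_bound:
  assumes TS: "adj_pair T S" and K: "\<And>x. x \<in> X \<Longrightarrow> hn (T x) \<le> K * hn x" and y: "y \<in> X"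
  shows "hn (S y) \<le> K * hn y"
proof (cases "hn (S y) = 0")
  case True
  show ?thesis
  \<comment> \<open>A negative \<open>K\<close> can only occur when \<open>y\<close> has norm 0,
    since the bound also holds for \<open>T y\<close>.\<close>
  proof (cases "K \<ge> 0")
    case False
    then have "K * hn y < 0 \<or> hn y = 0" using hn_nonneg[of y] by (auto simp: mult_less_0_iff simp del: hn_nonneg)
    then show ?thesis using K[OF y] hn_nonneg[of "T y"] True by auto
  qed (use True in simp)
next
  case False
  note D = adj_pairD[OF TS]
  have "(hn (S y))\<^sup>2 = norm (ip (T (S y)) y)" using y by (simp add: hn_square D)
  also have "\<dots> \<le> hn (T (S y)) * hn y" using y D by (intro norm_ip_le) auto
  also have "\<dots> \<le> K * hn (S y) * hn y" using y D K by (intro mult_right_mono) auto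
  finally have "hn (S y) * hn (S y) \<le> hn (S y) * (K * hn y)" by (simp add: power2_eq_square mult_ac)
  then show ?thesis using False hn_nonneg[of "S y"] by (simp add: less_le)
qed

text \<open>Uniform boundedness of the functionals \<open>\<langle>T z, \<cdot>\<rangle>\<close>, \<open>\<parallel>z\<parallel> \<le> 1\<close>, by a gliding hump.\<close>

lemma adj_pair_bounded:
  assumes TS: "adj_pair T S"
  obtains K where "K \<ge> 0" "\<And>x. x \<in> X \<Longrightarrow> hn (T x) \<le> K * hn x"
proof (rule ccontr)
  assume neg: "\<not> thesis"
  note bounded = that
  note D = adj_pairD[OF TS]
  have lin: "adjointable X ip T" using TS adjointable_iff by blast
  note T = adjointable_linear[OF lin]
  \<comment> \<open>The rate 4 is matched with perturbations of size \<open>(1/3) ^ n\<close>: all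
    perturbations after step n add up to at most \<open>(1/3) ^ n / 2\<close>, half of the hump of
    that step, and what remains grows like \<open>(4/3) ^ n\<close>.\<close>
  have "\<exists>z\<in>X. hn z \<le> 1 \<and> 4 ^ n \<le> hn (T z)" for n :: nat
  proof -
    obtain x where x: "x \<in> X" "hn (T x) > 4 ^ n * hn x"
      using neg bounded[of "4 ^ n"] by (metis not_le zero_le_numeral zero_le_power)
    have "hn x \<noteq> 0"
    proof
      assume "hn x = 0"
      then have "x = 0" using hn_eq_0 x by blast
      then show False using x T(4) by simp
    qed
    then have pos: "hn x > 0" using hn_nonneg[of x] by linarith
    have "hn (rm x ((1 / hn x) *\<^sub>R 1)) \<le> 1" using x pos by (simp add: hn_rm_scaleR)
    moreover have "hn (T (rm x ((1 / hn x) *\<^sub>R 1))) = hn (T x) / hn x"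
      using x pos by (simp add: T hn_rm_scaleR)
    moreover have "4 ^ n \<le> hn (T x) / hn x" using x pos by (simp add: pos_le_divide_eq)
    ultimately show ?thesis using rm_mem[OF x(1)] by (intro bexI[of _ "rm x ((1 / hn x) *\<^sub>R 1)"]) auto
  qed
  then obtain z where z: "\<And>n. z n \<in> X" "\<And>n. hn (z n) \<le> 1" "\<And>n. 4 ^ n \<le> hn (T (z n))" by metis
  define t where "t n = hn (T (z n))" for n
  have t: "t n \<ge> 4 ^ n" "t n > 0" for n
    using z(3)[of n] zero_less_power[of "4::real" n] unfolding t_def by linarith+
  define w where "w n = rm (T (z n)) ((1 / t n) *\<^sub>R 1)" for n
  define \<phi> where "\<phi> n y = ip (T (z n)) y" for n y
  have w: "w n \<in> X" "hn (w n) = 1" for n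
    using z t(2)[of n] by (simp_all add: w_def T hn_rm_scaleR) (simp add: t_def)
  have "\<phi> n (w n) = (1 / t n) *\<^sub>R ip (T (z n)) (T (z n))" for n
    using z by (simp add: \<phi>_def w_def T ip_rm_right)
  then have "norm (\<phi> n (w n)) = (1 / t n) * (t n)\<^sup>2" for n
    using t(2)[of n] by (simp add: t_def hn_square)
  then have \<phi>w: "norm (\<phi> n (w n)) = t n" for n using t(2)[of n] by (simp add: power2_eq_square)
  have \<phi>_le: "norm (\<phi> n y) \<le> t n * hn y" if "y \<in> X" for n y
    unfolding \<phi>_def t_def using z that by (intro norm_ip_le) (auto simp: T)
  define r where "r n = rm (w n) ((1/3) ^ n *\<^sub>R 1)" for n
  have r: "r n \<in> X" "hn (r n) = (1/3) ^ n" "norm (\<phi> n (r n)) = (1/3) ^ n * t n" for n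
  proof -
    show "r n \<in> X" "hn (r n) = (1/3) ^ n" using w by (simp_all add: r_def hn_rm_scaleR)
    have "\<phi> n (r n) = (1/3) ^ n *\<^sub>R \<phi> n (w n)" using w z by (simp add: r_def \<phi>_def T ip_rm_right)
    then show "norm (\<phi> n (r n)) = (1/3) ^ n * t n" using \<phi>w by simp
  qed
  define y where "y = rec_nat 0 (\<lambda>n u. if (1/3) ^ n * t n \<le> norm (\<phi> n (u + r n)) then u + r n else u - r n)"
  have y0: "y 0 = 0" and ySuc: "y (Suc n) = (if (1/3) ^ n * t n \<le> norm (\<phi> n (y n + r n)) then y n + r n else y n - r n)" for n
    by (simp_all add: y_def)
  have y_mem: "y n \<in> X" for n by (induction n) (auto simp: y0 ySuc r)
  \<comment> \<open>One of the two signs must work, because the two values differ by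
    \<open>2 *\<^sub>R \<phi> n (r n)\<close>.\<close>
  have hump: "(1/3) ^ n * t n \<le> norm (\<phi> n (y (Suc n)))" for n
  proof (cases "(1/3) ^ n * t n \<le> norm (\<phi> n (y n + r n))")
    case False
    have "\<phi> n (y n + r n) - \<phi> n (y n - r n) = 2 *\<^sub>R \<phi> n (r n)"
      unfolding \<phi>_def using z y_mem r by (simp add: T ip_add_right ip_diff_right scaleR_2)
    then have "2 * ((1/3) ^ n * t n) \<le> norm (\<phi> n (y n + r n)) + norm (\<phi> n (y n - r n))"
      using norm_triangle_ineq4[of "\<phi> n (y n + r n)" "\<phi> n (y n - r n)"] r(3)[of n] by simp
    then show ?thesis using False by (simp add: ySuc)
  qed (simp add: ySuc)
  have step: "hn (y (Suc n) - y n) \<le> (1/3) ^ n" for n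
    using r[of n] y_mem[of n] by (simp add: ySuc)
  have far: "hn (y m - y n) \<le> (3/2) * ((1/3) ^ n - (1/3) ^ m)" if "n \<le> m" for n m
    using that
  proof (induction m rule: dec_induct)
    case (step m)
    have "hn (y (Suc m) - y n) \<le> hn (y (Suc m) - y m) + hn (y m - y n)"
      using y_mem by (intro hn_diff_triangle)
    also have "\<dots> \<le> (1/3) ^ m + (3/2) * ((1/3) ^ n - (1/3) ^ m)"
      using step \<open>\<And>n. hn (y (Suc n) - y n) \<le> (1/3) ^ n\<close> by (intro add_mono) auto
    finally show ?case by (simp add: field_simps)
  qed simp
  have far': "hn (y m - y n) \<le> (3/2) * (1/3) ^ n" if "n \<le> m" for n m
    by (rule order_trans[OF far[OF that]]) (rule mult_left_mono, simp_all)
  obtain l where l: "l \<in> X" "(\<lambda>n. hn (y n - l)) \<longlonglongrightarrow> 0"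
  proof (rule complete[of y])
    fix e :: real assume "e > 0"
    have "(\<lambda>n. 3 * (1/3::real) ^ n) \<longlonglongrightarrow> 3 * 0" by (intro tendsto_intros LIMSEQ_realpow_zero) auto
    then obtain N where N: "3 * (1/3::real) ^ N < e"
      using \<open>e > 0\<close> by (auto simp: LIMSEQ_iff dest!: spec[of _ e])
    have "hn (y m - y n) < e" if "m \<ge> N" "n \<ge> N" for m n
      using hn_diff_triangle[of "y m" "y N" "y n"] hn_diff_commute[of "y N" "y n"] far'[OF that(1)] far'[OF that(2)] y_mem N
      by simp
    then show "\<exists>N. \<forall>m\<ge>N. \<forall>n\<ge>N. hn (y m - y n) < e" by blast
  qed (use y_mem in auto)
  have close: "hn (l - y n) \<le> (3/2) * (1/3) ^ n" for n
  proof -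
    have "(\<lambda>m. hn (y m - l) + (3/2) * (1/3) ^ n) \<longlonglongrightarrow> 0 + (3/2) * (1/3) ^ n" by (intro tendsto_intros l)
    moreover have "hn (l - y n) \<le> hn (y m - l) + (3/2) * (1/3) ^ n" if "m \<ge> n" for m
      using hn_diff_triangle[of l "y m" "y n"] hn_diff_commute[of l "y m"] far'[OF that] l y_mem by simp
    ultimately have "hn (l - y n) \<le> 0 + (3/2) * (1/3) ^ n" by (intro LIMSEQ_le_const) auto
    then show ?thesis by simp
  qed
  \<comment> \<open>The adjoint supplies pointwise boundedness: every \<open>\<phi> n\<close> is
    bounded at \<open>l\<close> by \<open>hn (S l)\<close>.\<close>
  have "(4/3) ^ n / 2 \<le> hn (S l)" for n :: nat
  proof -
    have "norm (\<phi> n (l - y (Suc n))) \<le> t n * ((3/2) * (1/3) ^ Suc n)"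
      using close[of "Suc n"] t(2)[of n] l y_mem by (intro order_trans[OF \<phi>_le] mult_left_mono) auto
    moreover have "\<phi> n (y (Suc n)) = \<phi> n l - \<phi> n (l - y (Suc n))"
      unfolding \<phi>_def using z l y_mem by (simp add: T ip_diff_right)
    then have "norm (\<phi> n (y (Suc n))) \<le> norm (\<phi> n l) + norm (\<phi> n (l - y (Suc n)))"
      by (simp add: norm_triangle_ineq4)
    ultimately have "(1/3) ^ n * t n / 2 \<le> norm (\<phi> n l)" using hump[of n] by (simp add: algebra_simps)
    also have "\<phi> n l = ip (z n) (S l)" using z l by (simp add: \<phi>_def D)
    also have "norm \<dots> \<le> hn (z n) * hn (S l)" using z l D by (intro norm_ip_le) auto
    also have "\<dots> \<le> 1 * hn (S l)" using z by (intro mult_right_mono) auto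
    finally have "(1/3) ^ n * t n / 2 \<le> hn (S l)" by simp
    moreover have "(1/3) ^ n * 4 ^ n \<le> (1/3) ^ n * t n" using t(1)[of n] by (intro mult_left_mono) auto
    moreover have "(1/3::real) ^ n * 4 ^ n = (4/3) ^ n" by (simp flip: power_mult_distrib)
    ultimately show ?thesis by simp
  qed
  moreover obtain n where "2 * hn (S l) < (4/3) ^ n" using real_arch_pow[of "4/3"] by auto
  ultimately show False by (smt (verit) field_sum_of_halves)
qed

end

section \<open>Adjointable operators and square roots\<close>

lemma cscale_one_central: "cscale c 1 * a = a * cscale c (1::'a::cstar)"
  by (simp add: cscale_def algebra_simps iu_central)

lemma invol_cscale_one: "invol (cscale c (1::'a::cstar)) = cscale (cnj c) 1"
  by (simp add: cscale_def invol_add invol_scaleR invol_iu)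

lemma restr_apply [simp]: "x \<in> X \<Longrightarrow> restr X T x = T x"
  by (simp add: restr_def)

lemma restr_restr [simp]: "restr X (restr X T) = restr X T"
  by (auto simp: restr_def)

lemma restr_eqI: "restr X T = T \<Longrightarrow> restr X S = S \<Longrightarrow> (\<And>x. x \<in> X \<Longrightarrow> T x = S x) \<Longrightarrow> T = S"
  by (metis ext restr_def)

lemma op_apply [simp]:
  "x \<in> X \<Longrightarrow> op_add X T S x = T x + S x"
  "x \<in> X \<Longrightarrow> op_diff X T S x = T x - S x"
  "x \<in> X \<Longrightarrow> op_comp X T S' x = T (S' x)"
  "x \<in> X \<Longrightarrow> op_smul X rm c T x = rm (T x) (cscale c 1)"
  by (simp_all add: op_add_def op_diff_def op_comp_def op_smul_def)

lemma restr_op [simp]: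
  "restr X (op_add X T S) = op_add X T S"
  "restr X (op_diff X T S) = op_diff X T S"
  "restr X (op_comp X T S') = op_comp X T S'"
  "restr X (op_smul X rm c T) = op_smul X rm c T"
  by (simp_all add: op_add_def op_diff_def op_comp_def op_smul_def)

context hmod begin

definition ops :: "('x \<Rightarrow> 'x) set" where
  "ops = {T. adjointable X ip T \<and> restr X T = T}"

lemma opsD: "T \<in> ops \<Longrightarrow> adjointable X ip T" "T \<in> ops \<Longrightarrow> restr X T = T"
  by (auto simp: ops_def)

lemma ops_eqI: "T \<in> ops \<Longrightarrow> S \<in> ops \<Longrightarrow> (\<And>x. x \<in> X \<Longrightarrow> T x = S x) \<Longrightarrow> T = S"
  by (blast intro: restr_eqI dest: opsD)

lemma adjointable_bounded:
  assumes "adjointable X ip T"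
  obtains K where "K \<ge> 0" "\<And>x. x \<in> X \<Longrightarrow> hn (T x) \<le> K * hn x"
  using assms adj_pair_bounded adjointable_iff by metis

lemma bdd_above_opnorm:
  assumes "adjointable X ip T"
  shows "bdd_above ((\<lambda>x. hn (T x)) ` {x \<in> X. hn x \<le> 1})"
proof -
  obtain K where K: "K \<ge> 0" "\<And>x. x \<in> X \<Longrightarrow> hn (T x) \<le> K * hn x" using adjointable_bounded[OF assms] by metis
  have "hn (T x) \<le> K" if "x \<in> X" "hn x \<le> 1" for x
    using K(2)[OF that(1)] mult_left_mono[OF that(2) K(1)] by simp
  then show ?thesis by (auto simp: bdd_above_def)
qed

lemma opnorm_bound:
  assumes T: "adjointable X ip T" and x: "x \<in> X"
  shows "hn (T x) \<le> nrm T * hn x"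
proof (cases "hn x = 0")
  case True
  then have "x = 0" using hn_eq_0 x by blast
  then show ?thesis using adjointable_linear(4)[OF T] by simp
next
  case False
  then have pos: "hn x > 0" using hn_nonneg[of x] by linarith
  let ?x = "rm x ((1 / hn x) *\<^sub>R 1)"
  have "hn (T ?x) \<le> nrm T" unfolding opnorm_def
    using x pos by (intro cSup_upper bdd_above_opnorm T) (auto simp: hn_rm_scaleR)
  moreover have "hn (T ?x) = hn (T x) / hn x"
    using x pos by (simp add: adjointable_linear[OF T] hn_rm_scaleR)
  ultimately show ?thesis using pos by (simp add: field_simps)
qed

lemma opnorm_leI:
  assumes "K \<ge> 0" "\<And>x. x \<in> X \<Longrightarrow> hn (T x) \<le> K * hn x"
  shows "nrm T \<le> K"
  unfolding opnorm_def
proof (rule cSup_least)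
  have "(0::'x) \<in> {x \<in> X. hn x \<le> 1}" by simp
  then show "(\<lambda>x. hn (T x)) ` {x \<in> X. hn x \<le> 1} \<noteq> {}" by blast
  fix r assume "r \<in> (\<lambda>x. hn (T x)) ` {x \<in> X. hn x \<le> 1}"
  then obtain x where "x \<in> X" "hn x \<le> 1" "r = hn (T x)" by auto
  then show "r \<le> K" using assms(2)[of x] mult_left_mono[of "hn x" 1 K] assms(1) by simp
qed

lemma opnorm_nonneg: "adjointable X ip T \<Longrightarrow> 0 \<le> nrm T"
proof -
  assume T: "adjointable X ip T"
  have "hn (T 0) \<le> nrm T" unfolding opnorm_def
    by (intro cSup_upper bdd_above_opnorm T) auto
  then show ?thesis by (simp add: adjointable_linear(4)[OF T])
qed

lemma adj_pair_ops:
  assumes "adj_pair T T'" "adj_pair S S'"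
  shows "adj_pair (op_add X T S) (op_add X T' S')" "adj_pair (op_diff X T S) (op_diff X T' S')"
    "adj_pair (op_comp X T S) (op_comp X S' T')" "adj_pair (restr X T) (restr X T')"
    "adj_pair (op_smul X rm c T) (op_smul X rm (cnj c) T')"
  using adj_pairD[OF assms(1)] adj_pairD[OF assms(2)] unfolding adj_pair_def
  by (auto simp: ip_add_left ip_add_right ip_diff_left ip_diff_right ip_rm_left ip_rm_right
      invol_cscale_one cscale_one_central)

lemma adj_pair_id: "adj_pair (restr X (\<lambda>x. x)) (restr X (\<lambda>x. x))"
  by (auto simp: adj_pair_def)

lemma ops_closed:
  assumes "T \<in> ops" "S \<in> ops"
  shows "op_add X T S \<in> ops" "op_diff X T S \<in> ops" "op_comp X T S \<in> ops" "op_smul X rm c T \<in> ops"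
proof -
  obtain T' S' where "adj_pair T T'" "adj_pair S S'" using assms by (auto simp: ops_def adjointable_iff)
  note adj = adj_pair_ops[OF this]
  show "op_add X T S \<in> ops" "op_diff X T S \<in> ops" "op_comp X T S \<in> ops" "op_smul X rm c T \<in> ops"
    unfolding ops_def adjointable_iff mem_Collect_eq restr_op using adj(1-3) adj(5)[of c] by blast+
qed

lemma id_mem_ops: "restr X (\<lambda>x. x) \<in> ops"
  using adj_pair_id by (auto simp: ops_def adjointable_iff)

lemma ops_adjoint:
  assumes "T \<in> ops"
  obtains S where "S \<in> ops" "adj_pair T S"
proof -
  obtain S where S: "adj_pair T S" using assms adjointable_iff by (auto simp: ops_def)
  then have "adj_pair (restr X T) (restr X S)" by (rule adj_pair_ops(4)[OF _ S])
  then have *: "adj_pair T (restr X S)" using assms by (simp add: ops_def)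
  then have "restr X S \<in> ops" using adj_pair_sym[OF *] by (auto simp: ops_def adjointable_iff)
  then show thesis using that * by blast
qed

lemma cstar_subalg_ops: "cstar_subalg X rm ip ops"
  unfolding cstar_subalg_def
proof (intro conjI ballI allI impI)
  show "ops \<subseteq> {T. adjointable X ip T \<and> restr X T = T}" by (simp add: ops_def)
  fix T assume "T \<in> ops"
  then show "\<exists>T'\<in>ops. \<forall>x\<in>X. \<forall>y\<in>X. ip (T x) y = ip x (T' y)"
    by (metis adj_pair_def ops_adjoint)
qed (simp_all add: ops_closed, simp add: ops_def)

lemma op_limit_pointwise:
  assumes "\<And>n. adjointable X ip (u n)" "adjointable X ip T"
    "(\<lambda>n. nrm (op_diff X (u n) T)) \<longlonglongrightarrow> 0" "x \<in> X"
  shows "(\<lambda>n. hn (u n x - T x)) \<longlonglongrightarrow> 0"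
proof (rule tendsto_sandwich[OF _ _ tendsto_const])
  have "adjointable X ip (op_diff X (u n) T)" for n
    using assms(1)[of n] assms(2) adj_pair_ops(2) unfolding adjointable_iff by metis
  then have "hn (u n x - T x) \<le> nrm (op_diff X (u n) T) * hn x" for n
    using opnorm_bound[of "op_diff X (u n) T" x] assms(4) by simp
  then show "\<forall>\<^sub>F n in sequentially. hn (u n x - T x) \<le> nrm (op_diff X (u n) T) * hn x" by simp
  show "(\<lambda>n. nrm (op_diff X (u n) T) * hn x) \<longlonglongrightarrow> 0"
    using tendsto_mult_right[OF assms(3), of "hn x"] by simp
qed simp

lemma pointwise_limit:
  assumes u: "\<And>n x. x \<in> X \<Longrightarrow> u n x \<in> X"
    and Cau: "\<And>e. e > 0 \<Longrightarrow> \<exists>N. \<forall>m\<ge>N. \<forall>n\<ge>N. \<forall>x\<in>X. hn (u m x - u n x) \<le> e * hn x"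
  obtains T where "\<And>x. x \<in> X \<Longrightarrow> T x \<in> X" "restr X T = T"
    "\<And>x. x \<in> X \<Longrightarrow> (\<lambda>n. hn (u n x - T x)) \<longlonglongrightarrow> 0"
    "\<And>e. e > 0 \<Longrightarrow> \<exists>N. \<forall>n\<ge>N. \<forall>x\<in>X. hn (u n x - T x) \<le> e * hn x"
proof -
  have ex: "\<exists>l\<in>X. (\<lambda>n. hn (u n x - l)) \<longlonglongrightarrow> 0" if x: "x \<in> X" for x
  proof -
    have "\<exists>N. \<forall>m\<ge>N. \<forall>n\<ge>N. hn (u m x - u n x) < e" if "e > 0" for e
    proof -
      define d where "d = e / (2 * (hn x + 1))"
      have hx: "hn x + 1 > 0" using hn_nonneg[of x] by linarith
      have d: "d > 0" using that hx by (simp add: d_def)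
      have "d * hn x \<le> d * (hn x + 1)" using d by simp
      also have "\<dots> = e / 2" using hx by (simp add: d_def field_simps)
      finally have "d * hn x < e" using that by linarith
      then show ?thesis using Cau[OF d] x by (meson le_less_trans)
    qed
    then show ?thesis using complete[of "\<lambda>n. u n x"] u x by metis
  qed
  define T where "T = restr X (\<lambda>x. SOME l. l \<in> X \<and> (\<lambda>n. hn (u n x - l)) \<longlonglongrightarrow> 0)"
  have T: "T x \<in> X" "(\<lambda>n. hn (u n x - T x)) \<longlonglongrightarrow> 0" if "x \<in> X" for x
    using someI_ex[of "\<lambda>l. l \<in> X \<and> (\<lambda>n. hn (u n x - l)) \<longlonglongrightarrow> 0"] ex[OF that] that
    by (auto simp: T_def)
  have unif: "\<exists>N. \<forall>n\<ge>N. \<forall>x\<in>X. hn (u n x - T x) \<le> e * hn x" if "e > 0" for e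
  proof -
    obtain N where N: "\<And>m n x. m \<ge> N \<Longrightarrow> n \<ge> N \<Longrightarrow> x \<in> X \<Longrightarrow> hn (u m x - u n x) \<le> e * hn x"
      using Cau[OF \<open>e > 0\<close>] by blast
    have "hn (u n x - T x) \<le> e * hn x" if n: "n \<ge> N" and x: "x \<in> X" for n x
    proof -
      have "(\<lambda>m. e * hn x + hn (u m x - T x)) \<longlonglongrightarrow> e * hn x + 0" by (intro tendsto_intros T x)
      moreover have "hn (u n x - T x) \<le> e * hn x + hn (u m x - T x)" if "m \<ge> N" for m
        using hn_diff_triangle[of "u n x" "u m x" "T x"] N[OF n that x] u T x by auto
      ultimately have "hn (u n x - T x) \<le> e * hn x + 0" by (intro LIMSEQ_le_const) auto
      then show ?thesis by simp
    qed
    then show ?thesis by blast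
  qed
  have "restr X T = T" by (simp add: T_def)
  then show thesis using that[of T] T unif by blast
qed

text \<open>The Cauchy estimate carries over to the adjoints by \<open>adj_pair_bound\<close>, so
  these converge too, and their limit is an adjoint of the limit of the operators.\<close>

lemma ops_complete:
  assumes u: "\<And>n. u n \<in> ops"
    and Cau: "\<And>e. e > 0 \<Longrightarrow> \<exists>N. \<forall>m\<ge>N. \<forall>n\<ge>N. \<forall>x\<in>X. hn (u m x - u n x) \<le> e * hn x"
  obtains T where "T \<in> ops" "(\<lambda>n. nrm (op_diff X (u n) T)) \<longlonglongrightarrow> 0"
proof -
  have "\<exists>S. S \<in> ops \<and> adj_pair (u n) S" for n using ops_adjoint[OF u[of n]] by blast
  then obtain w where w: "\<And>n. w n \<in> ops" "\<And>n. adj_pair (u n) (w n)" by metis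
  have u_mem: "x \<in> X \<Longrightarrow> u n x \<in> X" and w_mem: "x \<in> X \<Longrightarrow> w n x \<in> X" for n x
    using adj_pairD[OF w(2)] by auto
  have Cau_w: "\<exists>N. \<forall>m\<ge>N. \<forall>n\<ge>N. \<forall>x\<in>X. hn (w m x - w n x) \<le> e * hn x" if "e > 0" for e
  proof -
    obtain N where N: "\<And>m n x. m \<ge> N \<Longrightarrow> n \<ge> N \<Longrightarrow> x \<in> X \<Longrightarrow> hn (u m x - u n x) \<le> e * hn x"
      using Cau[OF \<open>e > 0\<close>] by blast
    have "hn (w m x - w n x) \<le> e * hn x" if "m \<ge> N" "n \<ge> N" "x \<in> X" for m n x
      using adj_pair_bound[OF adj_pair_ops(2)[OF w(2)[of m] w(2)[of n]], of e x] N that by simp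
    then show ?thesis by blast
  qed
  obtain T where T: "\<And>x. x \<in> X \<Longrightarrow> T x \<in> X" "restr X T = T"
    "\<And>x. x \<in> X \<Longrightarrow> (\<lambda>n. hn (u n x - T x)) \<longlonglongrightarrow> 0"
    "\<And>e. e > 0 \<Longrightarrow> \<exists>N. \<forall>n\<ge>N. \<forall>x\<in>X. hn (u n x - T x) \<le> e * hn x"
    using pointwise_limit[of u] u_mem Cau by metis
  obtain S where S: "\<And>x. x \<in> X \<Longrightarrow> S x \<in> X" "\<And>x. x \<in> X \<Longrightarrow> (\<lambda>n. hn (w n x - S x)) \<longlonglongrightarrow> 0"
    using pointwise_limit[of w] w_mem Cau_w by metis
  have "ip (T x) y = ip x (S y)" if "x \<in> X" "y \<in> X" for x y
  proof -
    have "(\<lambda>n. ip (u n x) y) \<longlonglongrightarrow> ip (T x) y"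
      using that u_mem T by (intro tendsto_ip) auto
    moreover have "(\<lambda>n. ip x (w n y)) \<longlonglongrightarrow> ip x (S y)"
      using that w_mem S by (intro tendsto_ip) auto
    moreover have "ip (u n x) y = ip x (w n y)" for n using adj_pairD[OF w(2)] that by blast
    ultimately show ?thesis using LIMSEQ_unique by auto
  qed
  then have "adj_pair T S" unfolding adj_pair_def using T(1) S(1) by simp
  then have T_ops: "T \<in> ops" unfolding ops_def adjointable_iff using T(2) by auto
  have diff: "op_diff X (u n) T \<in> ops" for n using u T_ops by (rule ops_closed)
  have "(\<lambda>n. nrm (op_diff X (u n) T)) \<longlonglongrightarrow> 0"
  proof (rule LIMSEQ_I)
    fix r :: real assume "r > 0"
    then obtain N where N: "\<And>n x. n \<ge> N \<Longrightarrow> x \<in> X \<Longrightarrow> hn (u n x - T x) \<le> (r/2) * hn x"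
      using T(4)[of "r/2"] by auto
    have "nrm (op_diff X (u n) T) \<le> r/2" if "n \<ge> N" for n
      using N[OF that] \<open>r > 0\<close> by (intro opnorm_leI) auto
    then show "\<exists>N. \<forall>n\<ge>N. norm (nrm (op_diff X (u n) T) - 0) < r"
      using \<open>r > 0\<close> opnorm_nonneg[OF opsD(1)[OF diff]] by (intro exI[of _ N]) force
  qed
  then show thesis using that T_ops by blast
qed

text \<open>Normalising \<open>x\<close> by an inverse square root of \<open>\<langle>x, x\<rangle> + e\<close> turns the norm bound into an
  inequality in the algebra.\<close>

lemma cpos_form_diff:
  assumes P: "adj_pair P P" and K: "K \<ge> 0" "\<And>x. x \<in> X \<Longrightarrow> hn (P x) \<le> K * hn x" and x: "x \<in> X"
  shows "cpos (K *\<^sub>R ip x x - ip x (P x))"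
proof -
  have adj: "adjointable X ip P" using P adjointable_iff by blast
  have approx: "cpos (K *\<^sub>R (ip x x + e *\<^sub>R 1) - ip x (P x))" if e: "e > 0" for e
  proof -
    obtain h s where hs: "invol h = h" "invol s = s" "s * s = ip x x + e *\<^sub>R 1" "h * s = 1" "s * h = 1"
      using cpos_inverse_sqrt[OF cpos_ip[OF x] e] by metis
    define x' where "x' = rm x h"
    have x': "x' \<in> X" using x by (simp add: x'_def)
    have "ip x x = s * s - e *\<^sub>R 1" using hs by simp
    then have "ip x' x' = h * (s * s - e *\<^sub>R 1) * h" using x by (simp add: x'_def ip_rm_left ip_rm_right hs mult.assoc)
    also have "\<dots> = (h * s) * (s * h) - e *\<^sub>R (h * h)" by (simp add: algebra_simps)
    finally have "1 - ip x' x' = e *\<^sub>R (invol h * h)" using hs by simp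
    then have "cpos (1 - ip x' x')" using e cpos_scaleR[OF cpos_invol_mult, of e h] by simp
    \<comment> \<open>The difference from 1 is \<open>e\<close> times \<open>invol h * h\<close>,
      hence positive.\<close>
    then have "norm (ip x' x') \<le> 1" using cpos_norm_mono[OF cpos_ip[OF x']] by fastforce
    then have nx': "hn x' \<le> 1" by (simp add: hnorm_def)
    have "norm (ip x' (P x')) \<le> hn x' * (K * hn x')"
      using x' K(2)[OF x'] by (intro order_trans[OF norm_ip_le] mult_left_mono) (auto simp: adj_pairD[OF P])
    also have "\<dots> \<le> 1 * (K * 1)" using nx' K by (intro mult_mono) auto
    finally have "norm (ip x' (P x')) \<le> K" by simp
    moreover have "invol (ip x' (P x')) = ip x' (P x')" using x' by (simp add: invol_ip adj_pairD(1,3)[OF P])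
    ultimately have "cpos (K *\<^sub>R 1 - ip x' (P x'))" by (intro cpos_norm_diff)
    then have "cpos (invol s * (K *\<^sub>R 1 - ip x' (P x')) * s)" by (rule cpos_conj)
    moreover have "ip x' (P x') = h * ip x (P x) * h"
      using x by (simp add: x'_def adjointable_linear[OF adj] ip_rm_left ip_rm_right hs mult.assoc)
    then have "invol s * (K *\<^sub>R 1 - ip x' (P x')) * s = K *\<^sub>R (s * s) - (s * h) * ip x (P x) * (h * s)"
      using hs(2) by (simp add: algebra_simps)
    ultimately show ?thesis using hs by simp
  qed
  have "(\<lambda>n. K *\<^sub>R (ip x x + inverse (real (Suc n)) *\<^sub>R 1) - ip x (P x)) \<longlonglongrightarrow> K *\<^sub>R (ip x x + 0 *\<^sub>R 1) - ip x (P x)"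
    by (intro tendsto_intros LIMSEQ_inverse_real_of_nat)
  moreover have "cpos (K *\<^sub>R (ip x x + inverse (real (Suc n)) *\<^sub>R 1) - ip x (P x))" for n
    by (rule approx) simp
  ultimately have "cpos (K *\<^sub>R (ip x x + 0 *\<^sub>R 1) - ip x (P x))" by (rule cpos_LIMSEQ)
  then show ?thesis by simp
qed

text \<open>Cauchy--Schwarz for the positive form \<open>ip x (N y)\<close>, taken at the vectors
  \<open>x\<close> and \<open>N x\<close>, where its value is \<open>ip (N x) (N x)\<close>.\<close>

lemma positive_contraction:
  assumes N: "adj_pair N N" and pos: "\<And>x. x \<in> X \<Longrightarrow> cpos (ip x (N x))"
    and le: "\<And>x. x \<in> X \<Longrightarrow> cpos (ip x x - ip x (N x))" and x: "x \<in> X"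
  shows "hn (N x) \<le> hn x"
proof (cases "hn (N x) = 0")
  case False
  have adj: "adjointable X ip N" using N adjointable_iff by blast
  note L = adjointable_linear[OF adj] adj_pairD(3)[OF N]
  have le': "norm (ip z (N z)) \<le> (hn z)\<^sup>2" if "z \<in> X" for z
    using cpos_norm_mono[OF pos[OF that] le[OF that]] by (simp add: hn_square)
  have "(norm (ip x (N (N x))))\<^sup>2 \<le> norm (ip x (N x)) * norm (ip (N x) (N (N x)))"
  proof (rule cauchy_schwarz_cstar)
    fix a
    show "cpos (invol a * ip x (N x) * a + invol a * ip x (N (N x)) + invol (ip x (N (N x))) * a + ip (N x) (N (N x)))"
      using pos[of "rm x a + N x"] x
      by (simp add: L ip_add_left ip_add_right ip_rm_left ip_rm_right invol_ip algebra_simps)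
  qed (use pos x in auto)
  also have "\<dots> \<le> (hn x)\<^sup>2 * (hn (N x))\<^sup>2" using x by (intro mult_mono le') (simp_all add: L(1))
  also have "ip x (N (N x)) = ip (N x) (N x)" using x by (simp add: L)
  finally have "(hn (N x))\<^sup>2 * (hn (N x))\<^sup>2 \<le> (hn x)\<^sup>2 * (hn (N x))\<^sup>2"
    by (simp add: hn_square power2_eq_square[of "norm _"])
  then have "(hn (N x))\<^sup>2 \<le> (hn x)\<^sup>2" by (rule mult_right_le_imp_le) (use False in simp)
  then show ?thesis by (rule power2_le_imp_le) simp
qed simp

text \<open>Polarisation. The definition of complete positivity speaks of forms, whereas the square
  root needs a self-adjoint operator.\<close>

lemma self_adjoint_if_form_self_adjoint:
  assumes P: "adjointable X ip P" and sa: "\<And>x. x \<in> X \<Longrightarrow> invol (ip x (P x)) = ip x (P x)"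
  shows "adj_pair P P"
proof -
  note L = adjointable_linear[OF P]
  have sa': "ip (P x) x = ip x (P x)" if "x \<in> X" for x using sa[OF that] that by (simp add: invol_ip L)
  have "ip (P x) y = ip x (P y)" if xy: "x \<in> X" "y \<in> X" for x y
  proof -
    have add: "ip x (P z) + ip z (P x) = ip (P x) z + ip (P z) x" if "z \<in> X" for z
      using sa'[of "x + z"] sa'[of x] sa'[of z] that xy
      by (simp add: L ip_add_left ip_add_right algebra_simps)
    \<comment> \<open>Replacing \<open>y\<close> by \<open>rm y iu\<close> turns the sum in
      \<open>add\<close> into a difference; adding the two versions isolates
      \<open>ip x (P y)\<close>.\<close>
    have "iu * (ip x (P y) - ip y (P x)) = iu * (ip (P x) y - ip (P y) x)"
      using add[of "rm y iu"] xy
      by (simp add: L ip_rm_left ip_rm_right invol_iu iu_central[symmetric] algebra_simps)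
    then have "(iu * iu) * (ip x (P y) - ip y (P x)) = (iu * iu) * (ip (P x) y - ip (P y) x)"
      by (simp only: mult.assoc)
    then have "- (ip x (P y) - ip y (P x)) = - (ip (P x) y - ip (P y) x)" by (simp only: iu_sq mult_minus_left mult_1_left)
    then have "ip x (P y) - ip y (P x) = ip (P x) y - ip (P y) x" by (simp only: neg_equal_iff_equal)
    then have "(ip x (P y) - ip y (P x)) + (ip x (P y) + ip y (P x))
        = (ip (P x) y - ip (P y) x) + (ip (P x) y + ip (P y) x)" by (simp only: add[OF xy(2)])
    then have "2 *\<^sub>R ip (P x) y = 2 *\<^sub>R ip x (P y)" by (simp add: scaleR_2)
    then show ?thesis by simp
  qed
  then show ?thesis using L by (auto simp: adj_pair_def)
qed

section \<open>Square roots of positive operators inside a C*-subalgebra\<close>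

lemma cstar_subalgD:
  assumes "cstar_subalg X rm ip C"
  shows "T \<in> C \<Longrightarrow> T \<in> ops" "T \<in> C \<Longrightarrow> T' \<in> C \<Longrightarrow> op_add X T T' \<in> C"
    "T \<in> C \<Longrightarrow> T' \<in> C \<Longrightarrow> op_comp X T T' \<in> C" "T \<in> C \<Longrightarrow> op_smul X rm c T \<in> C"
    "T \<in> C \<Longrightarrow> \<exists>T'\<in>C. adj_pair T T'"
    "(\<And>n. u n \<in> C) \<Longrightarrow> S \<in> ops \<Longrightarrow> (\<lambda>n. nrm (op_diff X (u n) S)) \<longlonglongrightarrow> 0 \<Longrightarrow> S \<in> C"
proof -
  show ops: "T \<in> C \<Longrightarrow> T \<in> ops" for T using assms unfolding cstar_subalg_def ops_def by blast
  show "T \<in> C \<Longrightarrow> T' \<in> C \<Longrightarrow> op_add X T T' \<in> C" "T \<in> C \<Longrightarrow> T' \<in> C \<Longrightarrow> op_comp X T T' \<in> C"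
    "T \<in> C \<Longrightarrow> op_smul X rm c T \<in> C"
    using assms unfolding cstar_subalg_def by (elim conjE; simp; fail)+
  show "T \<in> C \<Longrightarrow> \<exists>T'\<in>C. adj_pair T T'"
  proof -
    assume T: "T \<in> C"
    have "\<forall>T\<in>C. \<exists>T'\<in>C. \<forall>x\<in>X. \<forall>y\<in>X. ip (T x) y = ip x (T' y)"
      using assms unfolding cstar_subalg_def by (elim conjE)
    then obtain T' where T': "T' \<in> C" "\<forall>x\<in>X. \<forall>y\<in>X. ip (T x) y = ip x (T' y)" using T by blast
    have "\<forall>x\<in>X. T x \<in> X" "\<forall>x\<in>X. T' x \<in> X"
      using adjointable_linear(1)[OF opsD(1)] ops T T' by blast+
    then show ?thesis using T' unfolding adj_pair_def by blast
  qed
  show "(\<And>n. u n \<in> C) \<Longrightarrow> S \<in> ops \<Longrightarrow> (\<lambda>n. nrm (op_diff X (u n) S)) \<longlonglongrightarrow> 0 \<Longrightarrow> S \<in> C"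
    using assms unfolding cstar_subalg_def ops_def by (elim conjE) (simp, blast)
qed

text \<open>The operator version of \<open>sqrt_iter\<close>. The zero operator is written as a
  multiple of \<open>N\<close> so that every iterate lies in each C*-subalgebra containing
  \<open>N\<close>.\<close>

primrec op_iter :: "('x \<Rightarrow> 'x) \<Rightarrow> nat \<Rightarrow> 'x \<Rightarrow> 'x" where
  "op_iter N 0 = op_smul X rm 0 N"
| "op_iter N (Suc k) = op_smul X rm (1/2) (op_add X N (op_comp X (op_iter N k) (op_iter N k)))"

lemma op_iter_mem: "cstar_subalg X rm ip C \<Longrightarrow> N \<in> C \<Longrightarrow> op_iter N k \<in> C"
  by (induction k) (auto intro!: cstar_subalgD(2-4))

lemma op_iter_ops: "N \<in> ops \<Longrightarrow> op_iter N k \<in> ops"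
  by (rule op_iter_mem[OF cstar_subalg_ops])

lemma op_iter_linear:
  assumes "N \<in> ops"
  shows "x \<in> X \<Longrightarrow> op_iter N k x \<in> X"
    "x \<in> X \<Longrightarrow> y \<in> X \<Longrightarrow> op_iter N k (x + y) = op_iter N k x + op_iter N k y"
    "x \<in> X \<Longrightarrow> y \<in> X \<Longrightarrow> op_iter N k (x - y) = op_iter N k x - op_iter N k y"
  using adjointable_linear[OF opsD(1)[OF op_iter_ops[OF assms]]] by auto

lemma cscale_half: "cscale (1/2) (1::'a) = (1/2) *\<^sub>R 1"
  by (simp add: cscale_def)

lemma op_iter_0_apply: "N \<in> ops \<Longrightarrow> x \<in> X \<Longrightarrow> op_iter N 0 x = 0"
  using adjointable_linear(1)[OF opsD(1)] by (simp add: cscale_def)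

lemma op_iter_Suc_apply:
  "N \<in> ops \<Longrightarrow> x \<in> X \<Longrightarrow> op_iter N (Suc k) x = rm (N x + op_iter N k (op_iter N k x)) ((1/2) *\<^sub>R 1)"
  by (simp add: cscale_half)

lemma op_iter_commute:
  assumes N: "N \<in> ops" and Z: "Z \<in> ops" and comm: "\<And>x. x \<in> X \<Longrightarrow> Z (N x) = N (Z x)" and x: "x \<in> X"
  shows "Z (op_iter N k x) = op_iter N k (Z x)"
  using x
proof (induction k arbitrary: x)
  case 0
  then show ?case using adjointable_linear[OF opsD(1)[OF Z]] by (simp only: op_iter_0_apply N)
next
  case (Suc k)
  note L = adjointable_linear[OF opsD(1)[OF Z]] op_iter_linear[OF N] adjointable_linear(1)[OF opsD(1)[OF N]]
  show ?case using Suc by (simp add: op_iter_Suc_apply N L comm del: op_iter.simps)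
qed

lemma op_iter_commute_op_iter:
  assumes "N \<in> ops" "x \<in> X"
  shows "op_iter N j (op_iter N k x) = op_iter N k (op_iter N j x)"
  using assms by (intro op_iter_commute op_iter_ops sym[OF op_iter_commute]) auto

lemma op_iter_bound:
  assumes N: "N \<in> ops" and c: "\<And>x. x \<in> X \<Longrightarrow> hn (N x) \<le> hn x" and x: "x \<in> X"
  shows "hn (op_iter N k x) \<le> sqrt_iter (1::real) k * hn x"
  using x
proof (induction k arbitrary: x)
  case 0
  then show ?case by (simp only: op_iter_0_apply N) simp
next
  case (Suc k)
  note L = op_iter_linear[OF N] adjointable_linear(1)[OF opsD(1)[OF N]]
  let ?t = "sqrt_iter (1::real) k"
  have "hn (op_iter N k (op_iter N k x)) \<le> ?t * (?t * hn x)"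
    using Suc L sqrt_iter_real_bounds[of k] by (intro order_trans[OF Suc.IH] mult_left_mono) auto
  then have "hn (N x + op_iter N k (op_iter N k x)) \<le> hn x + ?t * (?t * hn x)"
    using Suc.prems L c by (intro order_trans[OF hn_triangle] add_mono) auto
  then show ?case using Suc.prems L
    by (simp add: op_iter_Suc_apply N hn_rm_scaleR algebra_simps del: op_iter.simps)
qed

text \<open>The factorisation from \<open>norm_sqrt_iter_step\<close>, read on vectors: the
  increment at \<open>x\<close> is half the preceding increment at the vector \<open>z\<close>
  below, so the induction has to range over all vectors.\<close>

lemma op_iter_step:
  assumes N: "N \<in> ops" and c: "\<And>x. x \<in> X \<Longrightarrow> hn (N x) \<le> hn x" and x: "x \<in> X"
  shows "hn (op_iter N (Suc k) x - op_iter N k x) \<le> (sqrt_iter (1::real) (Suc k) - sqrt_iter 1 k) * hn x"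
  using x
proof (induction k arbitrary: x)
  case 0
  then show ?case using op_iter_bound[OF N c, of x 1] by (simp only: op_iter_0_apply N) simp
next
  case (Suc k)
  note L = op_iter_linear[OF N] adjointable_linear(1)[OF opsD(1)[OF N]]
  let ?Y = "op_iter N" and ?t = "sqrt_iter (1::real)"
  define z where "z = ?Y (Suc k) x + ?Y k x"
  have z: "z \<in> X" using L Suc.prems by (simp add: z_def del: op_iter.simps)
  have "?Y (Suc (Suc k)) x - ?Y (Suc k) x = rm (?Y (Suc k) (?Y (Suc k) x) - ?Y k (?Y k x)) ((1/2) *\<^sub>R 1)"
    unfolding arg_cong2[where f = minus, OF op_iter_Suc_apply[OF N Suc.prems, of "Suc k"] op_iter_Suc_apply[OF N Suc.prems, of k]]
    using L Suc.prems by (simp add: rm_diff_left[symmetric] del: op_iter.simps)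
  also have "?Y (Suc k) (?Y (Suc k) x) - ?Y k (?Y k x) = ?Y (Suc k) z - ?Y k z"
    unfolding z_def using L Suc.prems op_iter_commute_op_iter[OF N Suc.prems, of k "Suc k"]
    by (simp del: op_iter.simps)
  finally have "hn (?Y (Suc (Suc k)) x - ?Y (Suc k) x) = (1/2) * hn (?Y (Suc k) z - ?Y k z)"
    using L z by (simp add: hn_rm_scaleR del: op_iter.simps)
  also have "\<dots> \<le> (1/2) * ((?t (Suc k) - ?t k) * hn z)"
    using Suc.IH[OF z] by simp
  also have "\<dots> \<le> (1/2) * ((?t (Suc k) - ?t k) * ((?t (Suc k) + ?t k) * hn x))"
  proof -
    have "hn z \<le> ?t (Suc k) * hn x + ?t k * hn x"
      unfolding z_def using L Suc.prems
      by (intro order_trans[OF hn_triangle] add_mono op_iter_bound[OF N c]) (auto simp del: op_iter.simps)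
    then show ?thesis using sqrt_iter_real_step[of k]
      by (intro mult_left_mono) (auto simp: algebra_simps simp del: sqrt_iter.simps)
  qed
  also have "\<dots> = (?t (Suc (Suc k)) - ?t (Suc k)) * hn x"
    unfolding arg_cong2[where f = minus, OF sqrt_iter.simps(2)[of "1::real" "Suc k"] sqrt_iter.simps(2)[of "1::real" k]]
    by (simp add: algebra_simps del: sqrt_iter.simps)
  finally show ?case .
qed

lemma op_iter_diff:
  assumes N: "N \<in> ops" and c: "\<And>x. x \<in> X \<Longrightarrow> hn (N x) \<le> hn x" and x: "x \<in> X" and mn: "m \<le> n"
  shows "hn (op_iter N n x - op_iter N m x) \<le> (sqrt_iter (1::real) n - sqrt_iter 1 m) * hn x"
  using mn
proof (induction n rule: dec_induct)
  case (step n)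
  have "hn (op_iter N (Suc n) x - op_iter N m x)
      \<le> hn (op_iter N (Suc n) x - op_iter N n x) + hn (op_iter N n x - op_iter N m x)"
    using op_iter_linear[OF N] x by (intro hn_diff_triangle) (auto simp del: op_iter.simps)
  also have "\<dots> \<le> (sqrt_iter (1::real) (Suc n) - sqrt_iter 1 n) * hn x + (sqrt_iter (1::real) n - sqrt_iter 1 m) * hn x"
    using step op_iter_step[OF N c x, of n] by (intro add_mono) auto
  finally show ?case by (simp add: algebra_simps del: sqrt_iter.simps op_iter.simps)
qed simp

text \<open>The last clause is the fixed-point equation 2Y = N + Y^2, that is (1 - Y)^2 = 1 - N,
  written without scalars.\<close>

lemma op_sqrt_one_minus:
  assumes C: "cstar_subalg X rm ip C" and N: "N \<in> C" and c: "\<And>x. x \<in> X \<Longrightarrow> hn (N x) \<le> hn x"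
    and sa: "adj_pair N N"
  obtains Y where "Y \<in> C" "adj_pair Y Y" "\<And>x. x \<in> X \<Longrightarrow> Y x + Y x = N x + Y (Y x)"
proof -
  have N_ops: "N \<in> ops" using cstar_subalgD(1)[OF C N] .
  let ?Y = "op_iter N" and ?t = "sqrt_iter (1::real)"
  note L = op_iter_linear[OF N_ops] adjointable_linear(1)[OF opsD(1)[OF N_ops]]
  obtain Y where Y: "Y \<in> ops" "(\<lambda>n. nrm (op_diff X (?Y n) Y)) \<longlonglongrightarrow> 0"
  proof (rule ops_complete[of ?Y])
    fix e :: real assume "e > 0"
    then obtain M where M: "\<And>m n. m \<ge> M \<Longrightarrow> n \<ge> M \<Longrightarrow> norm (?t m - ?t n) < e"
      using CauchyD[OF Cauchy_sqrt_iter_real] by meson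
    have main: "hn (?Y n x - ?Y m x) \<le> e * hn x" if "M \<le> m" "m \<le> n" "x \<in> X" for m n x
    proof -
      have "(?t n - ?t m) * hn x \<le> e * hn x" using M[of n m] that by (intro mult_right_mono) auto
      then show ?thesis using op_iter_diff[OF N_ops c that(3,2)] by linarith
    qed
    have "hn (?Y m x - ?Y n x) \<le> e * hn x" if "M \<le> m" "M \<le> n" "x \<in> X" for m n x
      using main[of m n x] main[of n m x] that L hn_diff_commute[of "?Y m x" "?Y n x"] by (cases "m \<le> n") auto
    then show "\<exists>N. \<forall>m\<ge>N. \<forall>n\<ge>N. \<forall>x\<in>X. hn (?Y m x - ?Y n x) \<le> e * hn x" by blast
  qed (use op_iter_ops[OF N_ops] in auto)
  note YL = adjointable_linear[OF opsD(1)[OF Y(1)]]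
  have lim: "(\<lambda>n. hn (?Y n x - Y x)) \<longlonglongrightarrow> 0" if "x \<in> X" for x
    using op_limit_pointwise[OF opsD(1)[OF op_iter_ops[OF N_ops]] opsD(1)[OF Y(1)] Y(2) that] .
  have "Y \<in> C" using cstar_subalgD(6)[OF C op_iter_mem[OF C N] Y] .
  moreover have "adj_pair Y Y"
  proof -
    have Yn_sa: "ip (?Y n x) y = ip x (?Y n y)" if "x \<in> X" "y \<in> X" for n x y
      using that
    proof (induction n arbitrary: x y)
      case 0
      then show ?case by (simp only: op_iter_0_apply N_ops) simp
    next
      case (Suc n)
      then show ?case using L adj_pairD(3)[OF sa]
        by (simp add: op_iter_Suc_apply N_ops ip_rm_left ip_rm_right invol_scaleR ip_add_left ip_add_right del: op_iter.simps)
    qed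
    have "ip (Y x) y = ip x (Y y)" if xy: "x \<in> X" "y \<in> X" for x y
    proof -
      have "(\<lambda>n. ip (?Y n x) y) \<longlonglongrightarrow> ip (Y x) y" using xy L YL lim by (intro tendsto_ip) auto
      moreover have "(\<lambda>n. ip x (?Y n y)) \<longlonglongrightarrow> ip x (Y y)" using xy L YL lim by (intro tendsto_ip) auto
      ultimately show ?thesis using LIMSEQ_unique Yn_sa[OF xy] by auto
    qed
    then show ?thesis using YL by (auto simp: adj_pair_def)
  qed
  moreover have "Y x + Y x = N x + Y (Y x)" if x: "x \<in> X" for x
  proof -
    \<comment> \<open>Squaring is continuous along the iterates because each of them is a
      contraction.\<close>
    define d where "d n = hn (?Y n (?Y n x) - Y (Y x))" for n
    have "(\<lambda>n. hn (?Y n x - Y x) + hn (?Y n (Y x) - Y (Y x))) \<longlonglongrightarrow> 0 + 0"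
      using x YL by (intro tendsto_add lim) auto
    moreover have "d n \<le> hn (?Y n x - Y x) + hn (?Y n (Y x) - Y (Y x))" for n
    proof -
      have "hn (?Y n (?Y n x - Y x)) \<le> ?t n * hn (?Y n x - Y x)"
        using x L YL by (intro op_iter_bound[OF N_ops c]) auto
      also have "\<dots> \<le> 1 * hn (?Y n x - Y x)" using sqrt_iter_real_bounds[of n] by (intro mult_right_mono) auto
      finally have "hn (?Y n (?Y n x) - ?Y n (Y x)) \<le> hn (?Y n x - Y x)" using x L YL by simp
      then show ?thesis unfolding d_def
        using hn_diff_triangle[of "?Y n (?Y n x)" "?Y n (Y x)" "Y (Y x)"] x L YL by auto
    qed
    moreover have "0 \<le> d n" for n by (simp add: d_def)
    ultimately have d: "d \<longlonglongrightarrow> 0"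
      by (intro tendsto_sandwich[of "\<lambda>_. 0" d _ "\<lambda>n. hn (?Y n x - Y x) + hn (?Y n (Y x) - Y (Y x))"]) auto
    let ?h = "\<lambda>z. rm z ((1/2) *\<^sub>R 1)"
    have "hn (?Y (Suc n) x - ?h (N x + Y (Y x))) = (1/2) * d n" for n
      using x L YL by (simp add: op_iter_Suc_apply N_ops d_def rm_diff_left[symmetric] hn_rm_scaleR del: op_iter.simps)
    then have "(\<lambda>n. hn (?Y (Suc n) x - ?h (N x + Y (Y x)))) \<longlonglongrightarrow> 0"
      using tendsto_mult_left[OF d, of "1/2"] by (simp only: mult_zero_right)
    moreover have "(\<lambda>n. hn (?Y (Suc n) x - Y x)) \<longlonglongrightarrow> 0" by (rule LIMSEQ_Suc[OF lim[OF x]])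
    ultimately have "Y x = ?h (N x + Y (Y x))"
      using x L YL by (intro LIMSEQ_hn_unique[of "\<lambda>n. ?Y (Suc n) x"]) (auto simp del: op_iter.simps)
    moreover have "?h z + ?h z = z" if "z \<in> X" for z
      using that rm_add_right[of z "(1/2) *\<^sub>R 1" "(1/2) *\<^sub>R 1"] by (simp flip: scaleR_left_distrib)
    ultimately show ?thesis using x L YL by (metis add_mem)
  qed
  ultimately show thesis using that by blast
qed

text \<open>For a bound \<open>K\<close> of \<open>P\<close>, the operator N = 1 - P/K lies between
  0 and 1 as a form, hence is a contraction. Then R is sqrt K times 1 - Y, with \<open>Y\<close>
  from \<open>op_sqrt_one_minus\<close>.\<close>

lemma op_sqrt:
  assumes C: "cstar_subalg X rm ip C" and I: "restr X (\<lambda>x. x) \<in> C" and P: "P \<in> C"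
    and pos: "\<And>x. x \<in> X \<Longrightarrow> cpos (ip x (P x))"
  obtains R where "R \<in> C" "adj_pair R R" "\<And>x. x \<in> X \<Longrightarrow> R (R x) = P x"
proof -
  have P_ops: "P \<in> ops" using cstar_subalgD(1)[OF C P] .
  note PL = adjointable_linear[OF opsD(1)[OF P_ops]]
  have sa: "adj_pair P P" using pos cpos_invol by (intro self_adjoint_if_form_self_adjoint opsD(1)[OF P_ops]) blast
  obtain K0 where K0: "K0 \<ge> 0" "\<And>x. x \<in> X \<Longrightarrow> hn (P x) \<le> K0 * hn x"
    using adjointable_bounded[OF opsD(1)[OF P_ops]] by metis
  \<comment> \<open>The added 1 makes \<open>K\<close> positive, so that \<open>P\<close> can be
    divided by it.\<close>
  define K where "K = K0 + 1"
  have K: "K > 0" "\<And>x. x \<in> X \<Longrightarrow> hn (P x) \<le> K * hn x"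
    using K0(1) by (auto simp: K_def distrib_right intro!: order_trans[OF K0(2)])
  define N where "N = op_add X (restr X (\<lambda>x. x)) (op_smul X rm (complex_of_real (-1/K)) P)"
  have N_C: "N \<in> C" unfolding N_def by (intro cstar_subalgD(2,4)[OF C] I P)
  have N_ops: "N \<in> ops" using cstar_subalgD(1)[OF C N_C] .
  have Nx: "N x = x + rm (P x) ((-1/K) *\<^sub>R 1)" if "x \<in> X" for x
    using that by (simp add: N_def cscale_of_real_one del: of_real_divide of_real_minus)
  have N_sa: "adj_pair N N"
    using adj_pair_ops(1)[OF adj_pair_id adj_pair_ops(5)[OF sa sa, of "complex_of_real (-1/K)"]]
    by (simp add: N_def)
  have ipN: "ip x (N x) = ip x x - (1/K) *\<^sub>R ip x (P x)" if "x \<in> X" for x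
    using that PL by (simp add: Nx ip_add_right ip_rm_right)
  have c: "hn (N x) \<le> hn x" if "x \<in> X" for x
  proof (rule positive_contraction[OF N_sa _ _ that])
    fix z assume z: "z \<in> X"
    have "cpos (K *\<^sub>R ip z z - ip z (P z))" using K z by (intro cpos_form_diff sa) auto
    then have "cpos ((1/K) *\<^sub>R (K *\<^sub>R ip z z - ip z (P z)))" using K by (intro cpos_scaleR) auto
    then show "cpos (ip z (N z))" using K z by (simp add: ipN scaleR_right_diff_distrib)
    have "cpos ((1/K) *\<^sub>R ip z (P z))" using K z pos by (intro cpos_scaleR) auto
    then show "cpos (ip z z - ip z (N z))" using z by (simp add: ipN)
  qed
  obtain Y where Y: "Y \<in> C" "adj_pair Y Y" "\<And>x. x \<in> X \<Longrightarrow> Y x + Y x = N x + Y (Y x)"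
    using op_sqrt_one_minus[OF C N_C c N_sa] by metis
  note YL = adjointable_linear[OF opsD(1)[OF cstar_subalgD(1)[OF C Y(1)]]]
  define S where "S = op_add X (restr X (\<lambda>x. x)) (op_smul X rm (complex_of_real (-1)) Y)"
  have S_C: "S \<in> C" unfolding S_def by (intro cstar_subalgD(2,4)[OF C] I Y)
  have S_sa: "adj_pair S S"
    using adj_pair_ops(1)[OF adj_pair_id adj_pair_ops(5)[OF Y(2) Y(2), of "complex_of_real (-1)"]]
    by (simp add: S_def)
  have Sx: "S x = x - Y x" if "x \<in> X" for x
    using that YL by (simp add: S_def cscale_def rm_minus_right)
  have SS: "S (S x) = rm (P x) ((1/K) *\<^sub>R 1)" if "x \<in> X" for x
  proof -
    have "S (S x) = x - (Y x + Y x) + Y (Y x)" using that YL by (simp add: Sx algebra_simps)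
    also have "\<dots> = x - N x" using Y(3)[OF that] by simp
    also have "\<dots> = rm (P x) ((1/K) *\<^sub>R 1)" using that PL by (simp add: Nx rm_minus_right)
    finally show ?thesis .
  qed
  note SL = adjointable_linear[OF opsD(1)[OF cstar_subalgD(1)[OF C S_C]]]
  let ?R = "op_smul X rm (complex_of_real (sqrt K)) S"
  have "?R (?R x) = P x" if "x \<in> X" for x
    using that SL PL K by (simp add: cscale_of_real_one rm_rm SS)
  moreover have "adj_pair ?R ?R" using adj_pair_ops(5)[OF S_sa S_sa, of "complex_of_real (sqrt K)"] by simp
  ultimately show thesis using that[of ?R] cstar_subalgD(4)[OF C S_C] by blast
qed

end

section \<open>Finite powers and operator matrices\<close>

lemma sum_fun_apply: "(\<Sum>j\<in>J. f j) i = (\<Sum>j\<in>J. f j i :: 'b::comm_monoid_add)"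
  by (induction J rule: infinite_finite_induct) auto

context hmod begin

lemma rm_sum_left: "(\<And>j. j \<in> J \<Longrightarrow> f j \<in> X) \<Longrightarrow> rm (\<Sum>j\<in>J. f j) a = (\<Sum>j\<in>J. rm (f j) a)"
  by (induction J rule: infinite_finite_induct) (auto simp: rm_add_left)

lemma op_adj_props:
  assumes "T \<in> ops"
  shows "op_adj X ip T \<in> ops" "adj_pair T (op_adj X ip T)"
proof -
  let ?Q = "\<lambda>S. restr X S = S \<and> (\<forall>x\<in>X. S x \<in> X) \<and> (\<forall>x\<in>X. \<forall>y\<in>X. ip (T x) y = ip x (S y))"
  obtain S where S: "S \<in> ops" "adj_pair T S" using ops_adjoint[OF assms] .
  then have "?Q S" using opsD(2)[OF S(1)] unfolding adj_pair_def by simp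
  then have Q: "?Q (op_adj X ip T)" unfolding op_adj_def by (rule someI[of ?Q])
  then show ap: "adj_pair T (op_adj X ip T)"
    unfolding adj_pair_def using adjointable_linear(1)[OF opsD(1)[OF assms]] by simp
  show "op_adj X ip T \<in> ops"
    using Q adj_pair_sym[OF ap] unfolding ops_def adjointable_iff by auto
qed

lemma op_adj_eqI: "S \<in> ops \<Longrightarrow> adj_pair T S \<Longrightarrow> T \<in> ops \<Longrightarrow> op_adj X ip T = S"
  using op_adj_props[of T] adj_pairD
  by (intro ops_eqI) (auto intro!: eq_if_ip_eq simp: adj_pairD(3)[symmetric])

text \<open>Vanishing from \<open>n\<close> onwards is what makes \<open>pow_ip n\<close> definite,
  so that the direct sum is again a module with a carrier set.\<close>

definition pow :: "nat \<Rightarrow> (nat \<Rightarrow> 'x) set" where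
  "pow n = {\<xi>. (\<forall>i<n. \<xi> i \<in> X) \<and> (\<forall>i\<ge>n. \<xi> i = 0)}"

definition pow_rm :: "(nat \<Rightarrow> 'x) \<Rightarrow> 'a \<Rightarrow> nat \<Rightarrow> 'x" where
  "pow_rm \<xi> a = (\<lambda>i. rm (\<xi> i) a)"

definition pow_ip :: "nat \<Rightarrow> (nat \<Rightarrow> 'x) \<Rightarrow> (nat \<Rightarrow> 'x) \<Rightarrow> 'a" where
  "pow_ip n \<xi> \<eta> = (\<Sum>i<n. ip (\<xi> i) (\<eta> i))"

lemma pow_component: "\<xi> \<in> pow n \<Longrightarrow> \<xi> i \<in> X"
  by (cases "i < n") (auto simp: pow_def)

lemma hnorm_pow_ip: "hnorm (pow_ip n) = msum_norm ip n"
  by (auto simp: hnorm_def msum_norm_def pow_ip_def)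

lemma hn_component_le:
  assumes "\<And>i. i < n \<Longrightarrow> \<xi> i \<in> X" "i < n"
  shows "hn (\<xi> i) \<le> hnorm (pow_ip n) \<xi>"
proof -
  have "(\<Sum>j<n. ip (\<xi> j) (\<xi> j)) - ip (\<xi> i) (\<xi> i) = (\<Sum>j\<in>{..<n} - {i}. ip (\<xi> j) (\<xi> j))"
    using assms(2) by (simp add: sum_diff1)
  moreover have "cpos \<dots>" using assms(1) by (intro cpos_sum) auto
  ultimately have "norm (ip (\<xi> i) (\<xi> i)) \<le> norm (\<Sum>j<n. ip (\<xi> j) (\<xi> j))"
    using assms by (intro cpos_norm_mono) auto
  then show ?thesis by (simp add: hnorm_def pow_ip_def)
qed

lemma hnorm_pow_le_sum:
  assumes "\<And>i. i < n \<Longrightarrow> \<xi> i \<in> X"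
  shows "hnorm (pow_ip n) \<xi> \<le> (\<Sum>i<n. hn (\<xi> i))"
proof -
  have "norm (\<Sum>j<n. ip (\<xi> j) (\<xi> j)) \<le> (\<Sum>j<n. (hn (\<xi> j))\<^sup>2)"
    by (simp add: hn_square norm_sum)
  also have "\<dots> \<le> (\<Sum>j<n. hn (\<xi> j))\<^sup>2"
  proof -
    have "(\<Sum>j<n. hn (\<xi> j) * hn (\<xi> j)) \<le> (\<Sum>j<n. hn (\<xi> j) * (\<Sum>i<n. hn (\<xi> i)))"
      by (intro sum_mono mult_left_mono member_le_sum) auto
    then show ?thesis by (simp add: power2_eq_square sum_distrib_right)
  qed
  finally show ?thesis by (simp add: hnorm_def pow_ip_def real_le_lsqrt sum_nonneg)
qed

lemma hilbert_module_pow: "hilbert_module (pow n) pow_rm (pow_ip n)"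
proof -
  have complete_pow: "\<exists>l\<in>pow n. \<forall>e>0. \<exists>N. \<forall>k\<ge>N. hnorm (pow_ip n) (s k - l) < e"
    if s: "\<And>k. s k \<in> pow n" and Cau: "\<And>e. e > 0 \<Longrightarrow> \<exists>N. \<forall>m\<ge>N. \<forall>k\<ge>N. hnorm (pow_ip n) (s m - s k) < e"
    for s :: "nat \<Rightarrow> nat \<Rightarrow> 'x"
  proof -
    note mem = pow_component[OF s]
    have "\<exists>l\<in>X. (\<lambda>k. hn (s k i - l)) \<longlonglongrightarrow> 0" if i: "i < n" for i
    proof -
      have "\<exists>N. \<forall>m\<ge>N. \<forall>k\<ge>N. hn (s m i - s k i) < e" if e: "e > 0" for e
      proof -
        have "hn (s m i - s k i) \<le> hnorm (pow_ip n) (s m - s k)" for m k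
          using hn_component_le[of n "s m - s k" i] mem i by simp
        then show ?thesis using Cau[OF e] by (meson le_less_trans)
      qed
      then show ?thesis using complete[of "\<lambda>k. s k i"] mem by metis
    qed
    then obtain l0 where l0: "\<And>i. i < n \<Longrightarrow> l0 i \<in> X" "\<And>i. i < n \<Longrightarrow> (\<lambda>k. hn (s k i - l0 i)) \<longlonglongrightarrow> 0" by metis
    define l where "l i = (if i < n then l0 i else 0)" for i
    have l: "l \<in> pow n" using l0 by (auto simp: pow_def l_def)
    have "(\<lambda>k. \<Sum>i<n. hn (s k i - l0 i)) \<longlonglongrightarrow> (\<Sum>i<n. 0)" by (intro tendsto_sum l0) auto
    then have lim: "(\<lambda>k. \<Sum>i<n. hn (s k i - l0 i)) \<longlonglongrightarrow> 0" by simp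
    have bound: "hnorm (pow_ip n) (s k - l) \<le> (\<Sum>i<n. hn (s k i - l0 i))" for k
      using hnorm_pow_le_sum[of n "s k - l"] mem l0 by (simp add: l_def)
    have "\<exists>N. \<forall>k\<ge>N. hnorm (pow_ip n) (s k - l) < e" if "e > 0" for e
    proof -
      obtain N where "\<And>k. k \<ge> N \<Longrightarrow> \<bar>\<Sum>i<n. hn (s k i - l0 i)\<bar> < e"
        using lim \<open>e > 0\<close> unfolding LIMSEQ_iff by auto
      then show ?thesis using bound by (intro exI[of _ N]) (meson abs_ge_self le_less_trans)
    qed
    then show ?thesis using l by blast
  qed
  have ip0: "\<xi> = 0" if "\<xi> \<in> pow n" "pow_ip n \<xi> \<xi> = 0" for \<xi>
  proof
    fix i
    show "\<xi> i = 0 i"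
    proof (cases "i < n")
      case True
      have "hn (\<xi> i) \<le> 0" using hn_component_le[of n \<xi> i] True that pow_component
        by (simp add: hnorm_def)
      then show ?thesis using hn_eq_0[of "\<xi> i"] hn_nonneg[of "\<xi> i"] pow_component[OF that(1)] by simp
    qed (use that in \<open>auto simp: pow_def\<close>)
  qed
  show ?thesis unfolding hilbert_module_def
    apply (intro conjI ballI allI impI)
    subgoal by (auto simp: pow_def)
    subgoal by (auto simp: pow_def)
    subgoal by (auto simp: pow_def)
    subgoal by (auto simp: pow_def pow_rm_def)
    subgoal by (auto simp: pow_rm_def rm_add_left pow_component)
    subgoal by (auto simp: pow_rm_def rm_add_right pow_component)
    subgoal by (auto simp: pow_rm_def rm_rm pow_component)
    subgoal by (auto simp: pow_rm_def pow_component)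
    subgoal by (simp add: pow_ip_def ip_add_right pow_component sum.distrib)
    subgoal by (simp add: pow_ip_def pow_rm_def ip_rm_right pow_component sum_distrib_right)
    subgoal by (simp add: pow_ip_def invol_sum invol_ip pow_component)
    subgoal by (auto simp: pow_ip_def pow_component intro!: cpos_sum)
    subgoal by (rule ip0)
    subgoal by (rule complete_pow) auto
    done
qed

lemma hmod_pow: "hmod (pow n) pow_rm (pow_ip n)"
  by (rule hmod.intro) (rule hilbert_module_pow)

definition emb :: "nat \<Rightarrow> 'x \<Rightarrow> nat \<Rightarrow> 'x" where
  "emb j x = (\<lambda>l. if l = j then x else 0)"

lemma emb_mem: "j < n \<Longrightarrow> x \<in> X \<Longrightarrow> emb j x \<in> pow n"
  by (auto simp: emb_def pow_def)

lemma pow_ip_emb_right: "i < n \<Longrightarrow> \<xi> \<in> pow n \<Longrightarrow> pow_ip n \<xi> (emb i y) = ip (\<xi> i) y"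
proof -
  assume "i < n" "\<xi> \<in> pow n"
  moreover have "ip (\<xi> j) (emb i y j) = (if j = i then ip (\<xi> i) y else 0)" for j
    using pow_component[OF \<open>\<xi> \<in> pow n\<close>] by (simp add: emb_def)
  ultimately show ?thesis by (simp add: pow_ip_def)
qed

lemma pow_ip_emb_left: "i < n \<Longrightarrow> \<xi> \<in> pow n \<Longrightarrow> pow_ip n (emb i y) \<xi> = ip y (\<xi> i)"
proof -
  assume "i < n" "\<xi> \<in> pow n"
  moreover have "ip (emb i y j) (\<xi> j) = (if j = i then ip y (\<xi> i) else 0)" for j
    using pow_component[OF \<open>\<xi> \<in> pow n\<close>] by (simp add: emb_def)
  ultimately show ?thesis by (simp add: pow_ip_def)
qed

lemma hnorm_emb: "j < n \<Longrightarrow> x \<in> X \<Longrightarrow> hnorm (pow_ip n) (emb j x) = hn x"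
  by (simp add: hnorm_def pow_ip_emb_right emb_mem) (simp add: emb_def)

lemma pow_eq_sum_emb: "\<xi> \<in> pow n \<Longrightarrow> \<xi> = (\<Sum>j<n. emb j (\<xi> j))"
  by (rule ext) (auto simp: sum_fun_apply emb_def pow_def)

definition matop :: "nat \<Rightarrow> (nat \<Rightarrow> nat \<Rightarrow> 'x \<Rightarrow> 'x) \<Rightarrow> (nat \<Rightarrow> 'x) \<Rightarrow> nat \<Rightarrow> 'x" where
  "matop n M = restr (pow n) (\<lambda>\<xi> i. if i < n then \<Sum>j<n. M i j (\<xi> j) else 0)"

lemma matop_apply: "\<xi> \<in> pow n \<Longrightarrow> i < n \<Longrightarrow> matop n M \<xi> i = (\<Sum>j<n. M i j (\<xi> j))"
  by (simp add: matop_def)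

lemma matop_adj_pair:
  assumes "\<And>i j. i < n \<Longrightarrow> j < n \<Longrightarrow> adj_pair (M i j) (M' j i)"
  shows "hmod.adj_pair (pow n) (pow_ip n) (matop n M) (matop n M')"
proof -
  interpret P: hmod "pow n" pow_rm "pow_ip n" by (rule hmod_pow)
  note D = adj_pairD[OF assms]
  have "pow_ip n (matop n M \<xi>) \<eta> = pow_ip n \<xi> (matop n M' \<eta>)" if "\<xi> \<in> pow n" "\<eta> \<in> pow n" for \<xi> \<eta>
  proof -
    have "pow_ip n (matop n M \<xi>) \<eta> = (\<Sum>i<n. \<Sum>j<n. ip (M i j (\<xi> j)) (\<eta> i))"
      unfolding pow_ip_def using that
      by (intro sum.cong refl) (simp only: lessThan_iff matop_apply, intro ip_sum_left, auto intro: D pow_component)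
    also have "\<dots> = (\<Sum>j<n. \<Sum>i<n. ip (\<xi> j) (M' j i (\<eta> i)))"
      using that by (subst sum.swap) (intro sum.cong refl, auto intro!: D(3) intro: pow_component)
    also have "\<dots> = pow_ip n \<xi> (matop n M' \<eta>)"
      unfolding pow_ip_def using that
      by (intro sum.cong refl) (simp only: lessThan_iff matop_apply, intro ip_sum_right[symmetric], auto intro: D pow_component)
    finally show ?thesis .
  qed
  moreover have "matop n M \<xi> \<in> pow n" "matop n M' \<xi> \<in> pow n" if "\<xi> \<in> pow n" for \<xi>
    using that by (auto simp: pow_def[of n] matop_def D pow_component intro!: sum_mem)
  ultimately show ?thesis by (simp add: P.adj_pair_def)
qed

lemma matop_ops: "(\<And>i j. i < n \<Longrightarrow> j < n \<Longrightarrow> M i j \<in> ops) \<Longrightarrow> matop n M \<in> hmod.ops (pow n) (pow_ip n)"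
proof -
  assume M: "\<And>i j. i < n \<Longrightarrow> j < n \<Longrightarrow> M i j \<in> ops"
  interpret P: hmod "pow n" pow_rm "pow_ip n" by (rule hmod_pow)
  have "P.adj_pair (matop n M) (matop n (\<lambda>i j. op_adj X ip (M j i)))"
    by (rule matop_adj_pair) (rule op_adj_props(2)[OF M])
  then show ?thesis unfolding P.ops_def P.adjointable_iff by (auto simp: matop_def)
qed

lemma matop_emb:
  assumes "\<And>i j. i < n \<Longrightarrow> j < n \<Longrightarrow> M i j \<in> ops" "i < n" "j < n" "x \<in> X"
  shows "matop n M (emb j x) i = M i j x"
proof -
  have "M i k (emb j x k) = (if k = j then M i j x else 0)" if "k < n" for k
    using adjointable_linear(4)[OF opsD(1)[OF assms(1)[OF assms(2) that]]] by (simp add: emb_def)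
  then show ?thesis using assms by (simp add: matop_apply emb_mem)
qed

text \<open>\<open>matnorm\<close> admits tuples with arbitrary values from \<open>n\<close>
  onwards; truncation affects neither side. After this, matrix norms are ordinary operator norms on
  another Hilbert module.\<close>

lemma matnorm_eq_opnorm: "matnorm X ip n M = opnorm (pow n) (pow_ip n) (matop n M)"
proof -
  have "(\<lambda>\<xi>. msum_norm ip n (mat_apply n M \<xi>)) ` {\<xi>. (\<forall>i<n. \<xi> i \<in> X) \<and> msum_norm ip n \<xi> \<le> 1} =
        (\<lambda>\<xi>. msum_norm ip n (matop n M \<xi>)) ` {\<xi> \<in> pow n. msum_norm ip n \<xi> \<le> 1}" (is "?f ` ?A = ?g ` ?B")
  proof
    show "?f ` ?A \<subseteq> ?g ` ?B"
    proof
      fix r assume "r \<in> ?f ` ?A"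
      then obtain \<xi> where \<xi>: "\<forall>i<n. \<xi> i \<in> X" "msum_norm ip n \<xi> \<le> 1" "r = ?f \<xi>" by blast
      define \<xi>' where "\<xi>' i = (if i < n then \<xi> i else 0)" for i
      have mem: "\<xi>' \<in> pow n" using \<xi> by (simp add: \<xi>'_def pow_def)
      have "msum_norm ip n \<xi>' = msum_norm ip n \<xi>" by (simp add: msum_norm_def \<xi>'_def)
      moreover have "?g \<xi>' = ?f \<xi>"
        using mem by (simp add: msum_norm_def mat_apply_def matop_apply) (simp add: \<xi>'_def)
      ultimately show "r \<in> ?g ` ?B" using mem \<xi> by (intro image_eqI[of _ _ \<xi>']) auto
    qed
    show "?g ` ?B \<subseteq> ?f ` ?A"
    proof
      fix r assume "r \<in> ?g ` ?B"
      then obtain \<xi> where \<xi>: "\<xi> \<in> pow n" "msum_norm ip n \<xi> \<le> 1" "r = ?g \<xi>" by blast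
      then have "?g \<xi> = ?f \<xi>" by (simp add: msum_norm_def mat_apply_def matop_apply)
      then show "r \<in> ?f ` ?A" using \<xi> by (intro image_eqI[of _ _ \<xi>]) (auto simp: pow_def)
    qed
  qed
  then show ?thesis by (simp add: matnorm_def opnorm_def hnorm_pow_ip)
qed

text \<open>The matrix algebra M_n(C), realised as operators on the n-th power of the
  module.\<close>

definition matset :: "nat \<Rightarrow> ('x \<Rightarrow> 'x) set \<Rightarrow> ((nat \<Rightarrow> 'x) \<Rightarrow> nat \<Rightarrow> 'x) set" where
  "matset n C = {matop n M | M. \<forall>i<n. \<forall>j<n. M i j \<in> C}"

lemma matsetI: "(\<And>i j. i < n \<Longrightarrow> j < n \<Longrightarrow> M i j \<in> C) \<Longrightarrow> matop n M \<in> matset n C"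
  by (auto simp: matset_def)

lemma matset_cases:
  assumes "T \<in> matset n C"
  obtains M where "T = matop n M" "\<And>i j. i < n \<Longrightarrow> j < n \<Longrightarrow> M i j \<in> C"
  using assms by (auto simp: matset_def)

lemma cstar_subalg_zero:
  assumes "cstar_subalg X rm ip C" "T \<in> C" shows "restr X (\<lambda>_. 0) \<in> C"
proof -
  have "op_smul X rm 0 T = restr X (\<lambda>_. 0)"
    using adjointable_linear(1)[OF opsD(1)[OF cstar_subalgD(1)[OF assms]]]
    by - (rule restr_eqI[of X], auto simp: cscale_def)
  then show ?thesis using cstar_subalgD(4)[OF assms, of 0] by simp
qed

lemma cstar_subalg_sum:
  assumes C: "cstar_subalg X rm ip C" and "restr X (\<lambda>_. 0) \<in> C" "\<And>k. k \<in> F \<Longrightarrow> f k \<in> C"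
  shows "restr X (\<lambda>x. \<Sum>k\<in>F. f k x) \<in> C"
  using assms(3)
proof (induction F rule: infinite_finite_induct)
  case (insert k F)
  have "restr X (\<lambda>x. \<Sum>k\<in>insert k F. f k x) = op_add X (f k) (restr X (\<lambda>x. \<Sum>k\<in>F. f k x))"
    using insert.hyps by - (rule restr_eqI[of X], auto)
  then show ?case using insert by (auto intro!: cstar_subalgD(2)[OF C])
qed (use assms(2) in auto)

text \<open>The algebraic clauses are matrix arithmetic. For closedness, the entries of a limit are
  recovered as compressions to coordinates, and compression does not increase the norm, so the
  entries converge in \<open>C\<close>.\<close>

lemma cstar_subalg_matset:
  assumes C: "cstar_subalg X rm ip C" and I: "restr X (\<lambda>x. x) \<in> C"
  shows "cstar_subalg (pow n) pow_rm (pow_ip n) (matset n C)"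
proof -
  interpret P: hmod "pow n" pow_rm "pow_ip n" by (rule hmod_pow)
  note zero = cstar_subalg_zero[OF C I]
  note Cops = cstar_subalgD(1)[OF C]
  have sub: "T \<in> P.ops" if T: "T \<in> matset n C" for T
    using T by (rule matset_cases) (auto intro: matop_ops Cops)
  have L: "M i j x \<in> X" if "\<And>i j. i < n \<Longrightarrow> j < n \<Longrightarrow> M i j \<in> C" "i < n" "j < n" "x \<in> X" for M i j x
    using that adjointable_linear(1)[OF opsD(1)[OF Cops]] by blast
  have Pmem: "T \<xi> \<in> pow n" if "T \<in> matset n C" "\<xi> \<in> pow n" for T \<xi>
    using P.adjointable_linear(1)[OF P.opsD(1)[OF sub]] that by blast
  have eqI: "T = matop n M" if "restr (pow n) T = T" "\<And>\<xi>. \<xi> \<in> pow n \<Longrightarrow> T \<xi> \<in> pow n"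
    "\<And>\<xi> i. \<xi> \<in> pow n \<Longrightarrow> i < n \<Longrightarrow> T \<xi> i = (\<Sum>j<n. M i j (\<xi> j))" for T M
  proof (rule restr_eqI[OF that(1)])
    show "restr (pow n) (matop n M) = matop n M" by (simp add: matop_def)
    fix \<xi> assume \<xi>: "\<xi> \<in> pow n"
    show "T \<xi> = matop n M \<xi>"
    proof
      fix i show "T \<xi> i = matop n M \<xi> i"
        using that(2)[OF \<xi>] that(3)[OF \<xi>, of i] \<xi> by (cases "i < n") (auto simp: matop_def pow_def)
    qed
  qed
  have closed: "op_add (pow n) T T' \<in> matset n C" "op_comp (pow n) T T' \<in> matset n C"
    if TT: "T \<in> matset n C" "T' \<in> matset n C" for T T'
  proof -
    obtain M where M: "T = matop n M" "\<And>i j. i < n \<Longrightarrow> j < n \<Longrightarrow> M i j \<in> C" using TT(1) by (rule matset_cases) blast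
    obtain M' where M': "T' = matop n M'" "\<And>i j. i < n \<Longrightarrow> j < n \<Longrightarrow> M' i j \<in> C" using TT(2) by (rule matset_cases) blast
    have "op_add (pow n) T T' = matop n (\<lambda>i j. op_add X (M i j) (M' i j))"
      using Pmem TT by (intro eqI) (auto simp: M(1) M'(1) matop_apply pow_component sum.distrib)
    then show "op_add (pow n) T T' \<in> matset n C" using M M' by (auto intro!: matsetI cstar_subalgD(2)[OF C])
    have "op_comp (pow n) T T' = matop n (\<lambda>i j. restr X (\<lambda>x. \<Sum>k<n. op_comp X (M i k) (M' k j) x))"
    proof (rule eqI)
      fix \<xi> i assume \<xi>: "\<xi> \<in> pow n" and i: "i < n"
      have "op_comp (pow n) T T' \<xi> i = (\<Sum>k<n. M i k (\<Sum>j<n. M' k j (\<xi> j)))"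
        using \<xi> i Pmem[OF TT(2) \<xi>] by (simp add: M(1) M'(1) matop_apply)
      also have "\<dots> = (\<Sum>k<n. \<Sum>j<n. M i k (M' k j (\<xi> j)))"
        using i \<xi> M M' by (intro sum.cong refl adjointable_linear(6)[OF opsD(1)[OF Cops]]) (auto intro: L pow_component)
      finally show "op_comp (pow n) T T' \<xi> i = (\<Sum>j<n. restr X (\<lambda>x. \<Sum>k<n. op_comp X (M i k) (M' k j) x) (\<xi> j))"
        using \<xi> by (subst (asm) sum.swap) (simp add: pow_component)
    qed (use Pmem TT in auto)
    then show "op_comp (pow n) T T' \<in> matset n C" using M M'
      by (auto intro!: matsetI cstar_subalg_sum[OF C zero] cstar_subalgD(3)[OF C])
  qed
  have smul: "op_smul (pow n) pow_rm c T \<in> matset n C" if T: "T \<in> matset n C" for T c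
  proof -
    obtain M where M: "T = matop n M" "\<And>i j. i < n \<Longrightarrow> j < n \<Longrightarrow> M i j \<in> C" using T by (rule matset_cases) blast
    have "op_smul (pow n) pow_rm c T = matop n (\<lambda>i j. op_smul X rm c (M i j))"
    proof (rule eqI)
      fix \<xi> i assume \<xi>: "\<xi> \<in> pow n" and i: "i < n"
      then show "op_smul (pow n) pow_rm c T \<xi> i = (\<Sum>j<n. op_smul X rm c (M i j) (\<xi> j))"
        using M(2) by (simp add: M(1) pow_rm_def matop_apply pow_component) (intro rm_sum_left, auto intro: L pow_component)
    qed (use Pmem T in auto)
    then show ?thesis using M by (auto intro!: matsetI cstar_subalgD(4)[OF C])
  qed
  have adj: "\<exists>T'\<in>matset n C. \<forall>\<xi>\<in>pow n. \<forall>\<eta>\<in>pow n. pow_ip n (T \<xi>) \<eta> = pow_ip n \<xi> (T' \<eta>)"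
    if T: "T \<in> matset n C" for T
  proof -
    obtain M where M: "T = matop n M" "\<And>i j. i < n \<Longrightarrow> j < n \<Longrightarrow> M i j \<in> C" using T by (rule matset_cases) blast
    define M' where "M' j i = (SOME S. S \<in> C \<and> adj_pair (M i j) S)" for j i
    have M': "M' j i \<in> C \<and> adj_pair (M i j) (M' j i)" if "i < n" "j < n" for i j
    proof -
      have "\<exists>S. S \<in> C \<and> adj_pair (M i j) S" using cstar_subalgD(5)[OF C M(2)[OF that]] by blast
      then show ?thesis unfolding M'_def by (rule someI_ex)
    qed
    then have "P.adj_pair (matop n M) (matop n M')" by (intro matop_adj_pair) blast
    moreover have "matop n M' \<in> matset n C" using M' by (intro matsetI) blast
    ultimately show ?thesis unfolding M(1) P.adj_pair_def by blast
  qed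
  have lim: "T \<in> matset n C" if u: "\<And>k. u k \<in> matset n C" and T: "T \<in> P.ops"
    and conv: "(\<lambda>k. opnorm (pow n) (pow_ip n) (op_diff (pow n) (u k) T)) \<longlonglongrightarrow> 0" for T u
  proof -
    note TL = P.adjointable_linear[OF P.opsD(1)[OF T]]
    have "\<exists>M. u k = matop n M \<and> (\<forall>i<n. \<forall>j<n. M i j \<in> C)" for k using u[of k] by (auto simp: matset_def)
    then obtain M where M: "\<And>k. u k = matop n (M k)" "\<And>k i j. i < n \<Longrightarrow> j < n \<Longrightarrow> M k i j \<in> C" by metis
    obtain S where S: "S \<in> P.ops" "P.adj_pair T S" using P.ops_adjoint[OF T] .
    note SD = P.adj_pairD[OF S(2)]
    \<comment> \<open>The (i, j) compression of \<open>T\<close>; its adjoint is the (j, i)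
      compression of the adjoint \<open>S\<close>.\<close>
    define E where "E i j = restr X (\<lambda>x. T (emb j x) i)" for i j
    have E_ops: "E i j \<in> ops" if ij: "i < n" "j < n" for i j
    proof -
      have "ip (T (emb j x) i) y = ip x (S (emb i y) j)" if "x \<in> X" "y \<in> X" for x y
        using SD(3)[of "emb j x" "emb i y"] that ij
        by (simp add: emb_mem pow_ip_emb_right pow_ip_emb_left SD)
      moreover have "T (emb j x) i \<in> X" "S (emb i x) j \<in> X" if "x \<in> X" for x
        using that ij by (auto intro: pow_component[where n = n] SD emb_mem)
      ultimately have "adj_pair (E i j) (\<lambda>y. S (emb i y) j)" by (simp add: adj_pair_def E_def)
      then show ?thesis unfolding ops_def adjointable_iff by (auto simp: E_def)
    qed
    have "T = matop n E"
    proof (rule eqI)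
      fix \<xi> i assume \<xi>: "\<xi> \<in> pow n" and i: "i < n"
      have "T \<xi> = T (\<Sum>j<n. emb j (\<xi> j))" using pow_eq_sum_emb[OF \<xi>] by simp
      also have "\<dots> = (\<Sum>j<n. T (emb j (\<xi> j)))" using \<xi> by (intro TL(6)) (auto intro: emb_mem pow_component)
      finally show "T \<xi> i = (\<Sum>j<n. E i j (\<xi> j))" using \<xi> by (simp add: sum_fun_apply E_def pow_component)
    qed (use TL P.opsD[OF T] in auto)
    moreover have "E i j \<in> C" if ij: "i < n" "j < n" for i j
    proof (rule cstar_subalgD(6)[OF C, of "\<lambda>k. M k i j"])
      have diff: "op_diff (pow n) (u k) T \<in> P.ops" for k using sub[OF u] T by (rule P.ops_closed)
      have "nrm (op_diff X (M k i j) (E i j)) \<le> opnorm (pow n) (pow_ip n) (op_diff (pow n) (u k) T)" for k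
      proof (rule opnorm_leI)
        show "0 \<le> opnorm (pow n) (pow_ip n) (op_diff (pow n) (u k) T)" by (rule P.opnorm_nonneg[OF P.opsD(1)[OF diff]])
        fix x assume x: "x \<in> X"
        have e: "emb j x \<in> pow n" using ij x by (simp add: emb_mem)
        have "M k i j x = u k (emb j x) i" unfolding M(1)
          by (rule matop_emb[symmetric]) (use M(2) ij x Cops in auto)
        then have "op_diff X (M k i j) (E i j) x = op_diff (pow n) (u k) T (emb j x) i"
          using x e by (simp add: E_def)
        also have "hn \<dots> \<le> hnorm (pow_ip n) (op_diff (pow n) (u k) T (emb j x))"
          by (rule hn_component_le[OF pow_component[OF P.adjointable_linear(1)[OF P.opsD(1)[OF diff] e]] ij(1)])
        also have "\<dots> \<le> opnorm (pow n) (pow_ip n) (op_diff (pow n) (u k) T) * hnorm (pow_ip n) (emb j x)"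
          by (rule P.opnorm_bound[OF P.opsD(1)[OF diff] e])
        finally show "hn (op_diff X (M k i j) (E i j) x) \<le> opnorm (pow n) (pow_ip n) (op_diff (pow n) (u k) T) * hn x"
          using ij x by (simp add: hnorm_emb)
      qed
      moreover have "0 \<le> nrm (op_diff X (M k i j) (E i j))" for k
        by (intro opnorm_nonneg opsD(1) ops_closed(2) E_ops ij Cops M)
      ultimately show "(\<lambda>k. nrm (op_diff X (M k i j) (E i j))) \<longlonglongrightarrow> 0"
        by (intro tendsto_sandwich[OF _ _ tendsto_const conv]) auto
    qed (use M ij E_ops in auto)
    ultimately show ?thesis using matsetI[of n E C] by simp
  qed
  show ?thesis unfolding cstar_subalg_def
  proof (intro conjI)
    show "matset n C \<subseteq> {T. adjointable (pow n) (pow_ip n) T \<and> restr (pow n) T = T}"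
      using sub unfolding P.ops_def by blast
    show "\<forall>T\<in>matset n C. \<forall>T'\<in>matset n C. op_add (pow n) T T' \<in> matset n C \<and> op_comp (pow n) T T' \<in> matset n C"
      using closed by blast
    show "\<forall>T\<in>matset n C. \<forall>c. op_smul (pow n) pow_rm c T \<in> matset n C" using smul by blast
    show "\<forall>T\<in>matset n C. \<exists>T'\<in>matset n C. \<forall>\<xi>\<in>pow n. \<forall>\<eta>\<in>pow n. pow_ip n (T \<xi>) \<eta> = pow_ip n \<xi> (T' \<eta>)"
      by (rule ballI) (rule adj)
    show "\<forall>T u. (\<forall>k. u k \<in> matset n C) \<and> adjointable (pow n) (pow_ip n) T \<and> restr (pow n) T = T \<and>
        (\<lambda>k. opnorm (pow n) (pow_ip n) (op_diff (pow n) (u k) T)) \<longlonglongrightarrow> 0 \<longrightarrow> T \<in> matset n C"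
    proof (intro allI impI, elim conjE)
      fix T :: "(nat \<Rightarrow> 'x) \<Rightarrow> nat \<Rightarrow> 'x" and u
      assume "\<forall>k. u k \<in> matset n C" "adjointable (pow n) (pow_ip n) T" "restr (pow n) T = T"
        "(\<lambda>k. opnorm (pow n) (pow_ip n) (op_diff (pow n) (u k) T)) \<longlonglongrightarrow> 0"
      then show "T \<in> matset n C" by - (rule lim[of u], simp_all add: P.ops_def)
    qed
  qed
qed

lemma id_mem_matset:
  assumes C: "cstar_subalg X rm ip C" and I: "restr X (\<lambda>x. x) \<in> C"
  shows "restr (pow n) (\<lambda>\<xi>. \<xi>) \<in> matset n C"
proof -
  define M where "M i j = (if i = j then restr X (\<lambda>x. x) else restr X (\<lambda>_. 0))" for i j :: nat
  have "matop n M = restr (pow n) (\<lambda>\<xi>. \<xi>)"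
  proof (rule restr_eqI)
    fix \<xi> assume \<xi>: "\<xi> \<in> pow n"
    have "M i j (\<xi> j) = (if j = i then \<xi> i else 0)" for i j using \<xi> by (simp add: M_def pow_component)
    then show "matop n M \<xi> = restr (pow n) (\<lambda>\<xi>. \<xi>) \<xi>"
      using \<xi> by (auto simp: fun_eq_iff matop_def pow_def)
  qed (auto simp: matop_def)
  moreover have "matop n M \<in> matset n C"
    using I cstar_subalg_zero[OF C I] by (intro matsetI) (auto simp: M_def)
  ultimately show ?thesis by simp
qed

lemma matposE:
  assumes Mat: "matpos X ip C n Mat"
  obtains B where "\<And>i j. i < n \<Longrightarrow> j < n \<Longrightarrow> B i j \<in> C"
    "\<And>i j x. i < n \<Longrightarrow> j < n \<Longrightarrow> x \<in> X \<Longrightarrow> Mat i j x = (\<Sum>k<n. op_adj X ip (B k i) (B k j x))"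
proof -
  obtain B where B: "\<forall>i<n. \<forall>j<n. B i j \<in> C"
    "\<forall>i<n. \<forall>j<n. Mat i j = restr X (\<lambda>x. \<Sum>k<n. op_adj X ip (B k i) (B k j x))"
    using Mat unfolding matpos_def by blast
  show thesis by (rule that[of B]) (use B in auto)
qed

text \<open>The square root is taken inside \<open>matset n C\<close>. Being self-adjoint, its
  matrix \<open>B\<close> has \<open>B i k\<close> as the adjoint of \<open>B k i\<close>, so its
  square has exactly the shape required by \<open>matpos\<close>.\<close>

lemma form_matpos:
  assumes C: "cstar_subalg X rm ip C" and I: "restr X (\<lambda>x. x) \<in> C"
    and Mat: "\<And>i j. i < n \<Longrightarrow> j < n \<Longrightarrow> Mat i j \<in> C"
    and pos: "\<And>\<xi>. \<xi> \<in> pow n \<Longrightarrow> cpos (pow_ip n \<xi> (matop n Mat \<xi>))"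
  shows "matpos X ip C n Mat"
proof -
  interpret P: hmod "pow n" pow_rm "pow_ip n" by (rule hmod_pow)
  note Cops = cstar_subalgD(1)[OF C]
  obtain R where R: "R \<in> matset n C" "P.adj_pair R R" "\<And>\<xi>. \<xi> \<in> pow n \<Longrightarrow> R (R \<xi>) = matop n Mat \<xi>"
    using P.op_sqrt[OF cstar_subalg_matset[OF C I] id_mem_matset[OF C I] matsetI[OF Mat] pos] by metis
  obtain B where B: "R = matop n B" "\<And>i j. i < n \<Longrightarrow> j < n \<Longrightarrow> B i j \<in> C" using R(1) by (rule matset_cases) blast
  have BL: "B i j x \<in> X" if "i < n" "j < n" "x \<in> X" for i j x
    using that B adjointable_linear(1)[OF opsD(1)[OF Cops]] by blast
  have emb_eq: "matop n B (emb j x) i = B i j x" if "i < n" "j < n" "x \<in> X" for i j x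
    using that B(2) Cops by (intro matop_emb) auto
  note RD = P.adj_pairD[OF R(2)]
  have adj: "op_adj X ip (B k i) = B i k" if ik: "i < n" "k < n" for i k
  proof (rule op_adj_eqI)
    show "adj_pair (B k i) (B i k)" unfolding adj_pair_def
    proof (intro conjI ballI)
      fix x y assume xy: "x \<in> X" "y \<in> X"
      show "ip (B k i x) y = ip x (B i k y)"
        using RD(3)[of "emb i x" "emb k y"] xy ik RD(1)
        by (simp add: emb_mem pow_ip_emb_right pow_ip_emb_left) (simp add: B(1) emb_eq)
    qed (use BL ik in auto)
  qed (use B Cops ik in auto)
  have "Mat i j = restr X (\<lambda>x. \<Sum>k<n. op_adj X ip (B k i) (B k j x))" if ij: "i < n" "j < n" for i j
  proof (rule restr_eqI)
    show "restr X (Mat i j) = Mat i j" using Mat ij Cops opsD by blast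
    fix x assume x: "x \<in> X"
    have "Mat i j x = matop n Mat (emb j x) i" using x ij Mat Cops by (intro matop_emb[symmetric]) auto
    also have "\<dots> = R (R (emb j x)) i" using R(3) ij x by (simp add: emb_mem)
    also have "\<dots> = (\<Sum>k<n. B i k (R (emb j x) k))"
      using RD(1)[of "emb j x"] ij x unfolding B(1) by (intro matop_apply) (auto simp: emb_mem)
    also have "\<dots> = (\<Sum>k<n. op_adj X ip (B k i) (B k j x))"
      using ij x by (intro sum.cong refl) (simp add: B(1) emb_eq adj)
    finally show "Mat i j x = restr X (\<lambda>x. \<Sum>k<n. op_adj X ip (B k i) (B k j x)) x" using x by simp
  qed simp
  then show ?thesis unfolding matpos_def using B(2) by blast
qed

end

section \<open>Schur multiplication of operator matrices by a representation\<close>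

context hmod begin

text \<open>Cauchy--Schwarz in a finite direct sum of copies of \<open>X\<close>.\<close>

lemma norm_sum_ip_le:
  assumes "\<And>l. l \<in> L \<Longrightarrow> w l \<in> X" "\<And>l. l \<in> L \<Longrightarrow> k l \<in> X"
  shows "(norm (\<Sum>l\<in>L. ip (w l) (k l)))\<^sup>2 \<le> norm (\<Sum>l\<in>L. ip (w l) (w l)) * norm (\<Sum>l\<in>L. ip (k l) (k l))"
proof (rule cauchy_schwarz_cstar)
  show "cpos (\<Sum>l\<in>L. ip (w l) (w l))" using assms by (intro cpos_sum) auto
  fix a
  have "cpos (\<Sum>l\<in>L. ip (rm (w l) a + k l) (rm (w l) a + k l))" using assms by (intro cpos_sum) auto
  also have "(\<Sum>l\<in>L. ip (rm (w l) a + k l) (rm (w l) a + k l)) =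
      (\<Sum>l\<in>L. invol a * ip (w l) (w l) * a + invol a * ip (w l) (k l) + invol (ip (w l) (k l)) * a + ip (k l) (k l))"
    using assms
    by (intro sum.cong refl) (simp add: ip_add_left ip_add_right ip_rm_left ip_rm_right invol_ip algebra_simps)
  finally show "cpos (invol a * (\<Sum>l\<in>L. ip (w l) (w l)) * a + invol a * (\<Sum>l\<in>L. ip (w l) (k l)) +
      invol (\<Sum>l\<in>L. ip (w l) (k l)) * a + (\<Sum>l\<in>L. ip (k l) (k l)))"
    by (simp add: sum.distrib sum_distrib_left sum_distrib_right invol_sum)
qed

lemma tendsto_hn:
  assumes "\<And>n. u n \<in> X" "l \<in> X" "(\<lambda>n. hn (u n - l)) \<longlonglongrightarrow> 0"
  shows "(\<lambda>n. hn (u n)) \<longlonglongrightarrow> hn l"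
  unfolding hnorm_def by (intro tendsto_intros tendsto_ip assms)

lemma tendsto_op:
  assumes T: "adjointable X ip T" and u: "\<And>n. u n \<in> X" "l \<in> X" "(\<lambda>n. hn (u n - l)) \<longlonglongrightarrow> 0"
  shows "(\<lambda>n. hn (T (u n) - T l)) \<longlonglongrightarrow> 0"
proof (rule tendsto_sandwich[OF _ _ tendsto_const])
  have "hn (T (u n) - T l) \<le> nrm T * hn (u n - l)" for n
    using opnorm_bound[OF T, of "u n - l"] u adjointable_linear[OF T] by simp
  then show "\<forall>\<^sub>F n in sequentially. hn (T (u n) - T l) \<le> nrm T * hn (u n - l)" by simp
  show "(\<lambda>n. nrm T * hn (u n - l)) \<longlonglongrightarrow> 0"
    using tendsto_mult_left[OF u(3), of "nrm T"] by simp
qed simp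

end

section \<open>Representations and orthonormal bases\<close>

locale star_rep = hmod X rm ip
  for X :: "'x::ab_group_add set" and rm :: "'x \<Rightarrow> 'a::cstar \<Rightarrow> 'x" and ip :: "'x \<Rightarrow> 'x \<Rightarrow> 'a" +
  fixes \<rho> :: "'a \<Rightarrow> 'x \<Rightarrow> 'x"
  assumes rho_adjointable: "adjointable X ip (\<rho> a)"
    and rho_add: "x \<in> X \<Longrightarrow> \<rho> (a + b) x = \<rho> a x + \<rho> b x"
    and rho_mult: "x \<in> X \<Longrightarrow> \<rho> (a * b) x = \<rho> a (\<rho> b x)"
    and rho_one: "x \<in> X \<Longrightarrow> \<rho> 1 x = x"
    and rho_cscale: "x \<in> X \<Longrightarrow> \<rho> (cscale c a) x = rm (\<rho> a x) (cscale c 1)"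
    and rho_invol: "x \<in> X \<Longrightarrow> y \<in> X \<Longrightarrow> ip (\<rho> a x) y = ip x (\<rho> (invol a) y)"
begin

lemmas rho_linear = adjointable_linear[OF rho_adjointable]

lemma rho_zero [simp]: "x \<in> X \<Longrightarrow> \<rho> 0 x = 0"
  using rho_add[of x 0 0] by simp

lemma rho_diff: "x \<in> X \<Longrightarrow> \<rho> (a - b) x = \<rho> a x - \<rho> b x"
  using rho_add[of x "a - b" b] by (simp add: eq_diff_eq)

lemma rho_sum: "x \<in> X \<Longrightarrow> \<rho> (\<Sum>i\<in>I. f i) x = (\<Sum>i\<in>I. \<rho> (f i) x)"
  by (induction I rule: infinite_finite_induct) (auto simp: rho_add)

lemma rho_scaleR: "x \<in> X \<Longrightarrow> \<rho> (r *\<^sub>R a) x = rm (\<rho> a x) (r *\<^sub>R 1)"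
  using rho_cscale[of x "complex_of_real r" a] by (simp add: cscale_def)

text \<open>Write (norm a)^2 minus \<open>invol a * a\<close> as \<open>invol d * d\<close>; the
  representation turns this into \<open>ip (\<rho> d x) (\<rho> d x)\<close>, which is
  positive.\<close>

lemma hn_rho_le: "x \<in> X \<Longrightarrow> hn (\<rho> a x) \<le> norm a * hn x"
proof -
  assume x: "x \<in> X"
  have "cpos (((norm a)\<^sup>2) *\<^sub>R 1 - invol a * a)"
    by (rule cpos_norm_diff) (auto simp: invol_mult invol_invol cstar_identity)
  then obtain d where d: "((norm a)\<^sup>2) *\<^sub>R 1 - invol a * a = invol d * d" by (auto simp: cpos_def)
  have "ip (\<rho> d x) (\<rho> d x) = ip x (\<rho> (invol d * d) x)" using x by (simp add: rho_invol rho_mult rho_linear)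
  also have "\<dots> = (norm a)\<^sup>2 *\<^sub>R ip x x - ip (\<rho> a x) (\<rho> a x)"
    using x by (simp add: d[symmetric] rho_diff rho_scaleR rho_one ip_diff_right rho_linear ip_rm_right rho_mult rho_invol)
  finally have "cpos ((norm a)\<^sup>2 *\<^sub>R ip x x - ip (\<rho> a x) (\<rho> a x))" using cpos_ip[of "\<rho> d x"] x rho_linear by simp
  then have "norm (ip (\<rho> a x) (\<rho> a x)) \<le> norm ((norm a)\<^sup>2 *\<^sub>R ip x x)"
    using x by (intro cpos_norm_mono) (auto simp: rho_linear)
  then have "(hn (\<rho> a x))\<^sup>2 \<le> (norm a * hn x)\<^sup>2" by (simp add: hn_square power_mult_distrib)
  then show ?thesis by (rule power2_le_imp_le) simp
qed

lemma bounded_linear_coefficient: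
  assumes "x \<in> X" "y \<in> X" shows "bounded_linear (\<lambda>a. ip x (\<rho> a y))"
proof (rule bounded_linear_intro[of _ "hn x * hn y"])
  fix a b r
  show "ip x (\<rho> (a + b) y) = ip x (\<rho> a y) + ip x (\<rho> b y)" using assms by (simp add: rho_add ip_add_right rho_linear)
  show "ip x (\<rho> (r *\<^sub>R a) y) = r *\<^sub>R ip x (\<rho> a y)" using assms by (simp add: rho_scaleR ip_rm_right rho_linear)
  have "norm (ip x (\<rho> a y)) \<le> hn x * (norm a * hn y)"
    using assms by (intro order_trans[OF norm_ip_le] mult_left_mono hn_rho_le) (auto simp: rho_linear)
  then show "norm (ip x (\<rho> a y)) \<le> norm a * (hn x * hn y)" by (simp add: mult_ac)
qed

end

text \<open>Density is required only for finite combinations, so no infinite expansions enter. The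
  index set \<open>J\<close> allows the same locale to serve the group and its product with
  \<open>{..<n}\<close>.\<close>

locale hbasis = hmod Y rmY ipY
  for Y :: "'y::ab_group_add set" and rmY :: "'y \<Rightarrow> 'a::cstar \<Rightarrow> 'y" and ipY :: "'y \<Rightarrow> 'y \<Rightarrow> 'a" +
  fixes e :: "'l \<Rightarrow> 'y" and J :: "'l set"
  assumes e_mem: "l \<in> J \<Longrightarrow> e l \<in> Y"
    and e_orth: "l \<in> J \<Longrightarrow> m \<in> J \<Longrightarrow> ipY (e l) (e m) = (if l = m then 1 else 0)"
    and e_dense: "\<xi> \<in> Y \<Longrightarrow> r > 0 \<Longrightarrow> \<exists>F b. finite F \<and> F \<subseteq> J \<and> hnorm ipY (\<xi> - (\<Sum>l\<in>F. rmY (e l) (b l))) < r"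
begin

definition comb :: "'l set \<Rightarrow> ('l \<Rightarrow> 'a) \<Rightarrow> 'y" where
  "comb F b = (\<Sum>l\<in>F. rmY (e l) (b l))"

lemma comb_mem: "F \<subseteq> J \<Longrightarrow> comb F b \<in> Y"
  unfolding comb_def by (intro sum_mem rm_mem e_mem) auto

lemma ip_comb_left: "F \<subseteq> J \<Longrightarrow> \<xi> \<in> Y \<Longrightarrow> ipY (comb F b) \<xi> = (\<Sum>l\<in>F. invol (b l) * ipY (e l) \<xi>)"
  unfolding comb_def by (subst ip_sum_left) (auto simp: ip_rm_left e_mem subset_eq intro!: sum.cong)

lemma ip_comb_right: "F \<subseteq> J \<Longrightarrow> \<xi> \<in> Y \<Longrightarrow> ipY \<xi> (comb F b) = (\<Sum>l\<in>F. ipY \<xi> (e l) * b l)"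
  unfolding comb_def by (subst ip_sum_right) (auto simp: ip_rm_right e_mem subset_eq intro!: sum.cong)

lemma ip_e_comb: "finite F \<Longrightarrow> F \<subseteq> J \<Longrightarrow> l \<in> F \<Longrightarrow> ipY (e l) (comb F b) = b l"
proof -
  assume F: "finite F" "F \<subseteq> J" "l \<in> F"
  then have "ipY (e l) (comb F b) = (\<Sum>m\<in>F. if m = l then b l else 0)"
    by (subst ip_comb_right) (blast, blast intro: e_mem, rule sum.cong, auto simp: e_orth subset_eq)
  then show ?thesis using F by simp
qed

lemma ip_comb_comb: "finite F \<Longrightarrow> F \<subseteq> J \<Longrightarrow> ipY (comb F b) (comb F c) = (\<Sum>l\<in>F. invol (b l) * c l)"
  by (simp add: ip_comb_left comb_mem ip_e_comb)

lemma op_comb: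
  assumes "adjointable Y ipY T" "F \<subseteq> J"
  shows "T (comb F b) = (\<Sum>l\<in>F. rmY (T (e l)) (b l))"
  unfolding comb_def using assms(2)
  by (subst adjointable_linear(6)[OF assms(1)]) (auto simp: e_mem subset_eq adjointable_linear(3)[OF assms(1)])

lemma comb_approx:
  assumes "\<xi> \<in> Y"
  obtains F b where "\<And>n::nat. finite (F n)" "\<And>n. F n \<subseteq> J" "(\<lambda>n. hn (comb (F n) (b n) - \<xi>)) \<longlonglongrightarrow> 0"
proof -
  have "\<exists>F b. finite F \<and> F \<subseteq> J \<and> hn (\<xi> - comb F b) < inverse (real (Suc n))" for n
    unfolding comb_def using e_dense[OF assms, of "inverse (real (Suc n))"] by simp
  then obtain F b where F: "\<And>n::nat. finite (F n)" "\<And>n. F n \<subseteq> J"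
    "\<And>n. hn (\<xi> - comb (F n) (b n)) < inverse (real (Suc n))" by metis
  have "hn (comb (F n) (b n) - \<xi>) \<le> inverse (real (Suc n))" for n
    using F(3)[of n] hn_diff_commute[OF comb_mem[OF F(2)] assms, of n "b n"] by simp
  then have "(\<lambda>n. hn (comb (F n) (b n) - \<xi>)) \<longlonglongrightarrow> 0"
    by (intro tendsto_sandwich[OF _ _ tendsto_const LIMSEQ_inverse_real_of_nat]) auto
  then show thesis using that F by blast
qed

lemma comb_extend: "finite L \<Longrightarrow> F \<subseteq> L \<Longrightarrow> L \<subseteq> J \<Longrightarrow> comb F b = comb L (\<lambda>l. if l \<in> F then b l else 0)"
  unfolding comb_def
  by (rule sum.mono_neutral_cong_left) (auto simp: e_mem subset_eq)

lemma hbasis_pow: "hbasis (pow n) pow_rm (pow_ip n) (\<lambda>(i, l). emb i (e l)) ({..<n} \<times> J)"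
proof -
  interpret P: hmod "pow n" pow_rm "pow_ip n" by (rule hmod_pow)
  show ?thesis
  proof unfold_locales
    fix l assume "l \<in> {..<n} \<times> J"
    then show "(case l of (i, l) \<Rightarrow> emb i (e l)) \<in> pow n" by (auto intro: emb_mem e_mem)
    fix m assume "m \<in> {..<n} \<times> J"
    then show "pow_ip n (case l of (i, l) \<Rightarrow> emb i (e l)) (case m of (i, l) \<Rightarrow> emb i (e l)) = (if l = m then 1 else 0)"
      using \<open>l \<in> {..<n} \<times> J\<close>
      by (auto simp: pow_ip_emb_right emb_mem e_mem) (auto simp: emb_def e_orth e_mem split: if_splits)
  next
    fix \<xi> :: "nat \<Rightarrow> 'y" and r :: real
    assume \<xi>: "\<xi> \<in> pow n" and r: "r > 0"
    \<comment> \<open>The total error of n coordinates stays strictly below \<open>r\<close>, also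
      for \<open>n = 0\<close>.\<close>
    define d where "d = r / (real n + 1)"
    have d: "d > 0" using r by (simp add: d_def)
    have "\<exists>F b. finite F \<and> F \<subseteq> J \<and> hn (\<xi> i - (\<Sum>l\<in>F. rmY (e l) (b l))) < d" for i
      by (rule e_dense[OF pow_component[OF \<xi>] d])
    then obtain F b where F: "\<And>i. finite (F i)" "\<And>i. F i \<subseteq> J"
      "\<And>i. hn (\<xi> i - (\<Sum>l\<in>F i. rmY (e l) (b i l))) < d" by metis
    let ?\<eta> = "\<Sum>(i, l)\<in>Sigma {..<n} F. pow_rm (emb i (e l)) (b i l)"
    have \<eta>: "?\<eta> i = (\<Sum>l\<in>F i. rmY (e l) (b i l))" if i: "i < n" for i
    proof -
      have "?\<eta> = (\<Sum>j<n. \<Sum>l\<in>F j. pow_rm (emb j (e l)) (b j l))" using F by (subst sum.Sigma) auto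
      then have "?\<eta> i = (\<Sum>j<n. \<Sum>l\<in>F j. rmY (emb j (e l) i) (b j l))"
        by (simp add: sum_fun_apply pow_rm_def)
      also have "\<dots> = (\<Sum>j<n. if j = i then \<Sum>l\<in>F i. rmY (e l) (b i l) else 0)"
        by (intro sum.cong refl) (auto simp: emb_def)
      also have "\<dots> = (\<Sum>l\<in>F i. rmY (e l) (b i l))" using i by simp
      finally show ?thesis .
    qed
    have mem: "(\<Sum>l\<in>F i. rmY (e l) (b i l)) \<in> Y" for i using F(2)[of i] by (intro sum_mem rm_mem e_mem) auto
    have "hnorm (pow_ip n) (\<xi> - ?\<eta>) \<le> (\<Sum>i<n. hn ((\<xi> - ?\<eta>) i))"
      using pow_component[OF \<xi>] mem by (intro hnorm_pow_le_sum) (simp add: \<eta>)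
    also have "\<dots> \<le> (\<Sum>i<n. d)" using F(3) by (intro sum_mono) (simp add: \<eta> less_imp_le)
    also have "\<dots> < r" using r by (simp add: d_def field_simps)
    finally have "hnorm (pow_ip n) (\<xi> - (\<Sum>p\<in>Sigma {..<n} F. pow_rm (case p of (i, l) \<Rightarrow> emb i (e l)) (case p of (i, l) \<Rightarrow> b i l))) < r"
      by (simp add: case_prod_unfold)
    then show "\<exists>F b. finite F \<and> F \<subseteq> {..<n} \<times> J \<and>
        hnorm (pow_ip n) (\<xi> - (\<Sum>l\<in>F. pow_rm (case l of (i, l) \<Rightarrow> emb i (e l)) (b l))) < r"
      using F(1,2) by (intro exI[of _ "Sigma {..<n} F"] exI[of _ "\<lambda>p. case p of (i, l) \<Rightarrow> b i l"]) auto
  qed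
qed

end

section \<open>Gram sums and the bound for Schur maps\<close>

locale schur = hbasis Y rmY ipY e J + R: star_rep X rm ip \<rho>
  for Y :: "'y::ab_group_add set" and rmY :: "'y \<Rightarrow> 'a::cstar \<Rightarrow> 'y" and ipY :: "'y \<Rightarrow> 'y \<Rightarrow> 'a"
    and e :: "'l \<Rightarrow> 'y" and J :: "'l set"
    and X :: "'x::ab_group_add set" and rm :: "'x \<Rightarrow> 'a \<Rightarrow> 'x" and ip :: "'x \<Rightarrow> 'x \<Rightarrow> 'a"
    and \<rho> :: "'a \<Rightarrow> 'x \<Rightarrow> 'x"
begin

text \<open>Positivity of the inner product of the interior tensor product of \<open>Y\<close> and \<open>X\<close> along \<open>\<rho>\<close>.\<close>

lemma cpos_tensor_comb:
  assumes L: "finite L" "L \<subseteq> J" and \<zeta>: "\<And>m. m \<in> F \<Longrightarrow> \<zeta> m \<in> X"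
  shows "cpos (\<Sum>m\<in>F. \<Sum>m'\<in>F. ip (\<zeta> m) (\<rho> (ipY (comb L (b m)) (comb L (b m'))) (\<zeta> m')))"
proof -
  have "(\<Sum>m\<in>F. \<Sum>m'\<in>F. ip (\<zeta> m) (\<rho> (ipY (comb L (b m)) (comb L (b m'))) (\<zeta> m')))
      = (\<Sum>m\<in>F. \<Sum>m'\<in>F. \<Sum>l\<in>L. ip (\<rho> (b m l) (\<zeta> m)) (\<rho> (b m' l) (\<zeta> m')))"
    using L \<zeta> by (intro sum.cong refl)
      (simp add: ip_comb_comb R.rho_sum R.ip_sum_right R.rho_linear R.rho_mult R.rho_invol)
  also have "\<dots> = (\<Sum>l\<in>L. \<Sum>m\<in>F. \<Sum>m'\<in>F. ip (\<rho> (b m l) (\<zeta> m)) (\<rho> (b m' l) (\<zeta> m')))"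
    by (subst (2) sum.swap, subst sum.swap) (rule refl)
  also have "\<dots> = (\<Sum>l\<in>L. ip (\<Sum>m\<in>F. \<rho> (b m l) (\<zeta> m)) (\<Sum>m\<in>F. \<rho> (b m l) (\<zeta> m)))"
    using \<zeta> by (intro sum.cong refl) (simp add: R.ip_sum_left R.ip_sum_right R.rho_linear, rule sum.swap)
  finally show ?thesis using \<zeta> by (auto intro!: cpos_sum R.cpos_ip R.sum_mem simp: R.rho_linear)
qed

text \<open>Density reduces to finite combinations; those belonging to the finitely many
  \<open>v m\<close> are rewritten over one common finite index set, where
  \<open>cpos_tensor_comb\<close> applies.\<close>

lemma cpos_tensor:
  assumes F: "finite F" and v: "\<And>m. m \<in> F \<Longrightarrow> v m \<in> Y" and \<zeta>: "\<And>m. m \<in> F \<Longrightarrow> \<zeta> m \<in> X"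
  shows "cpos (\<Sum>m\<in>F. \<Sum>m'\<in>F. ip (\<zeta> m) (\<rho> (ipY (v m) (v m')) (\<zeta> m')))"
proof -
  have "\<exists>G b. (\<forall>n::nat. finite (G n)) \<and> (\<forall>n. G n \<subseteq> J) \<and> (\<lambda>n. hn (comb (G n) (b n) - v m)) \<longlonglongrightarrow> 0"
    if "m \<in> F" for m using comb_approx[OF v[OF that]] by metis
  then obtain G b where G: "\<And>m n::nat. m \<in> F \<Longrightarrow> finite (G m n)" "\<And>m n. m \<in> F \<Longrightarrow> G m n \<subseteq> J"
    "\<And>m. m \<in> F \<Longrightarrow> (\<lambda>n. hn (comb (G m n) (b m n) - v m)) \<longlonglongrightarrow> 0" by metis
  define u where "u m n = comb (G m n) (b m n)" for m n
  have u: "u m n \<in> Y" if "m \<in> F" for m n using G that by (simp add: u_def comb_mem)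
  have "(\<lambda>n. \<Sum>m\<in>F. \<Sum>m'\<in>F. ip (\<zeta> m) (\<rho> (ipY (u m n) (u m' n)) (\<zeta> m')))
      \<longlonglongrightarrow> (\<Sum>m\<in>F. \<Sum>m'\<in>F. ip (\<zeta> m) (\<rho> (ipY (v m) (v m')) (\<zeta> m')))"
  proof (intro tendsto_sum)
    fix m m' assume mm: "m \<in> F" "m' \<in> F"
    have "(\<lambda>n. ipY (u m n) (u m' n)) \<longlonglongrightarrow> ipY (v m) (v m')"
      using mm u v G(3) by (intro tendsto_ip) (auto simp: u_def)
    then show "(\<lambda>n. ip (\<zeta> m) (\<rho> (ipY (u m n) (u m' n)) (\<zeta> m'))) \<longlonglongrightarrow> ip (\<zeta> m) (\<rho> (ipY (v m) (v m')) (\<zeta> m'))"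
      using mm \<zeta> by (intro bounded_linear.tendsto[OF R.bounded_linear_coefficient]) auto
  qed
  moreover have "cpos (\<Sum>m\<in>F. \<Sum>m'\<in>F. ip (\<zeta> m) (\<rho> (ipY (u m n) (u m' n)) (\<zeta> m')))" for n
  proof -
    define L where "L = (\<Union>m\<in>F. G m n)"
    have "finite L" using F G(1) by (simp add: L_def)
    moreover have "L \<subseteq> J" using G(2) unfolding L_def by blast
    ultimately have L: "finite L" "L \<subseteq> J" .
    have "u m n = comb L (\<lambda>l. if l \<in> G m n then b m n l else 0)" if "m \<in> F" for m
      unfolding u_def using L that by (intro comb_extend) (auto simp: L_def)
    then show ?thesis using cpos_tensor_comb[OF L \<zeta>, where b = "\<lambda>m l. if l \<in> G m n then b m n l else 0"]
      by simp
  qed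
  ultimately show ?thesis by (rule cpos_LIMSEQ)
qed

text \<open>Each summand is \<open>ip (x l) (x l)\<close> conjugated by \<open>b l\<close>, hence
  below c^2 times \<open>invol (b l) * b l\<close>, and these sum to the inner square of the
  combination.\<close>

lemma norm_sum_rm_le:
  assumes "\<And>l. l \<in> L \<Longrightarrow> x l \<in> X" "\<And>l. l \<in> L \<Longrightarrow> hnorm ip (x l) \<le> c" "finite L" "L \<subseteq> J" "c \<ge> 0"
  shows "norm (\<Sum>l\<in>L. ip (rm (x l) (b l)) (rm (x l) (b l))) \<le> c\<^sup>2 * (hn (comb L b))\<^sup>2"
proof -
  have "norm (\<Sum>l\<in>L. ip (rm (x l) (b l)) (rm (x l) (b l))) \<le> norm (\<Sum>l\<in>L. c\<^sup>2 *\<^sub>R (invol (b l) * b l))"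
  proof (rule cpos_norm_mono)
    show "cpos (\<Sum>l\<in>L. ip (rm (x l) (b l)) (rm (x l) (b l)))" using assms(1) by (intro cpos_sum) auto
    have "cpos (c\<^sup>2 *\<^sub>R (invol (b l) * b l) - ip (rm (x l) (b l)) (rm (x l) (b l)))" if "l \<in> L" for l
    proof -
      have "norm (ip (x l) (x l)) \<le> c\<^sup>2" using power_mono[OF assms(2)[OF that] R.hn_nonneg, of 2] R.hn_square by simp
      then show ?thesis using cpos_norm_conj_diff[of "ip (x l) (x l)" "c\<^sup>2" "b l"] assms(1)[OF that]
        by (simp add: R.ip_rm_left R.ip_rm_right mult.assoc)
    qed
    then show "cpos ((\<Sum>l\<in>L. c\<^sup>2 *\<^sub>R (invol (b l) * b l)) - (\<Sum>l\<in>L. ip (rm (x l) (b l)) (rm (x l) (b l))))"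
      by (simp flip: sum_subtractf add: cpos_sum)
  qed
  also have "\<dots> = c\<^sup>2 * (hn (comb L b))\<^sup>2"
    using assms by (simp add: hn_square ip_comb_comb flip: scaleR_sum_right)
  finally show ?thesis .
qed

text \<open>The coefficients are absorbed into the vectors, since \<open>\<rho> (c l m)\<close>
  commutes with the right action. The family \<open>c\<close> stays abstract: it is instantiated by
  entries in \<open>schur_bound\<close> and by Gram elements in
  \<open>schur_positive\<close>.\<close>

lemma schur_form:
  assumes R: "R \<in> ops"
    and x: "\<And>l. l \<in> J \<Longrightarrow> x l \<in> X" and y: "\<And>l. l \<in> J \<Longrightarrow> y l \<in> X"
    and entries: "\<And>l m. l \<in> J \<Longrightarrow> m \<in> J \<Longrightarrow> ipY (e l) (R (e m)) = ip (x l) (\<rho> (c l m) (y m))"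
    and L: "finite L" "L \<subseteq> J" and F: "finite F" "F \<subseteq> J"
  shows "ipY (comb L a) (R (comb F b)) = (\<Sum>l\<in>L. \<Sum>m\<in>F. ip (rm (x l) (a l)) (\<rho> (c l m) (rm (y m) (b m))))"
proof -
  note RL = adjointable_linear[OF opsD(1)[OF R]]
  have Re: "R (e m) \<in> Y" if "m \<in> F" for m using that F by (intro RL(1) e_mem) auto
  have "ipY (comb L a) (R (comb F b)) = (\<Sum>l\<in>L. invol (a l) * ipY (e l) (R (comb F b)))"
    using L F by (intro ip_comb_left) (auto intro!: RL(1) comb_mem)
  also have "\<dots> = (\<Sum>l\<in>L. invol (a l) * (\<Sum>m\<in>F. ipY (e l) (R (e m)) * b m))"
  proof (intro sum.cong refl arg_cong2[where f = times])
    fix l assume "l \<in> L"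
    then have "e l \<in> Y" using L by (auto intro: e_mem)
    then show "ipY (e l) (R (comb F b)) = (\<Sum>m\<in>F. ipY (e l) (R (e m)) * b m)"
      using Re F by (simp add: op_comb[OF opsD(1)[OF R]] ip_sum_right ip_rm_right)
  qed
  also have "\<dots> = (\<Sum>l\<in>L. \<Sum>m\<in>F. invol (a l) * ip (x l) (\<rho> (c l m) (y m)) * b m)"
    using L F by (auto simp: sum_distrib_left entries mult.assoc subset_eq intro!: sum.cong)
  also have "\<dots> = (\<Sum>l\<in>L. \<Sum>m\<in>F. ip (rm (x l) (a l)) (\<rho> (c l m) (rm (y m) (b m))))"
  proof (intro sum.cong refl)
    fix l m assume "l \<in> L" "m \<in> F"
    then have "x l \<in> X" "y m \<in> X" using x y L F by auto
    then show "invol (a l) * ip (x l) (\<rho> (c l m) (y m)) * b m = ip (rm (x l) (a l)) (\<rho> (c l m) (rm (y m) (b m)))"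
      by (simp add: R.rho_linear R.ip_rm_left R.ip_rm_right mult.assoc)
  qed
  finally show ?thesis .
qed

text \<open>By \<open>schur_form\<close> the form at a finite combination is the Gram sum of
  \<open>cpos_tensor\<close> with the vectors \<open>B (e l)\<close> in place of \<open>v\<close>;
  density does the rest.\<close>

lemma schur_positive:
  assumes R: "R \<in> ops" and B: "B \<in> ops" and x: "\<And>l. l \<in> J \<Longrightarrow> x l \<in> X"
    and entries: "\<And>l m. l \<in> J \<Longrightarrow> m \<in> J \<Longrightarrow> ipY (e l) (R (e m)) = ip (x l) (\<rho> (ipY (B (e l)) (B (e m))) (x m))"
    and \<xi>: "\<xi> \<in> Y"
  shows "cpos (ipY \<xi> (R \<xi>))"
proof -
  note RL = adjointable_linear[OF opsD(1)[OF R]] and BL = adjointable_linear[OF opsD(1)[OF B]]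
  obtain F b where F: "\<And>n::nat. finite (F n)" "\<And>n. F n \<subseteq> J" "(\<lambda>n. hn (comb (F n) (b n) - \<xi>)) \<longlonglongrightarrow> 0"
    using comb_approx[OF \<xi>] by metis
  have mem: "comb (F n) (b n) \<in> Y" for n using F by (simp add: comb_mem)
  have "(\<lambda>n. ipY (comb (F n) (b n)) (R (comb (F n) (b n)))) \<longlonglongrightarrow> ipY \<xi> (R \<xi>)"
    using mem \<xi> F(3) tendsto_op[OF opsD(1)[OF R] mem \<xi> F(3)] RL by (intro tendsto_ip) auto
  moreover have "cpos (ipY (comb (F n) (b n)) (R (comb (F n) (b n))))" for n
  proof -
    have "cpos (\<Sum>l\<in>F n. \<Sum>m\<in>F n. ip (rm (x l) (b n l)) (\<rho> (ipY (B (e l)) (B (e m))) (rm (x m) (b n m))))"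
      using F(2)[of n] x BL e_mem by (intro cpos_tensor F) (auto simp: subset_eq)
    then show ?thesis using schur_form[OF R x x entries F(1,2) F(1,2)] by simp
  qed
  ultimately show ?thesis by (rule cpos_LIMSEQ)
qed

text \<open>The estimate for S tensor 1 followed by the projection onto the coordinates in
  \<open>L\<close>. Two Gram sums are shown positive and added: one, from Q, bounds the image by the
  norm of \<open>S\<close>; the other is a Bessel inequality for discarding coordinates outside
  \<open>L\<close>.\<close>

lemma schur_row_bound:
  assumes S: "S \<in> ops" and L: "finite L" "L \<subseteq> J" and F: "finite F" "F \<subseteq> J" and \<zeta>: "\<And>m. m \<in> F \<Longrightarrow> \<zeta> m \<in> X"
  defines "\<kappa> \<equiv> \<lambda>l. \<Sum>m\<in>F. \<rho> (ipY (e l) (S (e m))) (\<zeta> m)"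
  shows "norm (\<Sum>l\<in>L. ip (\<kappa> l) (\<kappa> l)) \<le> (nrm S)\<^sup>2 * norm (\<Sum>m\<in>F. ip (\<zeta> m) (\<zeta> m))"
proof -
  note SL = adjointable_linear[OF opsD(1)[OF S]]
  define s where "s = nrm S"
  have s: "s \<ge> 0" unfolding s_def by (rule opnorm_nonneg[OF opsD(1)[OF S]])
  define c where "c l m = ipY (e l) (S (e m))" for l m
  have eF: "e m \<in> Y" "S (e m) \<in> Y" if "m \<in> F" for m using that F SL e_mem by auto
  have eL: "e l \<in> Y" if "l \<in> L" for l using that L e_mem by auto
  obtain S' where S': "S' \<in> ops" "adj_pair S S'" using ops_adjoint[OF S] .
  note SD = adj_pairD[OF S'(2)]
  define U where "U = op_comp Y S' S"
  have U: "U \<in> ops" unfolding U_def by (rule ops_closed[OF S'(1) S])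
  have U_sa: "adj_pair U U" unfolding U_def by (rule adj_pair_ops[OF adj_pair_sym[OF S'(2)] S'(2)])
  have U_ip: "ipY u (U w) = ipY (S u) (S w)" if "u \<in> Y" "w \<in> Y" for u w using that SD(3)[of u "S w"] by (simp add: U_def SD(1))
  have U_bound: "hn (U u) \<le> s\<^sup>2 * hn u" if u: "u \<in> Y" for u
  proof -
    have "hn (S' (S u)) \<le> s * hn (S u)"
      unfolding s_def using u SL by (intro adj_pair_bound[OF S'(2) opnorm_bound[OF opsD(1)[OF S]]]) auto
    also have "\<dots> \<le> s * (s * hn u)"
      using s u unfolding s_def by (intro mult_left_mono opnorm_bound[OF opsD(1)[OF S]]) auto
    finally show ?thesis using u by (simp add: U_def power2_eq_square)
  qed
  define P where "P = op_diff Y (op_smul Y rmY (complex_of_real (s\<^sup>2)) (restr Y (\<lambda>x. x))) U"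
  have P: "P \<in> ops" unfolding P_def by (intro ops_closed[OF _ U] ops_closed(4)[OF id_mem_ops id_mem_ops])
  have P_ip: "ipY u (P w) = s\<^sup>2 *\<^sub>R ipY u w - ipY (S u) (S w)" if "u \<in> Y" "w \<in> Y" for u w
  proof -
    have "P w = rmY w (s\<^sup>2 *\<^sub>R 1) - U w" using that unfolding P_def by (simp only: op_apply restr_apply cscale_of_real_one)
    then show ?thesis using that adjointable_linear(1)[OF opsD(1)[OF U]]
      by (simp add: ip_diff_right ip_rm_right U_ip)
  qed
  obtain Q where Q: "Q \<in> ops" "adj_pair Q Q" "\<And>u. u \<in> Y \<Longrightarrow> Q (Q u) = P u"
  proof (rule op_sqrt[OF cstar_subalg_ops id_mem_ops P])
    fix u assume u: "u \<in> Y"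
    have "cpos (s\<^sup>2 *\<^sub>R ipY u u - ipY u (U u))" using U_bound u by (intro cpos_form_diff U_sa) auto
    then show "cpos (ipY u (P u))" using u by (simp add: P_ip U_ip)
  qed blast
  have Q_ip: "ipY (Q (e m)) (Q (e m')) = s\<^sup>2 *\<^sub>R (if m = m' then 1 else 0) - ipY (S (e m)) (S (e m'))"
    if "m \<in> F" "m' \<in> F" for m m'
  proof -
    have "ipY (Q (e m)) (Q (e m')) = ipY (e m) (P (e m'))"
      using eF that Q(3) adj_pairD(1,3)[OF Q(2)] by simp
    then show ?thesis using P_ip eF that e_orth F(2) by (simp add: subset_eq)
  qed
  let ?G = "\<lambda>f. \<Sum>m\<in>F. \<Sum>m'\<in>F. ip (\<zeta> m) (\<rho> (f m m') (\<zeta> m'))"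
  have G_diff: "?G (\<lambda>m m'. f m m' - g m m') = ?G f - ?G g" for f g
    using \<zeta> by (simp add: R.rho_diff R.ip_diff_right R.rho_linear sum_subtractf)
  have "?G (\<lambda>m m'. s\<^sup>2 *\<^sub>R (if m = m' then 1 else 0)) = s\<^sup>2 *\<^sub>R (\<Sum>m\<in>F. ip (\<zeta> m) (\<zeta> m))"
  proof -
    have "ip (\<zeta> m) (\<rho> (s\<^sup>2 *\<^sub>R (if m = m' then 1 else 0)) (\<zeta> m')) = (if m' = m then s\<^sup>2 *\<^sub>R ip (\<zeta> m) (\<zeta> m) else 0)"
      if "m \<in> F" "m' \<in> F" for m m'
      using \<zeta> that by (simp add: R.rho_scaleR R.rho_one R.ip_rm_right)
    then show ?thesis using F(1) by (simp add: scaleR_sum_right)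
  qed
  moreover have "cpos (?G (\<lambda>m m'. ipY (Q (e m)) (Q (e m'))))"
    using eF \<zeta> adj_pairD(1)[OF Q(2)] by (intro cpos_tensor F) auto
  then have "cpos (?G (\<lambda>m m'. s\<^sup>2 *\<^sub>R (if m = m' then 1 else 0) - ipY (S (e m)) (S (e m'))))"
    by (simp add: Q_ip cong: sum.cong)
  ultimately have 1: "cpos (s\<^sup>2 *\<^sub>R (\<Sum>m\<in>F. ip (\<zeta> m) (\<zeta> m)) - ?G (\<lambda>m m'. ipY (S (e m)) (S (e m'))))"
    by (simp only: G_diff)
  \<comment> \<open>The part of \<open>S (e m)\<close> orthogonal to all \<open>e l\<close> with l
    in \<open>L\<close>; its Gram matrix is the defect in Bessel's inequality.\<close>
  define w where "w m = S (e m) - comb L (\<lambda>l. c l m)" for m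
  have w: "w m \<in> Y" if "m \<in> F" for m using eF that L by (simp add: w_def comb_mem)
  have w_ip: "ipY (w m) (w m') = ipY (S (e m)) (S (e m')) - (\<Sum>l\<in>L. invol (c l m) * c l m')" if mm: "m \<in> F" "m' \<in> F" for m m'
  proof -
    have "ipY (S (e m)) (comb L (\<lambda>l. c l m')) = (\<Sum>l\<in>L. invol (c l m) * c l m')"
      using L eF mm eL by (simp add: ip_comb_right c_def invol_ip cong: sum.cong)
    moreover have "ipY (comb L (\<lambda>l. c l m)) (S (e m')) = (\<Sum>l\<in>L. invol (c l m) * c l m')"
      using L eF mm eL by (simp add: ip_comb_left c_def)
    ultimately show ?thesis unfolding w_def using L eF mm
      by (simp add: ip_diff_left ip_diff_right comb_mem ip_comb_comb)
  qed
  have "cpos (?G (\<lambda>m m'. ipY (w m) (w m')))" using w \<zeta> by (intro cpos_tensor F) auto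
  then have "cpos (?G (\<lambda>m m'. ipY (S (e m)) (S (e m')) - (\<Sum>l\<in>L. invol (c l m) * c l m')))"
    by (simp add: w_ip cong: sum.cong)
  then have 2: "cpos (?G (\<lambda>m m'. ipY (S (e m)) (S (e m'))) - ?G (\<lambda>m m'. \<Sum>l\<in>L. invol (c l m) * c l m'))"
    by (simp only: G_diff)
  have "?G (\<lambda>m m'. \<Sum>l\<in>L. invol (c l m) * c l m') = (\<Sum>m\<in>F. \<Sum>m'\<in>F. \<Sum>l\<in>L. ip (\<rho> (c l m) (\<zeta> m)) (\<rho> (c l m') (\<zeta> m')))"
    using \<zeta> by (intro sum.cong refl) (simp add: R.rho_sum R.ip_sum_right R.rho_linear R.rho_mult R.rho_invol)
  also have "\<dots> = (\<Sum>l\<in>L. \<Sum>m\<in>F. \<Sum>m'\<in>F. ip (\<rho> (c l m) (\<zeta> m)) (\<rho> (c l m') (\<zeta> m')))"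
    by (subst (2) sum.swap, subst sum.swap) (rule refl)
  also have "\<dots> = (\<Sum>l\<in>L. ip (\<kappa> l) (\<kappa> l))"
    unfolding \<kappa>_def c_def[symmetric]
    using \<zeta> by (intro sum.cong refl) (simp add: R.ip_sum_left R.ip_sum_right R.rho_linear, rule sum.swap)
  finally have 3: "?G (\<lambda>m m'. \<Sum>l\<in>L. invol (c l m) * c l m') = (\<Sum>l\<in>L. ip (\<kappa> l) (\<kappa> l))" .
  have "cpos (s\<^sup>2 *\<^sub>R (\<Sum>m\<in>F. ip (\<zeta> m) (\<zeta> m)) - (\<Sum>l\<in>L. ip (\<kappa> l) (\<kappa> l)))"
    using cpos_add[OF 1 2] unfolding 3 by simp
  moreover have "cpos (\<Sum>l\<in>L. ip (\<kappa> l) (\<kappa> l))"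
    unfolding \<kappa>_def using \<zeta> by (intro cpos_sum R.cpos_ip R.sum_mem) (auto simp: R.rho_linear)
  ultimately have "norm (\<Sum>l\<in>L. ip (\<kappa> l) (\<kappa> l)) \<le> norm (s\<^sup>2 *\<^sub>R (\<Sum>m\<in>F. ip (\<zeta> m) (\<zeta> m)))"
    by (intro cpos_norm_mono)
  then show ?thesis by (simp add: s_def)
qed

text \<open>The form is bounded on pairs of finite combinations, by Cauchy--Schwarz with
  \<open>schur_row_bound\<close>. The bound then passes to \<open>R\<close> on finite combinations
  and, by density, to all vectors.\<close>

lemma schur_bound:
  assumes R: "R \<in> ops" and S: "S \<in> ops"
    and x: "\<And>l. l \<in> J \<Longrightarrow> x l \<in> X" "\<And>l. l \<in> J \<Longrightarrow> hnorm ip (x l) \<le> cx" and cx: "cx \<ge> 0"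
    and y: "\<And>l. l \<in> J \<Longrightarrow> y l \<in> X" "\<And>l. l \<in> J \<Longrightarrow> hnorm ip (y l) \<le> cy" and cy: "cy \<ge> 0"
    and entries: "\<And>l m. l \<in> J \<Longrightarrow> m \<in> J \<Longrightarrow> ipY (e l) (R (e m)) = ip (x l) (\<rho> (ipY (e l) (S (e m))) (y m))"
  shows "\<xi> \<in> Y \<Longrightarrow> hn (R \<xi>) \<le> cx * cy * nrm S * hn \<xi>"
proof -
  note RL = adjointable_linear[OF opsD(1)[OF R]]
  define K where "K = cx * cy * nrm S"
  have K: "K \<ge> 0" using cx cy opnorm_nonneg[OF opsD(1)[OF S]] by (simp add: K_def)
  have form: "norm (ipY (comb L a) (R (comb F b))) \<le> K * hn (comb L a) * hn (comb F b)"
    if L: "finite L" "L \<subseteq> J" and F: "finite F" "F \<subseteq> J" for L a F b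
  proof -
    define \<omega> \<zeta> where "\<omega> l = rm (x l) (a l)" and "\<zeta> m = rm (y m) (b m)" for l m
    define \<kappa> where "\<kappa> l = (\<Sum>m\<in>F. \<rho> (ipY (e l) (S (e m))) (\<zeta> m))" for l
    have \<omega>: "\<omega> l \<in> X" if "l \<in> L" for l using that L x by (auto simp: \<omega>_def)
    have \<zeta>: "\<zeta> l \<in> X" if "l \<in> F" for l using that F y by (auto simp: \<zeta>_def)
    have \<kappa>: "\<kappa> l \<in> X" for l unfolding \<kappa>_def using \<zeta> by (intro R.sum_mem) (auto simp: R.rho_linear)
    have "ipY (comb L a) (R (comb F b)) = (\<Sum>l\<in>L. \<Sum>m\<in>F. ip (\<omega> l) (\<rho> (ipY (e l) (S (e m))) (\<zeta> m)))"
      unfolding \<omega>_def \<zeta>_def by (rule schur_form[OF R x(1) y(1) entries L F])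
    also have "\<dots> = (\<Sum>l\<in>L. ip (\<omega> l) (\<kappa> l))"
      unfolding \<kappa>_def using \<omega> \<zeta> by (intro sum.cong refl R.ip_sum_right[symmetric]) (auto simp: R.rho_linear)
    finally have "ipY (comb L a) (R (comb F b)) = (\<Sum>l\<in>L. ip (\<omega> l) (\<kappa> l))" .
    then have "(norm (ipY (comb L a) (R (comb F b))))\<^sup>2 \<le> norm (\<Sum>l\<in>L. ip (\<omega> l) (\<omega> l)) * norm (\<Sum>l\<in>L. ip (\<kappa> l) (\<kappa> l))"
      using R.norm_sum_ip_le[of L \<omega> \<kappa>] \<omega> \<kappa> by simp
    also have "\<dots> \<le> (cx\<^sup>2 * (hn (comb L a))\<^sup>2) * ((nrm S)\<^sup>2 * (cy\<^sup>2 * (hn (comb F b))\<^sup>2))"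
    proof (intro mult_mono)
      show "norm (\<Sum>l\<in>L. ip (\<omega> l) (\<omega> l)) \<le> cx\<^sup>2 * (hn (comb L a))\<^sup>2"
        unfolding \<omega>_def using x L cx by (intro norm_sum_rm_le) auto
      have "norm (\<Sum>l\<in>L. ip (\<kappa> l) (\<kappa> l)) \<le> (nrm S)\<^sup>2 * norm (\<Sum>m\<in>F. ip (\<zeta> m) (\<zeta> m))"
        unfolding \<kappa>_def using \<zeta> by (intro schur_row_bound S L F)
      also have "\<dots> \<le> (nrm S)\<^sup>2 * (cy\<^sup>2 * (hn (comb F b))\<^sup>2)"
        unfolding \<zeta>_def using y F cy by (intro mult_left_mono norm_sum_rm_le) auto
      finally show "norm (\<Sum>l\<in>L. ip (\<kappa> l) (\<kappa> l)) \<le> (nrm S)\<^sup>2 * (cy\<^sup>2 * (hn (comb F b))\<^sup>2)" .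
    qed auto
    also have "\<dots> = (K * hn (comb L a) * hn (comb F b))\<^sup>2"
      by (simp add: K_def power_mult_distrib mult_ac)
    finally show ?thesis by (rule power2_le_imp_le) (simp add: K)
  qed
  \<comment> \<open>The form is tested against combinations approximating
    \<open>R (comb F b)\<close> itself, and one factor of its norm is cancelled.\<close>
  have comb_bound: "hn (R (comb F b)) \<le> K * hn (comb F b)" if F: "finite F" "F \<subseteq> J" for F b
  proof -
    let ?u = "R (comb F b)"
    have u: "?u \<in> Y" using F by (intro RL comb_mem)
    obtain L a where L: "\<And>n::nat. finite (L n)" "\<And>n. L n \<subseteq> J" "(\<lambda>n. hn (comb (L n) (a n) - ?u)) \<longlonglongrightarrow> 0"
      using comb_approx[OF u] by metis
    have mem: "comb (L n) (a n) \<in> Y" for n using L by (simp add: comb_mem)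
    have "(\<lambda>n. norm (ipY (comb (L n) (a n)) ?u)) \<longlonglongrightarrow> norm (ipY ?u ?u)"
      using mem u L(3) by (intro tendsto_norm tendsto_ip) auto
    moreover have "(\<lambda>n. K * hn (comb (L n) (a n)) * hn (comb F b)) \<longlonglongrightarrow> K * hn ?u * hn (comb F b)"
      by (intro tendsto_intros tendsto_hn mem u L(3))
    ultimately have "norm (ipY ?u ?u) \<le> K * hn ?u * hn (comb F b)"
      using form[OF L(1,2) F] by (intro LIMSEQ_le) auto
    then have "hn ?u * hn ?u \<le> hn ?u * (K * hn (comb F b))"
      unfolding hn_square[symmetric] by (simp add: power2_eq_square mult_ac)
    then show ?thesis using hn_nonneg[of ?u] K by (cases "hn ?u = 0") (auto simp: less_le)
  qed
  show "hn (R \<xi>) \<le> cx * cy * nrm S * hn \<xi>" if \<xi>: "\<xi> \<in> Y"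
  proof -
    obtain F b where F: "\<And>n::nat. finite (F n)" "\<And>n. F n \<subseteq> J" "(\<lambda>n. hn (comb (F n) (b n) - \<xi>)) \<longlonglongrightarrow> 0"
      using comb_approx[OF \<xi>] by metis
    have mem: "comb (F n) (b n) \<in> Y" for n using F by (simp add: comb_mem)
    have "(\<lambda>n. hn (R (comb (F n) (b n)))) \<longlonglongrightarrow> hn (R \<xi>)"
      using mem \<xi> RL by (intro tendsto_hn tendsto_op[OF opsD(1)[OF R] mem \<xi> F(3)]) auto
    moreover have "(\<lambda>n. K * hn (comb (F n) (b n))) \<longlonglongrightarrow> K * hn \<xi>"
      by (intro tendsto_intros tendsto_hn mem \<xi> F(3))
    ultimately show ?thesis unfolding K_def[symmetric]
      using comb_bound[OF F(1,2)] by (intro LIMSEQ_le) auto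
  qed
qed

text \<open>The difference has zero entries, so it is a Schur image for the zero vectors, and
  \<open>schur_bound\<close> with both constants 0 annihilates it.\<close>

lemma ops_eq_if_entries_eq:
  assumes R: "R \<in> ops" and S: "S \<in> ops"
    and entries: "\<And>l m. l \<in> J \<Longrightarrow> m \<in> J \<Longrightarrow> ipY (e l) (R (e m)) = ipY (e l) (S (e m))"
  shows "R = S"
proof (rule ops_eqI[OF R S])
  fix \<xi> assume \<xi>: "\<xi> \<in> Y"
  note RL = adjointable_linear[OF opsD(1)[OF R]] and SL = adjointable_linear[OF opsD(1)[OF S]]
  have D: "op_diff Y R S \<in> ops" by (rule ops_closed[OF R S])
  have "hn (op_diff Y R S \<xi>) \<le> 0 * 0 * nrm (op_diff Y R S) * hn \<xi>"
    by (rule schur_bound[OF D D, of "\<lambda>_. 0" _ "\<lambda>_. 0"])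
      (use \<xi> in \<open>auto simp: e_mem ip_diff_right RL SL entries R.rho_linear\<close>)
  then have "hn (R \<xi> - S \<xi>) = 0" using \<xi> hn_nonneg[of "R \<xi> - S \<xi>"] by simp
  then show "R \<xi> = S \<xi>" using hn_eq_0[of "R \<xi> - S \<xi>"] \<xi> RL SL by simp
qed

end

section \<open>The standard Hilbert module\<close>

text \<open>The Cauchy criterion for unconditional convergence; with it, membership in
  \<open>l2\<close> becomes a statement about finite sums only, where order estimates are
  available.\<close>

lemma summable_on_Cauchy_iff:
  fixes f :: "'i \<Rightarrow> 'b::banach"
  shows "f summable_on UNIV \<longleftrightarrow>
    (\<forall>r>0. \<exists>F0. finite F0 \<and> (\<forall>F. finite F \<and> F \<inter> F0 = {} \<longrightarrow> norm (sum f F) < r))"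
proof
  assume "f summable_on UNIV"
  then obtain S where S: "(sum f \<longlongrightarrow> S) (finite_subsets_at_top UNIV)"
    unfolding summable_on_def has_sum_def by blast
  show "\<forall>r>0. \<exists>F0. finite F0 \<and> (\<forall>F. finite F \<and> F \<inter> F0 = {} \<longrightarrow> norm (sum f F) < r)"
  proof (intro allI impI)
    fix r :: real assume r: "r > 0"
    then have "eventually (\<lambda>F. dist (sum f F) S < r/2) (finite_subsets_at_top UNIV)"
      using S by (intro tendstoD) auto
    then obtain F0 where F0: "finite F0" "\<And>F. finite F \<Longrightarrow> F0 \<subseteq> F \<Longrightarrow> dist (sum f F) S < r/2"
      unfolding eventually_finite_subsets_at_top by auto
    have "norm (sum f F) < r" if F: "finite F" "F \<inter> F0 = {}" for F
    proof -
      have "sum f F = sum f (F \<union> F0) - sum f F0" using F F0 by (simp add: sum.union_disjoint)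
      then have "norm (sum f F) = dist (sum f (F \<union> F0)) (sum f F0)" by (simp add: dist_norm)
      also have "\<dots> \<le> dist (sum f (F \<union> F0)) S + dist (sum f F0) S" by (rule dist_triangle2)
      also have "\<dots> < r/2 + r/2" using F F0 by (intro add_strict_mono F0(2)) auto
      finally show ?thesis by simp
    qed
    then show "\<exists>F0. finite F0 \<and> (\<forall>F. finite F \<and> F \<inter> F0 = {} \<longrightarrow> norm (sum f F) < r)" using F0(1) by blast
  qed
next
  assume Cau: "\<forall>r>0. \<exists>F0. finite F0 \<and> (\<forall>F. finite F \<and> F \<inter> F0 = {} \<longrightarrow> norm (sum f F) < r)"
  have "\<exists>P. eventually P (finite_subsets_at_top UNIV) \<and> (\<forall>F F'. P F \<and> P F' \<longrightarrow> dist (sum f F) (sum f F') < r)"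
    if r: "r > 0" for r
  proof -
    have "r/2 > 0" using r by simp
    then obtain F0 where F0: "finite F0" "\<And>F. finite F \<Longrightarrow> F \<inter> F0 = {} \<Longrightarrow> norm (sum f F) < r/2"
      using Cau by meson
    define P where "P F \<longleftrightarrow> finite F \<and> F0 \<subseteq> F" for F
    have ev: "eventually P (finite_subsets_at_top UNIV)"
      unfolding eventually_finite_subsets_at_top using F0(1) by (auto simp: P_def)
    have close: "dist (sum f F) (sum f F0) < r/2" if "P F" for F
    proof -
      have "sum f F - sum f F0 = sum f (F - F0)" using that by (simp add: P_def sum_diff)
      then show ?thesis using F0(2)[of "F - F0"] that by (auto simp: P_def dist_norm)
    qed
    have "dist (sum f F) (sum f F') < r" if "P F" "P F'" for F F'
      using dist_triangle2[of "sum f F" "sum f F'" "sum f F0"] close[OF that(1)] close[OF that(2)] by linarith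
    then show ?thesis using ev by blast
  qed
  then have "cauchy_filter (filtermap (sum f) (finite_subsets_at_top UNIV))"
    by (simp add: cauchy_filter_metric_filtermap)
  moreover have "complete (UNIV::'b set)" by (meson Cauchy_convergent UNIV_I complete_def convergent_def)
  ultimately obtain L where "(sum f \<longlongrightarrow> L) (finite_subsets_at_top UNIV)"
    using complete_uniform[where S = UNIV] by (force simp add: filterlim_def)
  then show "f summable_on UNIV" using summable_on_def has_sum_def by blast
qed

text \<open>The untwisted standard module. The map sending \<xi> to the function g \<mapsto> inv
  (\<alpha> g) (\<xi> g) identifies \<open>ASig \<alpha>\<close> with it, so the analytic axioms are
  verified here, free of automorphisms.\<close>

definition l2 :: "('i \<Rightarrow> 'a::cstar) set" where
  "l2 = {s. (\<lambda>i. invol (s i) * s i) summable_on UNIV}"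

definition l2_rm :: "('i \<Rightarrow> 'a::cstar) \<Rightarrow> 'a \<Rightarrow> 'i \<Rightarrow> 'a" where
  "l2_rm s a = (\<lambda>i. s i * a)"

definition l2_ip :: "('i \<Rightarrow> 'a::cstar) \<Rightarrow> ('i \<Rightarrow> 'a) \<Rightarrow> 'a" where
  "l2_ip s t = infsum (\<lambda>i. invol (s i) * t i) UNIV"

lemma norm_sum_invol_mult_le:
  fixes s t :: "'i \<Rightarrow> 'a::cstar"
  shows "(norm (\<Sum>i\<in>F. invol (s i) * t i))\<^sup>2 \<le> norm (\<Sum>i\<in>F. invol (s i) * s i) * norm (\<Sum>i\<in>F. invol (t i) * t i)"
proof (rule cauchy_schwarz_cstar)
  show "cpos (\<Sum>i\<in>F. invol (s i) * s i)" by (intro cpos_sum) auto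
  fix a
  have "cpos (\<Sum>i\<in>F. invol (s i * a + t i) * (s i * a + t i))" by (intro cpos_sum) auto
  also have "(\<Sum>i\<in>F. invol (s i * a + t i) * (s i * a + t i)) =
      (\<Sum>i\<in>F. invol a * (invol (s i) * s i) * a + invol a * (invol (s i) * t i) + invol (invol (s i) * t i) * a + invol (t i) * t i)"
    by (intro sum.cong refl) (simp add: invol_add invol_mult invol_invol algebra_simps)
  finally show "cpos (invol a * (\<Sum>i\<in>F. invol (s i) * s i) * a + invol a * (\<Sum>i\<in>F. invol (s i) * t i) +
      invol (\<Sum>i\<in>F. invol (s i) * t i) * a + (\<Sum>i\<in>F. invol (t i) * t i))"
    by (simp add: sum.distrib sum_distrib_left sum_distrib_right invol_sum)
qed

text \<open>The parallelogram law: the difference of the two sides, before taking norms, is the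
  inner square of s - t.\<close>

lemma norm_sum_invol_mult_add_le:
  fixes s t :: "'i \<Rightarrow> 'a::cstar"
  shows "norm (\<Sum>i\<in>F. invol (s i + t i) * (s i + t i))
    \<le> 2 * norm (\<Sum>i\<in>F. invol (s i) * s i) + 2 * norm (\<Sum>i\<in>F. invol (t i) * t i)"
proof -
  let ?a = "\<Sum>i\<in>F. invol (s i) * s i" and ?b = "\<Sum>i\<in>F. invol (t i) * t i"
  have "2 *\<^sub>R ?a + 2 *\<^sub>R ?b - (\<Sum>i\<in>F. invol (s i + t i) * (s i + t i)) = (\<Sum>i\<in>F. invol (s i - t i) * (s i - t i))"
    unfolding scaleR_sum_right sum.distrib[symmetric] sum_subtractf[symmetric]
    by (intro sum.cong refl) (simp add: invol_add invol_diff scaleR_2 algebra_simps)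
  moreover have "cpos \<dots>" by (intro cpos_sum) auto
  ultimately have "norm (\<Sum>i\<in>F. invol (s i + t i) * (s i + t i)) \<le> norm (2 *\<^sub>R ?a + 2 *\<^sub>R ?b)"
    by (intro cpos_norm_mono cpos_sum) auto
  also have "\<dots> \<le> norm (2 *\<^sub>R ?a) + norm (2 *\<^sub>R ?b)" by (rule norm_triangle_ineq)
  finally show ?thesis by simp
qed

lemma l2_iff:
  "s \<in> l2 \<longleftrightarrow> (\<forall>r>0. \<exists>F0. finite F0 \<and> (\<forall>F. finite F \<and> F \<inter> F0 = {} \<longrightarrow> norm (\<Sum>i\<in>F. invol (s i) * s i) < r))"
  unfolding l2_def by (simp add: summable_on_Cauchy_iff)

lemma l2_tail:
  assumes "s \<in> l2" "r > 0"
  obtains F0 where "finite F0" "\<And>F. finite F \<Longrightarrow> F \<inter> F0 = {} \<Longrightarrow> norm (\<Sum>i\<in>F. invol (s i) * s i) < r"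
  using assms unfolding l2_iff by meson

lemma l2_add: "s \<in> l2 \<Longrightarrow> t \<in> l2 \<Longrightarrow> s + t \<in> l2"
  unfolding l2_iff[of "s + t"]
proof (intro allI impI)
  fix r :: real assume st: "s \<in> l2" "t \<in> l2" and r: "r > 0"
  obtain F1 where F1: "finite F1" "\<And>F. finite F \<Longrightarrow> F \<inter> F1 = {} \<Longrightarrow> norm (\<Sum>i\<in>F. invol (s i) * s i) < r/4"
    using l2_tail[OF st(1), of "r/4"] r by auto
  obtain F2 where F2: "finite F2" "\<And>F. finite F \<Longrightarrow> F \<inter> F2 = {} \<Longrightarrow> norm (\<Sum>i\<in>F. invol (t i) * t i) < r/4"
    using l2_tail[OF st(2), of "r/4"] r by auto
  have "norm (\<Sum>i\<in>F. invol ((s + t) i) * (s + t) i) < r" if "finite F" "F \<inter> (F1 \<union> F2) = {}" for F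
  proof -
    have "norm (\<Sum>i\<in>F. invol (s i) * s i) < r/4" using that by (intro F1) auto
    moreover have "norm (\<Sum>i\<in>F. invol (t i) * t i) < r/4" using that by (intro F2) auto
    ultimately show ?thesis using norm_sum_invol_mult_add_le[of s t F] by simp
  qed
  then show "\<exists>F0. finite F0 \<and> (\<forall>F. finite F \<and> F \<inter> F0 = {} \<longrightarrow> norm (\<Sum>i\<in>F. invol ((s + t) i) * (s + t) i) < r)"
    using F1(1) F2(1) by (intro exI[of _ "F1 \<union> F2"]) auto
qed

lemma l2_dominated:
  assumes s: "s \<in> l2" and K: "K \<ge> 0" and dom: "\<And>i. cpos (K *\<^sub>R (invol (s i) * s i) - invol (t i) * t i)"
  shows "t \<in> l2"
  unfolding l2_iff[of t]
proof (intro allI impI)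
  fix r :: real assume r: "r > 0"
  define d where "d = r / (K + 1)"
  have d: "d > 0" using r K by (simp add: d_def)
  obtain F1 where F1: "finite F1" "\<And>F. finite F \<Longrightarrow> F \<inter> F1 = {} \<Longrightarrow> norm (\<Sum>i\<in>F. invol (s i) * s i) < d"
    using l2_tail[OF s d] by metis
  have "norm (\<Sum>i\<in>F. invol (t i) * t i) < r" if F: "finite F" "F \<inter> F1 = {}" for F
  proof -
    have "cpos (\<Sum>i\<in>F. K *\<^sub>R (invol (s i) * s i) - invol (t i) * t i)" by (intro cpos_sum dom)
    then have "cpos (K *\<^sub>R (\<Sum>i\<in>F. invol (s i) * s i) - (\<Sum>i\<in>F. invol (t i) * t i))"
      by (simp add: sum_subtractf scaleR_sum_right)
    then have "norm (\<Sum>i\<in>F. invol (t i) * t i) \<le> norm (K *\<^sub>R (\<Sum>i\<in>F. invol (s i) * s i))"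
      by (intro cpos_norm_mono cpos_sum) auto
    also have "\<dots> = K * norm (\<Sum>i\<in>F. invol (s i) * s i)" using K by simp
    also have "\<dots> \<le> K * d" using F1(2)[OF F] K by (intro mult_left_mono) auto
    also have "\<dots> < (K + 1) * d" using d by simp
    also have "\<dots> = r" using K by (simp add: d_def)
    finally show ?thesis .
  qed
  then show "\<exists>F0. finite F0 \<and> (\<forall>F. finite F \<and> F \<inter> F0 = {} \<longrightarrow> norm (\<Sum>i\<in>F. invol (t i) * t i) < r)"
    using F1(1) by blast
qed

lemma l2_has_sum:
  assumes s: "s \<in> l2" and t: "t \<in> l2"
  shows "((\<lambda>i. invol (s i) * t i) has_sum l2_ip s t) UNIV"
proof -
  have "(\<lambda>i. invol (s i) * t i) summable_on UNIV"
    unfolding summable_on_Cauchy_iff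
  proof (intro allI impI)
    fix r :: real assume r: "r > 0"
    obtain F1 where F1: "finite F1" "\<And>F. finite F \<Longrightarrow> F \<inter> F1 = {} \<Longrightarrow> norm (\<Sum>i\<in>F. invol (s i) * s i) < r"
      using l2_tail[OF s r] by metis
    obtain F2 where F2: "finite F2" "\<And>F. finite F \<Longrightarrow> F \<inter> F2 = {} \<Longrightarrow> norm (\<Sum>i\<in>F. invol (t i) * t i) < r"
      using l2_tail[OF t r] by metis
    have "norm (\<Sum>i\<in>F. invol (s i) * t i) < r" if "finite F" "F \<inter> (F1 \<union> F2) = {}" for F
    proof -
      have "norm (\<Sum>i\<in>F. invol (s i) * s i) < r" using that by (intro F1) auto
      moreover have "norm (\<Sum>i\<in>F. invol (t i) * t i) < r" using that by (intro F2) auto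
      ultimately have "norm (\<Sum>i\<in>F. invol (s i) * s i) * norm (\<Sum>i\<in>F. invol (t i) * t i) < r * r"
        using r by (intro mult_strict_mono') auto
      then have "(norm (\<Sum>i\<in>F. invol (s i) * t i))\<^sup>2 < r\<^sup>2"
        using norm_sum_invol_mult_le[of s t F] by (simp add: power2_eq_square)
      then show ?thesis using r by (intro power2_less_imp_less[of _ r]) auto
    qed
    then show "\<exists>F0. finite F0 \<and> (\<forall>F. finite F \<and> F \<inter> F0 = {} \<longrightarrow> norm (\<Sum>i\<in>F. invol (s i) * t i) < r)"
      using F1(1) F2(1) by (intro exI[of _ "F1 \<union> F2"]) auto
  qed
  then show ?thesis unfolding l2_ip_def by (rule has_sum_infsum)
qed

lemma cpos_has_sum:
  assumes "(f has_sum S) UNIV" "\<And>i. cpos (f i)" "finite F"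
  shows "cpos (S - sum f F)"
proof -
  have "((\<lambda>G. sum f G - sum f F) \<longlongrightarrow> S - sum f F) (finite_subsets_at_top UNIV)"
    using assms(1) unfolding has_sum_def by (intro tendsto_intros)
  moreover have "eventually (\<lambda>G. cpos (sum f G - sum f F)) (finite_subsets_at_top UNIV)"
    unfolding eventually_finite_subsets_at_top
  proof (intro exI[of _ F] conjI allI impI)
    fix G assume "finite G \<and> F \<subseteq> G \<and> G \<subseteq> UNIV"
    then have "sum f G - sum f F = sum f (G - F)" by (simp add: sum_diff)
    then show "cpos (sum f G - sum f F)" using assms(2) by (simp add: cpos_sum)
  qed (use assms in auto)
  ultimately show ?thesis by (rule cpos_tendsto[OF _ finite_subsets_at_top_neq_bot])
qed

lemma norm_has_sum_le:
  fixes f :: "'i \<Rightarrow> 'b::real_normed_vector"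
  assumes "(f has_sum S) UNIV" "\<And>F. finite F \<Longrightarrow> norm (sum f F) \<le> r"
  shows "norm S \<le> r"
proof (rule tendsto_upperbound)
  show "((\<lambda>F. norm (sum f F)) \<longlongrightarrow> norm S) (finite_subsets_at_top UNIV)"
    using assms(1) unfolding has_sum_def by (rule tendsto_norm)
  show "\<forall>\<^sub>F F in finite_subsets_at_top UNIV. norm (sum f F) \<le> r"
    using assms(2) by (intro eventually_finite_subsets_at_top_weakI)
qed simp

lemma l2_sum_le:
  assumes "s \<in> l2" "finite F"
  shows "norm (\<Sum>i\<in>F. invol (s i) * s i) \<le> norm (l2_ip s s)"
  using assms by (intro cpos_norm_mono cpos_has_sum l2_has_sum cpos_sum) auto

lemma l2_norm_component_le: "s \<in> l2 \<Longrightarrow> norm (s i) \<le> hnorm l2_ip s"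
  using l2_sum_le[of s "{i}"] by (simp add: hnorm_def cstar_identity real_le_rsqrt)

lemma zero_mem_l2: "0 \<in> l2"
  by (simp add: l2_def)

lemma minus_mem_l2: "s \<in> l2 \<Longrightarrow> - s \<in> l2"
  by (simp add: l2_def invol_minus)

lemma l2_rm_mem: "s \<in> l2 \<Longrightarrow> l2_rm s a \<in> l2"
proof -
  assume "s \<in> l2"
  then have "(\<lambda>i. invol a * (invol (s i) * s i) * a) summable_on UNIV"
    unfolding l2_def mem_Collect_eq
    by (intro summable_on_bounded_linear[OF bounded_linear_mult_left] summable_on_bounded_linear[OF bounded_linear_mult_right])
  then show ?thesis by (simp add: l2_def l2_rm_def invol_mult mult.assoc)
qed

text \<open>The limit is taken in each component. Estimates for finite sums are uniform in the
  finite set and survive this limit, which yields both membership in \<open>l2\<close> and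
  convergence in norm.\<close>

lemma l2_complete:
  fixes s :: "nat \<Rightarrow> 'i \<Rightarrow> 'a::cstar"
  assumes s: "\<And>n. s n \<in> l2" and Cau: "\<And>r. r > 0 \<Longrightarrow> \<exists>N. \<forall>m\<ge>N. \<forall>n\<ge>N. hnorm l2_ip (s m - s n) < r"
  shows "\<exists>l\<in>l2. \<forall>r>0. \<exists>N. \<forall>n\<ge>N. hnorm l2_ip (s n - l) < r"
proof -
  have diff: "s m - s n \<in> l2" for m n using l2_add[OF s[of m] minus_mem_l2[OF s[of n]]] by simp
  have "Cauchy (\<lambda>n. s n i)" for i
  proof (rule CauchyI)
    fix r :: real assume "r > 0"
    then obtain N where N: "\<And>m n. m \<ge> N \<Longrightarrow> n \<ge> N \<Longrightarrow> hnorm l2_ip (s m - s n) < r" using Cau by blast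
    have le: "norm (s m i - s n i) \<le> hnorm l2_ip (s m - s n)" for m n
      using l2_norm_component_le[OF diff, of m n i] by simp
    show "\<exists>M. \<forall>m\<ge>M. \<forall>n\<ge>M. norm (s m i - s n i) < r"
      by (intro exI[of _ N] allI impI le_less_trans[OF le N])
  qed
  then have "\<forall>i. \<exists>l. (\<lambda>n. s n i) \<longlonglongrightarrow> l" by (simp add: Cauchy_convergent_iff convergent_def)
  then obtain l where l: "\<And>i. (\<lambda>n. s n i) \<longlonglongrightarrow> l i" by metis
  have unif: "\<exists>N. \<forall>n\<ge>N. \<forall>F. finite F \<longrightarrow> norm (\<Sum>i\<in>F. invol (s n i - l i) * (s n i - l i)) \<le> r" if r: "r > 0" for r
  proof -
    obtain N where N: "\<And>m n. m \<ge> N \<Longrightarrow> n \<ge> N \<Longrightarrow> hnorm l2_ip (s m - s n) < sqrt r" using Cau[of "sqrt r"] r by auto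
    have "norm (\<Sum>i\<in>F. invol (s n i - l i) * (s n i - l i)) \<le> r" if n: "n \<ge> N" and F: "finite F" for n F
    proof (rule Lim_bounded)
      show "(\<lambda>m. norm (\<Sum>i\<in>F. invol (s n i - s m i) * (s n i - s m i))) \<longlonglongrightarrow> norm (\<Sum>i\<in>F. invol (s n i - l i) * (s n i - l i))"
        by (intro tendsto_intros tendsto_invol l)
      show "\<forall>m\<ge>N. norm (\<Sum>i\<in>F. invol (s n i - s m i) * (s n i - s m i)) \<le> r"
      proof (intro allI impI)
        fix m assume "m \<ge> N"
        then have "norm (l2_ip (s n - s m) (s n - s m)) < r" using N[OF n, of m] by (simp add: hnorm_def)
        then show "norm (\<Sum>i\<in>F. invol (s n i - s m i) * (s n i - s m i)) \<le> r"
          using l2_sum_le[OF diff F, of n m] by simp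
      qed
    qed
    then show ?thesis by blast
  qed
  have l_mem: "l \<in> l2" unfolding l2_iff
  proof (intro allI impI)
    fix r :: real assume r: "r > 0"
    then obtain N where N: "\<And>F. finite F \<Longrightarrow> norm (\<Sum>i\<in>F. invol (s N i - l i) * (s N i - l i)) \<le> r/8"
      using unif[of "r/8"] by auto
    obtain F1 where F1: "finite F1" "\<And>F. finite F \<Longrightarrow> F \<inter> F1 = {} \<Longrightarrow> norm (\<Sum>i\<in>F. invol (s N i) * s N i) < r/8"
      using l2_tail[OF s[of N], of "r/8"] r by auto
    have "norm (\<Sum>i\<in>F. invol (l i) * l i) < r" if F: "finite F" "F \<inter> F1 = {}" for F
    proof -
      have "norm (\<Sum>i\<in>F. invol (l i) * l i) \<le> 2 * norm (\<Sum>i\<in>F. invol (s N i) * s N i)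
          + 2 * norm (\<Sum>i\<in>F. invol (s N i - l i) * (s N i - l i))"
        using norm_sum_invol_mult_add_le[of "s N" "\<lambda>i. l i - s N i" F]
        by (simp add: minus_diff_eq[of "s N _" "l _", symmetric] invol_minus del: minus_diff_eq)
      then show ?thesis using N[OF F(1)] F1(2)[OF F] r by linarith
    qed
    then show "\<exists>F0. finite F0 \<and> (\<forall>F. finite F \<and> F \<inter> F0 = {} \<longrightarrow> norm (\<Sum>i\<in>F. invol (l i) * l i) < r)"
      using F1(1) by blast
  qed
  have "\<exists>N. \<forall>n\<ge>N. hnorm l2_ip (s n - l) < r" if r: "r > 0" for r
  proof -
    obtain N where N: "\<And>n F. n \<ge> N \<Longrightarrow> finite F \<Longrightarrow> norm (\<Sum>i\<in>F. invol (s n i - l i) * (s n i - l i)) \<le> (r/2)\<^sup>2"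
      using unif[of "(r/2)\<^sup>2"] r by auto
    have "hnorm l2_ip (s n - l) < r" if "n \<ge> N" for n
    proof -
      have mem: "s n - l \<in> l2" using l2_add[OF s minus_mem_l2[OF l_mem], of n] by simp
      have "norm (l2_ip (s n - l) (s n - l)) \<le> (r/2)\<^sup>2"
        using N[OF that] by (intro norm_has_sum_le[OF l2_has_sum[OF mem mem]]) simp
      then have "hnorm l2_ip (s n - l) \<le> r/2" unfolding hnorm_def using r by (intro real_le_lsqrt) auto
      then show ?thesis using r by simp
    qed
    then show ?thesis by blast
  qed
  then show ?thesis using l_mem by blast
qed

lemma hilbert_module_l2: "hilbert_module (l2 :: ('i \<Rightarrow> 'a::cstar) set) l2_rm l2_ip"
proof -
  have add: "l2_ip s (t + u) = l2_ip s t + l2_ip s u" if "s \<in> l2" "t \<in> l2" "u \<in> l2" for s t u :: "'i \<Rightarrow> 'a"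
    using has_sum_add[OF l2_has_sum[OF that(1,2)] l2_has_sum[OF that(1,3)]]
    by (simp add: l2_ip_def[of s "t + u"] infsumI distrib_left)
  have rm: "l2_ip s (l2_rm t a) = l2_ip s t * a" if "s \<in> l2" "t \<in> l2" for s t :: "'i \<Rightarrow> 'a" and a
    using has_sum_bounded_linear[OF bounded_linear_mult_left l2_has_sum[OF that], of a]
    unfolding l2_rm_def l2_ip_def[of s "\<lambda>i. t i * a"] by (intro infsumI) (simp add: mult.assoc)
  have inv: "invol (l2_ip s t) = l2_ip t s" if "s \<in> l2" "t \<in> l2" for s t :: "'i \<Rightarrow> 'a"
    using has_sum_bounded_linear[OF bounded_linear_invol l2_has_sum[OF that]]
    by (simp add: l2_ip_def[of t s] infsumI invol_mult invol_invol)
  have pos: "cpos (l2_ip s s)" if "s \<in> l2" for s :: "'i \<Rightarrow> 'a"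
    using cpos_has_sum[OF l2_has_sum[OF that that], of "{}"] by simp
  have zero: "s = 0" if "s \<in> l2" "l2_ip s s = 0" for s :: "'i \<Rightarrow> 'a"
    using l2_norm_component_le[OF that(1)] that(2) by (auto simp: fun_eq_iff hnorm_def)
  show ?thesis unfolding hilbert_module_def
    apply (intro conjI ballI allI impI)
    subgoal by (rule zero_mem_l2)
    subgoal by (rule l2_add)
    subgoal by (rule minus_mem_l2)
    subgoal by (rule l2_rm_mem)
    subgoal by (auto simp: l2_rm_def distrib_right)
    subgoal by (auto simp: l2_rm_def distrib_left)
    subgoal by (auto simp: l2_rm_def mult.assoc)
    subgoal by (auto simp: l2_rm_def)
    subgoal by (rule add)
    subgoal by (rule rm)
    subgoal by (rule inv)
    subgoal by (rule pos)
    subgoal by (rule zero)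
    subgoal by (rule l2_complete) auto
    done
qed

section \<open>The standard basis and its transport along a bijection\<close>

definition delta :: "'i \<Rightarrow> 'i \<Rightarrow> 'a::cstar" where
  "delta g = (\<lambda>i. if i = g then 1 else 0)"

lemma has_sum_single: "(\<And>i. i \<noteq> g \<Longrightarrow> f i = 0) \<Longrightarrow> (f has_sum f g) UNIV"
  using has_sum_cong_neutral[of "{g}" UNIV f f "f g"] has_sum_finite[of "{g}" f] by auto

lemma delta_mem_l2: "delta g \<in> l2"
  unfolding l2_def mem_Collect_eq summable_on_def
  by (rule exI) (rule has_sum_single[of g], simp add: delta_def)

lemma l2_ip_delta_left: "l2_ip (delta g) s = s g"
  unfolding l2_ip_def using has_sum_single[of g "\<lambda>i. invol (delta g i) * s i"]
  by (simp add: delta_def infsumI)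

lemma hbasis_l2: "hbasis (l2 :: ('i \<Rightarrow> 'a::cstar) set) l2_rm l2_ip delta UNIV"
proof -
  interpret hmod "l2 :: ('i \<Rightarrow> 'a) set" l2_rm l2_ip by (rule hmod.intro[OF hilbert_module_l2])
  show ?thesis
  proof unfold_locales
    show "delta l \<in> (l2 :: ('i \<Rightarrow> 'a) set)" for l by (rule delta_mem_l2)
    show "l2_ip (delta l) (delta m) = (if l = m then 1 else (0::'a))" for l m :: 'i
      by (simp add: l2_ip_delta_left) (simp add: delta_def)
    fix s :: "'i \<Rightarrow> 'a" and r :: real assume s: "s \<in> l2" and r: "r > 0"
    have r2: "(r/2)\<^sup>2 > 0" using r by simp
    obtain F where F: "finite F" "\<And>G. finite G \<Longrightarrow> G \<inter> F = {} \<Longrightarrow> norm (\<Sum>i\<in>G. invol (s i) * s i) < (r/2)\<^sup>2"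
      using l2_tail[OF s r2] by metis
    define u where "u = s - (\<Sum>l\<in>F. l2_rm (delta l) (s l))"
    have u: "u i = (if i \<in> F then 0 else s i)" for i
    proof -
      have "(\<Sum>l\<in>G. l2_rm (delta l) (s l)) i = (\<Sum>l\<in>G. if l = i then s i else 0)" for G
        by (induction G rule: infinite_finite_induct) (auto simp: l2_rm_def delta_def)
      then show ?thesis using F(1) by (simp add: u_def)
    qed
    have mem: "u \<in> l2" unfolding u_def using s by (intro diff_mem sum_mem rm_mem delta_mem_l2)
    have "norm (\<Sum>i\<in>G. invol (u i) * u i) \<le> (r/2)\<^sup>2" if "finite G" for G
    proof -
      have "(\<Sum>i\<in>G. invol (u i) * u i) = (\<Sum>i\<in>G - F. invol (s i) * s i)"
        using that by (intro sum.mono_neutral_cong_right) (auto simp: u)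
      moreover have "(G - F) \<inter> F = {}" by blast
      ultimately show ?thesis using F(2)[of "G - F"] that by simp
    qed
    then have "norm (l2_ip u u) \<le> (r/2)\<^sup>2" by (rule norm_has_sum_le[OF l2_has_sum[OF mem mem]])
    then have "hnorm l2_ip u \<le> r/2" unfolding hnorm_def using r by (intro real_le_lsqrt) auto
    then have "hnorm l2_ip u < r" using r by simp
    then show "\<exists>F b. finite F \<and> F \<subseteq> UNIV \<and> hnorm l2_ip (s - (\<Sum>l\<in>F. l2_rm (delta l) (b l))) < r"
      unfolding u_def using F(1) by blast
  qed
qed

text \<open>All axioms are pulled back along \<phi>. Injectivity returns the identities between
  vectors, and surjectivity supplies the preimage of a limit.\<close>

lemma hbasis_transfer:
  fixes \<phi> :: "'x::ab_group_add \<Rightarrow> 'y::ab_group_add"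
  assumes Y: "hbasis Y rmY ipY e J"
    and \<phi>: "\<And>x x'. \<phi> (x + x') = \<phi> x + \<phi> x'" "inj \<phi>" "surj \<phi>"
    and X: "X = {x. \<phi> x \<in> Y}" and rm: "\<And>x a. \<phi> (rm x a) = rmY (\<phi> x) a"
    and ip: "\<And>x x'. ip x x' = ipY (\<phi> x) (\<phi> x')" and e': "\<And>l. \<phi> (e' l) = e l"
  shows "hbasis X rm ip e' J"
proof -
  interpret Y: hbasis Y rmY ipY e J by (rule Y)
  have zero: "\<phi> 0 = 0" using \<phi>(1)[of 0 0] by simp
  have minus: "\<phi> (- x) = - \<phi> x" for x using \<phi>(1)[of x "- x"] zero by (simp add: eq_neg_iff_add_eq_0 add.commute)
  have diff: "\<phi> (x - x') = \<phi> x - \<phi> x'" for x x' using \<phi>(1)[of x "- x'"] minus by simp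
  have sum: "\<phi> (\<Sum>i\<in>I. f i) = (\<Sum>i\<in>I. \<phi> (f i))" for I and f :: "_ \<Rightarrow> 'x"
    by (induction I rule: infinite_finite_induct) (auto simp: zero \<phi>(1))
  have hn: "hnorm ip x = hnorm ipY (\<phi> x)" for x by (simp add: hnorm_def ip)
  note inj = injD[OF \<phi>(2)]
  have complete: "\<exists>l\<in>X. \<forall>r>0. \<exists>N. \<forall>n\<ge>N. hnorm ip (s n - l) < r"
    if "\<And>n. s n \<in> X" "\<And>r. r > 0 \<Longrightarrow> \<exists>N. \<forall>m\<ge>N. \<forall>n\<ge>N. hnorm ip (s m - s n) < r" for s :: "nat \<Rightarrow> 'x"
  proof -
    have s: "\<phi> (s n) \<in> Y" for n using that(1) X by blast
    have Cau: "\<exists>N. \<forall>m\<ge>N. \<forall>n\<ge>N. hnorm ipY (\<phi> (s m) - \<phi> (s n)) < r" if "r > 0" for r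
      using \<open>\<And>r. r > 0 \<Longrightarrow> \<exists>N. \<forall>m\<ge>N. \<forall>n\<ge>N. hnorm ip (s m - s n) < r\<close>[OF that] by (simp add: hn diff)
    obtain l where l: "l \<in> Y" "(\<lambda>n. hnorm ipY (\<phi> (s n) - l)) \<longlonglongrightarrow> 0"
      using Y.complete[OF s Cau] by metis
    obtain x where x: "\<phi> x = l" using \<phi>(3) by (metis surjD)
    have "\<exists>N. \<forall>n\<ge>N. hnorm ip (s n - x) < r" if "r > 0" for r
      using LIMSEQ_D[OF l(2) that] by (simp add: hn diff x)
    then show ?thesis using l x X by blast
  qed
  have "hilbert_module X rm ip"
    unfolding hilbert_module_def
    apply (intro conjI ballI allI impI)
    subgoal by (simp add: X zero)
    subgoal by (simp add: X \<phi>(1))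
    subgoal by (simp add: X minus)
    subgoal by (simp add: X rm)
    subgoal by (rule inj) (simp add: X \<phi>(1) rm Y.rm_add_left)
    subgoal by (rule inj) (simp add: X \<phi>(1) rm Y.rm_add_right)
    subgoal by (rule inj) (simp add: X rm Y.rm_rm)
    subgoal by (rule inj) (simp add: X rm)
    subgoal by (simp add: X ip \<phi>(1) Y.ip_add_right)
    subgoal by (simp add: X ip rm Y.ip_rm_right)
    subgoal by (simp add: X ip Y.invol_ip)
    subgoal by (simp add: X ip)
    subgoal by (rule inj) (simp add: X ip zero Y.ip_self_eq_0)
    subgoal by (rule complete) auto
    done
  then interpret X: hmod X rm ip by (rule hmod.intro)
  show ?thesis
  proof unfold_locales
    fix l assume l: "l \<in> J"
    then show "e' l \<in> X" by (simp add: X e' Y.e_mem)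
    fix m assume "m \<in> J"
    with l show "ip (e' l) (e' m) = (if l = m then 1 else 0)" by (simp add: ip e' Y.e_orth)
  next
    fix x :: 'x and r :: real assume "x \<in> X" "r > 0"
    then show "\<exists>F b. finite F \<and> F \<subseteq> J \<and> hnorm ip (x - (\<Sum>l\<in>F. rm (e' l) (b l))) < r"
      using Y.e_dense[of "\<phi> x" r] by (simp add: X hn diff sum rm e')
  qed
qed

section \<open>Generated C*-algebras and the twisted regular representation\<close>

context hmod begin

text \<open>The norm closure, expressed by a uniform estimate on vectors so that no supremum has to
  be computed.\<close>

definition op_closure :: "('x \<Rightarrow> 'x) set \<Rightarrow> ('x \<Rightarrow> 'x) set" where
  "op_closure D = {T \<in> ops. \<forall>r>0. \<exists>U\<in>D. \<forall>x\<in>X. hn (U x - T x) \<le> r * hn x}"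

lemma op_closureE:
  assumes "T \<in> op_closure D" "r > 0"
  obtains U where "U \<in> D" "\<And>x. x \<in> X \<Longrightarrow> hn (U x - T x) \<le> r * hn x"
  using assms unfolding op_closure_def by blast

lemma subset_op_closure: "D \<subseteq> ops \<Longrightarrow> D \<subseteq> op_closure D"
proof
  fix T assume "D \<subseteq> ops" "T \<in> D"
  moreover have "hn (T x - T x) \<le> r * hn x" if "r > 0" for x r using that by simp
  ultimately show "T \<in> op_closure D" unfolding op_closure_def by blast
qed

lemma cstar_subalg_op_closure:
  assumes D: "D \<subseteq> ops" and add: "\<And>T S. T \<in> D \<Longrightarrow> S \<in> D \<Longrightarrow> op_add X T S \<in> D"
    and comp: "\<And>T S. T \<in> D \<Longrightarrow> S \<in> D \<Longrightarrow> op_comp X T S \<in> D"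
    and smul: "\<And>T c. T \<in> D \<Longrightarrow> op_smul X rm c T \<in> D"
    and adj: "\<And>T. T \<in> D \<Longrightarrow> \<exists>T'\<in>D. adj_pair T T'"
  shows "cstar_subalg X rm ip (op_closure D)"
proof -
  have opsI: "T \<in> op_closure D \<Longrightarrow> T \<in> ops" for T by (simp add: op_closure_def)
  have L: "x \<in> X \<Longrightarrow> T x \<in> X" if "T \<in> ops" for T x using adjointable_linear(1)[OF opsD(1)[OF that]] .
  have c_add: "op_add X T S \<in> op_closure D" if TS: "T \<in> op_closure D" "S \<in> op_closure D" for T S
    unfolding op_closure_def
  proof (intro CollectI conjI allI impI ops_closed(1) opsI TS)
    fix r :: real assume "r > 0"
    then have r: "r/2 > 0" by simp
    obtain U where U: "U \<in> D" "\<And>x. x \<in> X \<Longrightarrow> hn (U x - T x) \<le> r/2 * hn x" using op_closureE[OF TS(1) r] by metis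
    obtain V where V: "V \<in> D" "\<And>x. x \<in> X \<Longrightarrow> hn (V x - S x) \<le> r/2 * hn x" using op_closureE[OF TS(2) r] by metis
    have "hn (op_add X U V x - op_add X T S x) \<le> r * hn x" if x: "x \<in> X" for x
    proof -
      have mem: "U x \<in> X" "V x \<in> X" "T x \<in> X" "S x \<in> X" using x U V D TS opsI L by blast+
      have "op_add X U V x - op_add X T S x = (U x - T x) + (V x - S x)" using x by simp
      also have "hn \<dots> \<le> hn (U x - T x) + hn (V x - S x)" using mem by (intro hn_triangle) auto
      finally show ?thesis using U(2)[OF x] V(2)[OF x] by simp
    qed
    then show "\<exists>W\<in>D. \<forall>x\<in>X. hn (W x - op_add X T S x) \<le> r * hn x" using add[OF U(1) V(1)] by blast
  qed
  have c_comp: "op_comp X T S \<in> op_closure D" if TS: "T \<in> op_closure D" "S \<in> op_closure D" for T S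
    unfolding op_closure_def
  proof (intro CollectI conjI allI impI ops_closed(3) opsI TS)
    fix r :: real assume r: "r > 0"
    obtain K where K: "K \<ge> 0" "\<And>x. x \<in> X \<Longrightarrow> hn (T x) \<le> K * hn x"
      using adjointable_bounded[OF opsD(1)[OF opsI[OF TS(1)]]] by metis
    have "r / (2 * (K + 1)) > 0" using r K by simp
    then obtain V where V: "V \<in> D" "\<And>x. x \<in> X \<Longrightarrow> hn (V x - S x) \<le> r / (2 * (K + 1)) * hn x"
      using op_closureE[OF TS(2)] by metis
    \<comment> \<open>The order of choices matters: the tolerance for \<open>U\<close> depends on a
      bound of the approximant \<open>V\<close>, so \<open>V\<close> is fixed first, using a bound
      of \<open>T\<close>.\<close>
    obtain M where M: "M \<ge> 0" "\<And>x. x \<in> X \<Longrightarrow> hn (V x) \<le> M * hn x"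
      using adjointable_bounded[OF opsD(1)[OF subsetD[OF D V(1)]]] by metis
    have "r / (2 * (M + 1)) > 0" using r M by simp
    then obtain U where U: "U \<in> D" "\<And>x. x \<in> X \<Longrightarrow> hn (U x - T x) \<le> r / (2 * (M + 1)) * hn x"
      using op_closureE[OF TS(1)] by metis
    have "hn (op_comp X U V x - op_comp X T S x) \<le> r * hn x" if x: "x \<in> X" for x
    proof -
      have Vx: "V x \<in> X" and Sx: "S x \<in> X" using x V D TS opsI L by blast+
      then have mem: "U (V x) \<in> X" "T (V x) \<in> X" "T (S x) \<in> X" using U D TS opsI L by blast+
      have "hn (op_comp X U V x - op_comp X T S x) \<le> hn (U (V x) - T (V x)) + hn (T (V x) - T (S x))"
        using x mem by (simp add: hn_diff_triangle)
      also have "T (V x) - T (S x) = T (V x - S x)"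
        using adjointable_linear(5)[OF opsD(1)[OF opsI[OF TS(1)]]] Vx Sx by simp
      also have "hn (U (V x) - T (V x)) + hn (T (V x - S x)) \<le> r / (2 * (M + 1)) * (M * hn x) + K * (r / (2 * (K + 1)) * hn x)"
      proof (rule add_mono)
        have "hn (U (V x) - T (V x)) \<le> r / (2 * (M + 1)) * hn (V x)" by (rule U(2)[OF Vx])
        also have "\<dots> \<le> r / (2 * (M + 1)) * (M * hn x)" using M r x by (intro mult_left_mono) auto
        finally show "hn (U (V x) - T (V x)) \<le> r / (2 * (M + 1)) * (M * hn x)" .
        have "hn (T (V x - S x)) \<le> K * hn (V x - S x)" using Vx Sx by (intro K(2)) simp
        also have "\<dots> \<le> K * (r / (2 * (K + 1)) * hn x)" using K V(2)[OF x] by (intro mult_left_mono)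
        finally show "hn (T (V x - S x)) \<le> K * (r / (2 * (K + 1)) * hn x)" .
      qed
      also have "\<dots> = (r/2 * (M / (M + 1)) + r/2 * (K / (K + 1))) * hn x" by (simp add: field_simps)
      also have "\<dots> \<le> (r/2 * 1 + r/2 * 1) * hn x"
        using M K r by (intro mult_right_mono add_mono mult_left_mono) auto
      finally show ?thesis by simp
    qed
    then show "\<exists>W\<in>D. \<forall>x\<in>X. hn (W x - op_comp X T S x) \<le> r * hn x" using comp[OF U(1) V(1)] by blast
  qed
  have c_smul: "op_smul X rm c T \<in> op_closure D" if T: "T \<in> op_closure D" for T c
    unfolding op_closure_def
  proof (intro CollectI conjI allI impI ops_closed(4)[OF opsI[OF T] opsI[OF T]])
    fix r :: real assume r: "r > 0"
    define k where "k = norm (cscale c (1::'a)) + 1"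
    have k: "k > 0" by (simp add: k_def add_nonneg_pos)
    then have "r / k > 0" using r by simp
    then obtain U where U: "U \<in> D" "\<And>x. x \<in> X \<Longrightarrow> hn (U x - T x) \<le> r / k * hn x" using op_closureE[OF T] by metis
    have "hn (op_smul X rm c U x - op_smul X rm c T x) \<le> r * hn x" if x: "x \<in> X" for x
    proof -
      have mem: "U x \<in> X" "T x \<in> X" using x U D T opsI L by blast+
      have "hn (op_smul X rm c U x - op_smul X rm c T x) = hn (rm (U x - T x) (cscale c 1))"
        using x mem by (simp add: rm_diff_left)
      also have "\<dots> \<le> hn (U x - T x) * norm (cscale c (1::'a))" using mem by (intro hn_rm_le) simp
      also have "\<dots> \<le> (r / k * hn x) * k" using U(2)[OF x] by (intro mult_mono) (auto simp: k_def r less_imp_le add_nonneg_pos)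
      finally show ?thesis using k by simp
    qed
    then show "\<exists>W\<in>D. \<forall>x\<in>X. hn (W x - op_smul X rm c T x) \<le> r * hn x" using smul[OF U(1)] by blast
  qed
  have c_adj: "\<exists>T'\<in>op_closure D. \<forall>x\<in>X. \<forall>y\<in>X. ip (T x) y = ip x (T' y)" if T: "T \<in> op_closure D" for T
  proof -
    obtain T' where T': "T' \<in> ops" "adj_pair T T'" using ops_adjoint[OF opsI[OF T]] .
    have "T' \<in> op_closure D" unfolding op_closure_def
    proof (intro CollectI conjI allI impI T')
      fix r :: real assume r: "r > 0"
      obtain U where U: "U \<in> D" "\<And>x. x \<in> X \<Longrightarrow> hn (U x - T x) \<le> r * hn x" using op_closureE[OF T r] by metis
      obtain U' where U': "U' \<in> D" "adj_pair U U'" using adj[OF U(1)] by blast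
      have "hn (U' x - T' x) \<le> r * hn x" if "x \<in> X" for x
        using adj_pair_bound[OF adj_pair_ops(2)[OF U'(2) T'(2)], of r x] U(2) that by simp
      then show "\<exists>W\<in>D. \<forall>x\<in>X. hn (W x - T' x) \<le> r * hn x" using U'(1) by blast
    qed
    then show ?thesis using T'(2) unfolding adj_pair_def by blast
  qed
  have c_lim: "T \<in> op_closure D"
    if u: "\<And>n. u n \<in> op_closure D" and T: "T \<in> ops" and lim: "(\<lambda>n. nrm (op_diff X (u n) T)) \<longlonglongrightarrow> 0" for T u
    unfolding op_closure_def
  proof (intro CollectI conjI allI impI T)
    fix r :: real assume "r > 0"
    then have r: "r/2 > 0" by simp
    obtain n where n: "nrm (op_diff X (u n) T) < r/2"
      using order_tendstoD(2)[OF lim r] unfolding eventually_sequentially by blast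
    have diff: "op_diff X (u n) T \<in> ops" by (rule ops_closed[OF opsI[OF u] T])
    obtain U where U: "U \<in> D" "\<And>x. x \<in> X \<Longrightarrow> hn (U x - u n x) \<le> r/2 * hn x" using op_closureE[OF u r] by metis
    have "hn (U x - T x) \<le> r * hn x" if x: "x \<in> X" for x
    proof -
      have mem: "U x \<in> X" "u n x \<in> X" "T x \<in> X" using x U D u T opsI L by blast+
      have "hn (u n x - T x) \<le> nrm (op_diff X (u n) T) * hn x"
        using opnorm_bound[OF opsD(1)[OF diff] x] x by simp
      also have "\<dots> \<le> r/2 * hn x" using n by (intro mult_right_mono) auto
      finally show ?thesis using hn_diff_triangle[OF mem] U(2)[OF x] by linarith
    qed
    then show "\<exists>W\<in>D. \<forall>x\<in>X. hn (W x - T x) \<le> r * hn x" using U(1) by blast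
  qed
  show ?thesis unfolding cstar_subalg_def
  proof (intro conjI)
    show "op_closure D \<subseteq> {T. adjointable X ip T \<and> restr X T = T}" using opsI opsD by blast
    show "\<forall>T\<in>op_closure D. \<forall>T'\<in>op_closure D. op_add X T T' \<in> op_closure D \<and> op_comp X T T' \<in> op_closure D"
      using c_add c_comp by blast
    show "\<forall>T\<in>op_closure D. \<forall>c. op_smul X rm c T \<in> op_closure D" using c_smul by blast
    show "\<forall>T\<in>op_closure D. \<exists>T'\<in>op_closure D. \<forall>x\<in>X. \<forall>y\<in>X. ip (T x) y = ip x (T' y)"
      by (rule ballI) (rule c_adj)
    show "\<forall>T u. (\<forall>n. u n \<in> op_closure D) \<and> adjointable X ip T \<and> restr X T = T \<and>
        (\<lambda>n. nrm (op_diff X (u n) T)) \<longlonglongrightarrow> 0 \<longrightarrow> T \<in> op_closure D"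
    proof (intro allI impI, elim conjE)
      fix T :: "'x \<Rightarrow> 'x" and u
      assume "\<forall>n. u n \<in> op_closure D" "adjointable X ip T" "restr X T = T"
        "(\<lambda>n. nrm (op_diff X (u n) T)) \<longlonglongrightarrow> 0"
      then show "T \<in> op_closure D" by - (rule c_lim[of u], simp_all add: ops_def)
    qed
  qed
qed

text \<open>An intersection of C*-subalgebras inherits every clause; only the existential adjoint
  clause needs an argument.\<close>

lemma cstar_subalg_generated:
  assumes "Gen \<subseteq> ops"
  shows "cstar_subalg X rm ip (generated_cstar X rm ip Gen)" "Gen \<subseteq> generated_cstar X rm ip Gen"
    "\<And>S. cstar_subalg X rm ip S \<Longrightarrow> Gen \<subseteq> S \<Longrightarrow> generated_cstar X rm ip Gen \<subseteq> S"
proof -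
  let ?G = "generated_cstar X rm ip Gen"
  show sub: "\<And>S. cstar_subalg X rm ip S \<Longrightarrow> Gen \<subseteq> S \<Longrightarrow> ?G \<subseteq> S" unfolding generated_cstar_def by blast
  show "Gen \<subseteq> ?G" unfolding generated_cstar_def by blast
  have ops: "T \<in> ops" if "T \<in> ?G" for T using sub[OF cstar_subalg_ops assms] that by blast
  have mem: "T \<in> S" if "T \<in> ?G" "cstar_subalg X rm ip S" "Gen \<subseteq> S" for T S using sub[OF that(2,3)] that(1) by blast
  have memI: "T \<in> ?G" if "\<And>S. cstar_subalg X rm ip S \<Longrightarrow> Gen \<subseteq> S \<Longrightarrow> T \<in> S" for T
    using that unfolding generated_cstar_def by blast
  have alg: "op_add X T T' \<in> ?G" "op_comp X T T' \<in> ?G" "op_smul X rm c T \<in> ?G" if T: "T \<in> ?G" "T' \<in> ?G" for T T' c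
  proof -
    show "op_add X T T' \<in> ?G"
      by (rule memI) (rule cstar_subalgD(2)[OF _ mem[OF T(1)] mem[OF T(2)]])
    show "op_comp X T T' \<in> ?G"
      by (rule memI) (rule cstar_subalgD(3)[OF _ mem[OF T(1)] mem[OF T(2)]])
    show "op_smul X rm c T \<in> ?G"
      by (rule memI) (rule cstar_subalgD(4)[OF _ mem[OF T(1)]])
  qed
  show "cstar_subalg X rm ip ?G" unfolding cstar_subalg_def
  proof (intro conjI)
    show "?G \<subseteq> {T. adjointable X ip T \<and> restr X T = T}" using ops opsD by blast
    show "\<forall>T\<in>?G. \<forall>T'\<in>?G. op_add X T T' \<in> ?G \<and> op_comp X T T' \<in> ?G"
      using alg(1,2) by blast
    show "\<forall>T\<in>?G. \<forall>c. op_smul X rm c T \<in> ?G" using alg(3) by blast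
    show "\<forall>T\<in>?G. \<exists>T'\<in>?G. \<forall>x\<in>X. \<forall>y\<in>X. ip (T x) y = ip x (T' y)"
    proof
      fix T assume T: "T \<in> ?G"
      \<comment> \<open>Each subalgebra provides some adjoint of \<open>T\<close>. By uniqueness
        they all equal \<open>op_adj X ip T\<close>, which therefore lies in the
        intersection.\<close>
      have "op_adj X ip T \<in> ?G"
      proof (rule memI)
        fix S assume S: "cstar_subalg X rm ip S" "Gen \<subseteq> S"
        then obtain T' where T': "T' \<in> S" "adj_pair T T'" using cstar_subalgD(5)[OF S(1)] mem[OF T] by blast
        then show "op_adj X ip T \<in> S" using op_adj_eqI[OF cstar_subalgD(1)[OF S(1) T'(1)] T'(2) ops[OF T]] by simp
      qed
      then show "\<exists>T'\<in>?G. \<forall>x\<in>X. \<forall>y\<in>X. ip (T x) y = ip x (T' y)"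
        using op_adj_props(2)[OF ops[OF T]] unfolding adj_pair_def by blast
    qed
    show "\<forall>T u. (\<forall>n. u n \<in> ?G) \<and> adjointable X ip T \<and> restr X T = T \<and>
        (\<lambda>n. nrm (op_diff X (u n) T)) \<longlonglongrightarrow> 0 \<longrightarrow> T \<in> ?G"
    proof (intro allI impI, elim conjE)
      fix T :: "'x \<Rightarrow> 'x" and u
      assume T: "\<forall>n. u n \<in> ?G" "adjointable X ip T" "restr X T = T"
        "(\<lambda>n. nrm (op_diff X (u n) T)) \<longlonglongrightarrow> 0"
      show "T \<in> ?G"
      proof (rule memI)
        fix S assume S: "cstar_subalg X rm ip S" "Gen \<subseteq> S"
        have "u n \<in> S" for n using T(1) mem[OF _ S] by blast
        then show "T \<in> S" by (rule cstar_subalgD(6)[OF S(1)]) (use T in \<open>auto simp: ops_def\<close>)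
      qed
    qed
  qed
qed

end

section \<open>Automorphisms and twisted systems\<close>

lemma is_autD:
  assumes "is_aut f"
  shows "bij f" "f (a + b) = f a + f b" "f (a * b) = f a * f b" "f (invol a) = invol (f a)"
    "f (cscale c a) = cscale c (f a)" "f 0 = 0" "f 1 = 1" "f (r *\<^sub>R a) = r *\<^sub>R f a" "f (a - b) = f a - f b"
proof -
  show bij: "bij f" and add: "f (a + b) = f a + f b" and mult: "f (a * b) = f a * f b"
    and "f (invol a) = invol (f a)" and cs: "f (cscale c a) = cscale c (f a)" for a b c
    using assms unfolding is_aut_def by blast+
  show "f 0 = 0" using add[of 0 0] by simp
  obtain u where "f u = 1" using bij by (metis bij_pointE)
  then show "f 1 = 1" using mult[of 1 u] by simp
  show "f (r *\<^sub>R a) = r *\<^sub>R f a" for r a using cs[of "complex_of_real r" a] by (simp add: cscale_def)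
  show "f (a - b) = f a - f b" using add[of "a - b" b] by (simp add: eq_diff_eq)
qed

lemma is_aut_inv: "is_aut f \<Longrightarrow> is_aut (inv f)"
proof -
  assume f: "is_aut f"
  note D = is_autD[OF f]
  have l: "inv f (f a) = a" and r: "f (inv f a) = a" for a
    using D(1) by (simp_all add: bij_is_inj bij_is_surj surj_f_inv_f)
  have *: "inv f b = a" if "f a = b" for a b using l that by blast
  show ?thesis unfolding is_aut_def
    using bij_imp_bij_inv[OF D(1)] by (auto intro!: * simp: D r)
qed

text \<open>Continuity is not part of \<open>is_aut\<close>. The positive element (norm a)^2 minus
  \<open>invol a * a\<close> has positive image, so \<open>f\<close> is contractive, and so is its
  inverse.\<close>

lemma is_aut_norm: "is_aut f \<Longrightarrow> norm (f a) = norm a"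
proof -
  have le: "norm (f a) \<le> norm a" if "is_aut f" for f :: "'a \<Rightarrow> 'a" and a
  proof -
    note D = is_autD[OF that]
    have "cpos ((norm a)\<^sup>2 *\<^sub>R 1 - invol a * a)"
      by (rule cpos_norm_diff) (auto simp: invol_mult invol_invol cstar_identity)
    then obtain d where "(norm a)\<^sup>2 *\<^sub>R 1 - invol a * a = invol d * d" by (auto simp: cpos_def)
    then have "f ((norm a)\<^sup>2 *\<^sub>R 1 - invol a * a) = invol (f d) * f d" by (simp add: D)
    then have "cpos ((norm a)\<^sup>2 *\<^sub>R 1 - invol (f a) * f a)" by (simp add: D)
    then have "norm (invol (f a) * f a) \<le> norm ((norm a)\<^sup>2 *\<^sub>R (1::'a))" by (intro cpos_norm_mono) auto
    then have "(norm (f a))\<^sup>2 \<le> (norm a)\<^sup>2" by (simp add: cstar_identity)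
    then show ?thesis by (rule power2_le_imp_le) simp
  qed
  assume f: "is_aut f"
  have "inv f (f a) = a" using is_autD(1)[OF f] by (simp add: bij_is_inj)
  then show ?thesis using le[OF f, of a] le[OF is_aut_inv[OF f], of "f a"] by simp
qed

locale tsys =
  fixes \<alpha> :: "'g::group_add \<Rightarrow> 'a::cstar \<Rightarrow> 'a" and \<sigma> :: "'g \<Rightarrow> 'g \<Rightarrow> 'a"
  assumes tsys: "twisted_system \<alpha> \<sigma>"
begin

abbreviation "\<beta> g \<equiv> inv (\<alpha> g)"

lemma aut: "is_aut (\<alpha> g)" and aut_inv: "is_aut (\<beta> g)"
  using tsys is_aut_inv unfolding twisted_system_def by blast+

lemmas alpha = is_autD[OF aut] and beta = is_autD[OF aut_inv]

lemma beta_alpha [simp]: "\<beta> g (\<alpha> g a) = a" and alpha_beta [simp]: "\<alpha> g (\<beta> g a) = a"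
  using alpha(1)[of g] by (simp_all add: bij_is_inj bij_is_surj surj_f_inv_f)

lemma sigma_unitary: "invol (\<sigma> g h) * \<sigma> g h = 1" "\<sigma> g h * invol (\<sigma> g h) = 1"
  using tsys unfolding twisted_system_def unitary_def by blast+

lemma alpha_alpha: "\<alpha> g (\<alpha> h a) = \<sigma> g h * \<alpha> (g + h) a * invol (\<sigma> g h)"
  and cocycle: "\<sigma> g h * \<sigma> (g + h) k = \<alpha> g (\<sigma> h k) * \<sigma> g (h + k)"
  and sigma_zero: "\<sigma> g 0 = 1" "\<sigma> 0 g = 1"
  using tsys unfolding twisted_system_def by blast+

text \<open>The relation between \<alpha>(g) \<alpha>(k) and \<alpha>(g + k), solved for the
  inverses. It cancels the twist in the terms of \<open>as_ip\<close> and so makes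
  \<open>lam \<alpha> \<sigma> g\<close> isometric.\<close>

lemma beta_conj_sigma: "\<beta> (g + k) (invol (\<sigma> g k) * \<alpha> g c * \<sigma> g k) = \<beta> k c"
proof -
  have "invol (\<sigma> g k) * \<alpha> g c * \<sigma> g k = invol (\<sigma> g k) * (\<sigma> g k * \<alpha> (g + k) (\<beta> k c) * invol (\<sigma> g k)) * \<sigma> g k"
    using alpha_alpha[of g k "\<beta> k c"] by simp
  also have "\<dots> = (invol (\<sigma> g k) * \<sigma> g k) * \<alpha> (g + k) (\<beta> k c) * (invol (\<sigma> g k) * \<sigma> g k)"
    by (simp only: mult.assoc)
  finally show ?thesis by (simp add: sigma_unitary)
qed

text \<open>The transport map removes the automorphisms: \<open>as_ip\<close> becomes
  \<open>l2_ip\<close>, and \<open>delta\<close> is unchanged because automorphisms fix 0 and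
  1.\<close>

sublocale hbasis "ASig \<alpha>" "as_rm \<alpha>" "as_ip \<alpha>" delta UNIV
proof (rule hbasis_transfer[OF hbasis_l2, where \<phi> = "\<lambda>\<xi> g. \<beta> g (\<xi> g)"])
  show "inj (\<lambda>\<xi> g. \<beta> g (\<xi> g))" by (rule injI) (metis alpha_beta ext)
  show "surj (\<lambda>\<xi> g. \<beta> g (\<xi> g))" by (rule surjI[of _ "\<lambda>\<eta> g. \<alpha> g (\<eta> g)"]) simp
qed (auto simp: beta ASig_def l2_def as_rm_def l2_rm_def as_ip_def l2_ip_def delta_def fun_eq_iff)

lemma ASig_iff: "\<xi> \<in> ASig \<alpha> \<longleftrightarrow> (\<lambda>g. \<beta> g (\<xi> g)) \<in> l2"
  by (simp add: ASig_def l2_def beta)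

lemma as_ip_delta_left: "as_ip \<alpha> (delta h) \<xi> = \<beta> h (\<xi> h)"
proof -
  have "as_ip \<alpha> (delta h) \<xi> = l2_ip (delta h) (\<lambda>g. \<beta> g (\<xi> g))"
    unfolding as_ip_def l2_ip_def by (intro infsum_cong) (simp add: beta delta_def)
  then show ?thesis by (simp add: l2_ip_delta_left)
qed

lemma leftop_apply: "\<xi> \<in> ASig \<alpha> \<Longrightarrow> leftop \<alpha> a \<xi> h = a * \<xi> h"
  by (simp add: leftop_def)

text \<open>After transport to \<open>l2\<close>, \<open>a\<close> multiplies the component at i by
  \<open>\<beta> i a\<close>, which has the same norm as \<open>a\<close>; hence the domination is
  uniform in i.\<close>

lemma leftop_mem: "\<xi> \<in> ASig \<alpha> \<Longrightarrow> leftop \<alpha> a \<xi> \<in> ASig \<alpha>"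
proof -
  assume \<xi>: "\<xi> \<in> ASig \<alpha>"
  show ?thesis unfolding ASig_iff
  proof (rule l2_dominated[OF \<xi>[unfolded ASig_iff], of "(norm a)\<^sup>2"])
    fix i
    have "cpos ((norm a)\<^sup>2 *\<^sub>R (invol (\<beta> i (\<xi> i)) * \<beta> i (\<xi> i)) - invol (\<beta> i (\<xi> i)) * (invol (\<beta> i a) * \<beta> i a) * \<beta> i (\<xi> i))"
      by (rule cpos_norm_conj_diff) (auto simp: cstar_identity is_aut_norm[OF aut_inv])
    then show "cpos ((norm a)\<^sup>2 *\<^sub>R (invol (\<beta> i (\<xi> i)) * \<beta> i (\<xi> i)) - invol (\<beta> i (leftop \<alpha> a \<xi> i)) * \<beta> i (leftop \<alpha> a \<xi> i))"
      using \<xi> by (simp add: leftop_apply beta invol_mult mult.assoc)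
  qed simp
qed

lemma adj_pair_leftop: "adj_pair (leftop \<alpha> a) (leftop \<alpha> (invol a))"
  unfolding adj_pair_def
  by (auto simp: leftop_mem as_ip_def leftop_apply invol_mult mult.assoc)

lemma leftop_ops: "leftop \<alpha> a \<in> ops"
  unfolding ops_def adjointable_iff using adj_pair_leftop by (auto simp: leftop_def)

text \<open>Obtained by solving \<eta>(g + k) = \<alpha> g (\<xi> k) * \<sigma> g k for \<xi> k, so
  it is the inverse of \<open>lam \<alpha> \<sigma> g\<close> and thereby the candidate for its
  adjoint.\<close>

definition lam_adj :: "'g \<Rightarrow> ('g \<Rightarrow> 'a) \<Rightarrow> 'g \<Rightarrow> 'a" where
  "lam_adj g \<eta> = (\<lambda>k. \<beta> g (\<eta> (g + k) * invol (\<sigma> g k)))"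

lemma lam_apply: "\<xi> \<in> ASig \<alpha> \<Longrightarrow> lam \<alpha> \<sigma> g \<xi> (g + k) = \<alpha> g (\<xi> k) * \<sigma> g k"
  by (simp add: lam_def flip: add.assoc)

lemma bij_plus: "bij ((+) (g::'g))"
  by (rule bijI') (auto intro: exI[of _ "- g + _"] simp flip: add.assoc)

text \<open>A termwise identity under the reindexing h = g + k. Summation gives the adjoint
  relation, and taking for \<eta> the image of \<xi> gives membership in the module.\<close>

lemma lam_ip_term:
  assumes "\<xi> \<in> ASig \<alpha>"
  shows "\<beta> (g + k) (invol (lam \<alpha> \<sigma> g \<xi> (g + k)) * \<eta> (g + k)) = \<beta> k (invol (\<xi> k) * lam_adj g \<eta> k)"
proof -
  have "invol (lam \<alpha> \<sigma> g \<xi> (g + k)) * \<eta> (g + k) = invol (\<sigma> g k) * \<alpha> g (invol (\<xi> k) * lam_adj g \<eta> k) * \<sigma> g k"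
    by (simp add: lam_apply[OF assms] lam_adj_def alpha invol_mult mult.assoc sigma_unitary)
  then show ?thesis by (simp only: beta_conj_sigma)
qed

lemma lam_mem: "\<xi> \<in> ASig \<alpha> \<Longrightarrow> lam \<alpha> \<sigma> g \<xi> \<in> ASig \<alpha>"
proof -
  assume \<xi>: "\<xi> \<in> ASig \<alpha>"
  have "lam_adj g (lam \<alpha> \<sigma> g \<xi>) k = \<xi> k" for k
    by (simp add: lam_adj_def lam_apply[OF \<xi>] mult.assoc sigma_unitary)
  then have "\<beta> (g + k) (invol (lam \<alpha> \<sigma> g \<xi> (g + k)) * lam \<alpha> \<sigma> g \<xi> (g + k)) = \<beta> k (invol (\<xi> k) * \<xi> k)" for k
    by (simp add: lam_ip_term[OF \<xi>])
  then have "(\<lambda>k. \<beta> (g + k) (invol (lam \<alpha> \<sigma> g \<xi> (g + k)) * lam \<alpha> \<sigma> g \<xi> (g + k))) summable_on UNIV"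
    using \<xi> by (simp add: ASig_def)
  then show ?thesis unfolding ASig_def mem_Collect_eq
    by (subst (asm) summable_on_reindex_bij_betw[OF bij_plus, of "\<lambda>h. \<beta> h (invol (lam \<alpha> \<sigma> g \<xi> h) * lam \<alpha> \<sigma> g \<xi> h)"])
qed

lemma lam_adj_mem: "\<eta> \<in> ASig \<alpha> \<Longrightarrow> lam_adj g \<eta> \<in> ASig \<alpha>"
proof -
  assume \<eta>: "\<eta> \<in> ASig \<alpha>"
  have "\<beta> k (invol (lam_adj g \<eta> k) * lam_adj g \<eta> k) = \<beta> (g + k) (invol (\<eta> (g + k)) * \<eta> (g + k))" for k
  proof -
    have "invol (\<sigma> g k) * \<alpha> g (invol (lam_adj g \<eta> k) * lam_adj g \<eta> k) * \<sigma> g k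
        = (invol (\<sigma> g k) * \<sigma> g k) * (invol (\<eta> (g + k)) * \<eta> (g + k)) * (invol (\<sigma> g k) * \<sigma> g k)"
      by (simp add: lam_adj_def alpha beta invol_mult invol_invol mult.assoc)
    then show ?thesis using beta_conj_sigma[of g k "invol (lam_adj g \<eta> k) * lam_adj g \<eta> k"]
      by (simp add: sigma_unitary)
  qed
  moreover have "(\<lambda>k. \<beta> (g + k) (invol (\<eta> (g + k)) * \<eta> (g + k))) summable_on UNIV"
    using \<eta> unfolding ASig_def mem_Collect_eq
    by (subst summable_on_reindex_bij_betw[OF bij_plus, of "\<lambda>h. \<beta> h (invol (\<eta> h) * \<eta> h)"])
  ultimately show ?thesis by (simp add: ASig_def)
qed

lemma adj_pair_lam: "adj_pair (lam \<alpha> \<sigma> g) (lam_adj g)"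
  unfolding adj_pair_def
proof (intro conjI ballI lam_mem lam_adj_mem)
  fix \<xi> \<eta> assume \<xi>: "\<xi> \<in> ASig \<alpha>"
  have "as_ip \<alpha> (lam \<alpha> \<sigma> g \<xi>) \<eta> = infsum (\<lambda>k. \<beta> (g + k) (invol (lam \<alpha> \<sigma> g \<xi> (g + k)) * \<eta> (g + k))) UNIV"
    unfolding as_ip_def
    by (rule infsum_reindex_bij_betw[OF bij_plus, of "\<lambda>h. \<beta> h (invol (lam \<alpha> \<sigma> g \<xi> h) * \<eta> h)", symmetric])
  then show "as_ip \<alpha> (lam \<alpha> \<sigma> g \<xi>) \<eta> = as_ip \<alpha> \<xi> (lam_adj g \<eta>)"
    unfolding as_ip_def by (simp add: lam_ip_term[OF \<xi>])
qed

lemma lam_ops: "lam \<alpha> \<sigma> g \<in> ops"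
  unfolding ops_def adjointable_iff using adj_pair_lam by (auto simp: lam_def)

text \<open>This form brings the adjoint back into the linear span of the products a \<lambda>(g),
  which is needed for that span to be closed under adjoints.\<close>

lemma lam_adj_eq: "\<eta> \<in> ASig \<alpha> \<Longrightarrow> lam_adj g \<eta> = leftop \<alpha> (invol (\<sigma> (- g) g)) (lam \<alpha> \<sigma> (- g) \<eta>)"
proof
  fix k assume \<eta>: "\<eta> \<in> ASig \<alpha>"
  \<comment> \<open>The inverse of \<open>\<alpha> g\<close> differs from
    \<open>\<alpha> (- g)\<close> by conjugation with \<open>\<sigma> (- g) g\<close>.\<close>
  have "\<alpha> (- g) (\<alpha> g c) = \<sigma> (- g) g * \<alpha> 0 c * invol (\<sigma> (- g) g)" for c
    using alpha_alpha[of "- g" g c] by simp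
  moreover have alpha0: "\<alpha> 0 c = c" for c
    using alpha_alpha[of 0 0 "\<beta> 0 c"] by (simp add: sigma_zero)
  ultimately have beta_eq: "invol (\<sigma> (- g) g) * \<alpha> (- g) b * \<sigma> (- g) g = \<beta> g b" for b
  proof -
    have "\<alpha> (- g) b = \<sigma> (- g) g * \<beta> g b * invol (\<sigma> (- g) g)"
      using \<open>\<And>c. \<alpha> (- g) (\<alpha> g c) = \<sigma> (- g) g * \<alpha> 0 c * invol (\<sigma> (- g) g)\<close>[of "\<beta> g b"] by (simp add: alpha0)
    then have "invol (\<sigma> (- g) g) * \<alpha> (- g) b * \<sigma> (- g) g
        = (invol (\<sigma> (- g) g) * \<sigma> (- g) g) * \<beta> g b * (invol (\<sigma> (- g) g) * \<sigma> (- g) g)" by (simp only: mult.assoc)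
    then show ?thesis by (simp add: sigma_unitary)
  qed
  \<comment> \<open>The cocycle identity at -g, g, k; the factor \<open>\<sigma> 0 k\<close> is
    1.\<close>
  have "\<sigma> (- g) g = \<alpha> (- g) (\<sigma> g k) * \<sigma> (- g) (g + k)" using cocycle[of "- g" g k] by (simp add: sigma_zero)
  then have "\<alpha> (- g) (invol (\<sigma> g k)) * \<sigma> (- g) g = \<alpha> (- g) (invol (\<sigma> g k) * \<sigma> g k) * \<sigma> (- g) (g + k)"
    by (simp add: alpha mult.assoc)
  then have *: "\<alpha> (- g) (invol (\<sigma> g k)) * \<sigma> (- g) g = \<sigma> (- g) (g + k)" by (simp add: sigma_unitary alpha)
  have "lam_adj g \<eta> k = invol (\<sigma> (- g) g) * \<alpha> (- g) (\<eta> (g + k) * invol (\<sigma> g k)) * \<sigma> (- g) g"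
    unfolding lam_adj_def beta_eq ..
  also have "\<dots> = invol (\<sigma> (- g) g) * (\<alpha> (- g) (\<eta> (g + k)) * (\<alpha> (- g) (invol (\<sigma> g k)) * \<sigma> (- g) g))"
    by (simp only: alpha(3) mult.assoc)
  also have "\<dots> = leftop \<alpha> (invol (\<sigma> (- g) g)) (lam \<alpha> \<sigma> (- g) \<eta>) k"
    unfolding * using \<eta> lam_apply[OF \<eta>, of "- g" "g + k"]
    by (simp add: leftop_apply lam_mem flip: add.assoc)
  finally show "lam_adj g \<eta> k = leftop \<alpha> (invol (\<sigma> (- g) g)) (lam \<alpha> \<sigma> (- g) \<eta>) k" .
qed

text \<open>Covariance and the cocycle rule in one equation: \<lambda>(g) b \<lambda>(h) is again a
  coefficient times a single translation, so products a \<lambda>(g) multiply among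
  themselves.\<close>

lemma lam_leftop_lam:
  assumes \<xi>: "\<xi> \<in> ASig \<alpha>"
  shows "lam \<alpha> \<sigma> g (leftop \<alpha> b (lam \<alpha> \<sigma> h \<xi>)) = leftop \<alpha> (\<alpha> g b * \<sigma> g h) (lam \<alpha> \<sigma> (g + h) \<xi>)"
proof
  fix k
  \<comment> \<open>Chosen so that both translations act at an index of the form g + (h + m), where
    \<open>lam_apply\<close> computes them.\<close>
  define m where "m = - h + (- g + k)"
  have k: "k = g + (h + m)" by (simp add: m_def)
  have "lam \<alpha> \<sigma> g (leftop \<alpha> b (lam \<alpha> \<sigma> h \<xi>)) (g + (h + m)) = \<alpha> g (b * (\<alpha> h (\<xi> m) * \<sigma> h m)) * \<sigma> g (h + m)"
    using \<xi> by (simp add: lam_apply leftop_mem lam_mem leftop_apply)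
  also have "\<dots> = \<alpha> g b * (\<sigma> g h * \<alpha> (g + h) (\<xi> m) * invol (\<sigma> g h)) * (\<alpha> g (\<sigma> h m) * \<sigma> g (h + m))"
    by (simp add: alpha alpha_alpha mult.assoc)
  also have "\<dots> = \<alpha> g b * \<sigma> g h * \<alpha> (g + h) (\<xi> m) * (invol (\<sigma> g h) * \<sigma> g h) * \<sigma> (g + h) m"
    unfolding cocycle[symmetric] by (simp only: mult.assoc)
  also have "\<dots> = leftop \<alpha> (\<alpha> g b * \<sigma> g h) (lam \<alpha> \<sigma> (g + h) \<xi>) ((g + h) + m)"
    using \<xi> by (simp add: sigma_unitary lam_apply leftop_apply lam_mem mult.assoc)
  finally show "lam \<alpha> \<sigma> g (leftop \<alpha> b (lam \<alpha> \<sigma> h \<xi>)) k = leftop \<alpha> (\<alpha> g b * \<sigma> g h) (lam \<alpha> \<sigma> (g + h) \<xi>) k"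
    unfolding k by (simp only: add.assoc)
qed

end

context hmod begin

lemma adj_pair_sum:
  assumes "\<And>k. k \<in> F \<Longrightarrow> adj_pair (T k) (S k)"
  shows "adj_pair (restr X (\<lambda>x. \<Sum>k\<in>F. T k x)) (restr X (\<lambda>x. \<Sum>k\<in>F. S k x))"
  unfolding adj_pair_def
proof (intro conjI ballI)
  fix x y assume xy: "x \<in> X" "y \<in> X"
  have mem: "T k x \<in> X" "S k y \<in> X" if "k \<in> F" for k using adj_pairD[OF assms[OF that]] xy by auto
  then show "restr X (\<lambda>x. \<Sum>k\<in>F. T k x) x \<in> X" using xy by simp
  have "ip (\<Sum>k\<in>F. T k x) y = (\<Sum>k\<in>F. ip x (S k y))"
    using mem xy adj_pairD(3)[OF assms] by (subst ip_sum_left) auto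
  also have "\<dots> = ip x (\<Sum>k\<in>F. S k y)" using mem xy by (intro ip_sum_right[symmetric]) auto
  finally show "ip (restr X (\<lambda>x. \<Sum>k\<in>F. T k x) x) y = ip x (restr X (\<lambda>x. \<Sum>k\<in>F. S k x) y)" using xy by simp
next
  fix x assume x: "x \<in> X"
  have "S k x \<in> X" if "k \<in> F" for k using adj_pairD[OF assms[OF that]] x by auto
  then show "restr X (\<lambda>x. \<Sum>k\<in>F. S k x) x \<in> X" using x by simp
qed

lemma adj_pair_cong:
  "adj_pair T S \<Longrightarrow> (\<And>x. x \<in> X \<Longrightarrow> T x = T' x) \<Longrightarrow> (\<And>x. x \<in> X \<Longrightarrow> S x = S' x) \<Longrightarrow> adj_pair T' S'"
  by (simp add: adj_pair_def)

lemma matnorm_one: "matnorm X ip 1 (\<lambda>i j. T) = nrm T"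
proof -
  have "(\<lambda>\<xi>. msum_norm ip 1 (mat_apply 1 (\<lambda>i j. T) \<xi>)) ` {\<xi>. (\<forall>i<1. \<xi> i \<in> X) \<and> msum_norm ip 1 \<xi> \<le> 1}
      = (\<lambda>x. hn (T x)) ` {x \<in> X. hn x \<le> 1}" (is "?f ` ?A = ?g ` ?B")
  proof
    show "?f ` ?A \<subseteq> ?g ` ?B" by (auto simp: msum_norm_def mat_apply_def hnorm_def)
    show "?g ` ?B \<subseteq> ?f ` ?A"
    proof
      fix r assume "r \<in> ?g ` ?B"
      then obtain x where "x \<in> X" "hn x \<le> 1" "r = hn (T x)" by blast
      then show "r \<in> ?f ` ?A"
        by (intro image_eqI[of _ _ "\<lambda>_. x"]) (auto simp: msum_norm_def mat_apply_def hnorm_def)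
    qed
  qed
  then show ?thesis unfolding matnorm_def opnorm_def by (rule arg_cong)
qed

end

section \<open>Monomials a \<lambda>(g) and approximation in the reduced crossed product\<close>

context tsys begin

abbreviation "AS \<equiv> ASig \<alpha>"

abbreviation "CR \<equiv> Cr \<alpha> \<sigma>"

definition mon :: "'a \<Rightarrow> 'g \<Rightarrow> ('g \<Rightarrow> 'a) \<Rightarrow> 'g \<Rightarrow> 'a" where
  "mon a g = op_comp AS (leftop \<alpha> a) (lam \<alpha> \<sigma> g)"

lemma mon_apply: "\<xi> \<in> AS \<Longrightarrow> mon a g \<xi> = leftop \<alpha> a (lam \<alpha> \<sigma> g \<xi>)"
  by (simp add: mon_def)

lemma mon_ops: "mon a g \<in> ops"
  unfolding mon_def by (rule ops_closed[OF leftop_ops lam_ops])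

lemmas mon_linear = adjointable_linear[OF opsD(1)[OF mon_ops]]

lemma mon_add: "\<xi> \<in> AS \<Longrightarrow> mon (a + b) g \<xi> = mon a g \<xi> + mon b g \<xi>"
  by (auto simp: mon_apply leftop_apply lam_mem distrib_right)

lemma mon_zero: "\<xi> \<in> AS \<Longrightarrow> mon 0 g \<xi> = 0"
  by (auto simp: mon_apply leftop_apply lam_mem)

lemma leftop_leftop: "\<xi> \<in> AS \<Longrightarrow> leftop \<alpha> a (leftop \<alpha> b \<xi>) = leftop \<alpha> (a * b) \<xi>"
  by (auto simp: leftop_apply leftop_mem mult.assoc)

lemma mon_mon: "\<xi> \<in> AS \<Longrightarrow> mon a g (mon b h \<xi>) = mon (a * (\<alpha> g b * \<sigma> g h)) (g + h) \<xi>"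
  by (simp add: mon_apply leftop_mem lam_mem lam_leftop_lam leftop_leftop)

lemma alpha_zero: "\<alpha> 0 c = c"
  using alpha_alpha[of 0 0 "\<beta> 0 c"] by (simp add: sigma_zero)

lemma lam_zero: "\<xi> \<in> AS \<Longrightarrow> lam \<alpha> \<sigma> 0 \<xi> = \<xi>"
  by (auto simp: lam_def alpha_zero sigma_zero)

lemma leftop_one: "\<xi> \<in> AS \<Longrightarrow> leftop \<alpha> 1 \<xi> = \<xi>"
  by (auto simp: leftop_apply)

lemma adj_pair_mon: "adj_pair (mon a g) (mon (invol (\<sigma> (- g) g) * \<alpha> (- g) (invol a)) (- g))"
proof (rule adj_pair_cong)
  show "adj_pair (mon a g) (op_comp AS (lam_adj g) (leftop \<alpha> (invol a)))"
    unfolding mon_def by (rule adj_pair_ops[OF adj_pair_leftop adj_pair_lam])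
  fix \<xi> assume \<xi>: "\<xi> \<in> AS"
  have "lam \<alpha> \<sigma> (- g) (leftop \<alpha> (invol a) \<xi>) = leftop \<alpha> (\<alpha> (- g) (invol a)) (lam \<alpha> \<sigma> (- g) \<xi>)"
    using lam_leftop_lam[OF \<xi>, of "- g" "invol a" 0] \<xi> by (simp add: lam_zero sigma_zero)
  then show "op_comp AS (lam_adj g) (leftop \<alpha> (invol a)) \<xi> = mon (invol (\<sigma> (- g) g) * \<alpha> (- g) (invol a)) (- g) \<xi>"
    using \<xi> by (simp add: lam_adj_eq leftop_mem mon_apply leftop_leftop lam_mem)
qed simp

text \<open>Allowing any finite superset of the support lets several functions be summed over one
  common set.\<close>

lemma Lambda_eq_sum_mon:
  assumes G: "finite G" "{g. f g \<noteq> 0} \<subseteq> G"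
  shows "Lambda \<alpha> \<sigma> f = restr AS (\<lambda>\<xi>. \<Sum>g\<in>G. mon (f g) g \<xi>)"
proof (rule restr_eqI)
  fix \<xi> assume \<xi>: "\<xi> \<in> AS"
  have "(\<Sum>g\<in>{g. f g \<noteq> 0}. f g * lam \<alpha> \<sigma> g \<xi> h) = (\<Sum>g\<in>G. f g * lam \<alpha> \<sigma> g \<xi> h)" for h
    using G by (intro sum.mono_neutral_left) auto
  then show "Lambda \<alpha> \<sigma> f \<xi> = restr AS (\<lambda>\<xi>. \<Sum>g\<in>G. mon (f g) g \<xi>) \<xi>"
    using \<xi> by (simp add: fun_eq_iff Lambda_def sum_fun_apply mon_apply leftop_apply lam_mem)
qed (auto simp: Lambda_def)

text \<open>The image of the finitely supported functions, which serves as the dense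
  *-algebra.\<close>

definition Lam_set :: "(('g \<Rightarrow> 'a) \<Rightarrow> 'g \<Rightarrow> 'a) set" where
  "Lam_set = {Lambda \<alpha> \<sigma> f | f. finite {g. f g \<noteq> 0}}"

lemma Lambda_add:
  assumes "finite {g. f g \<noteq> 0}" "finite {g. f' g \<noteq> 0}"
  shows "op_add AS (Lambda \<alpha> \<sigma> f) (Lambda \<alpha> \<sigma> f') = Lambda \<alpha> \<sigma> (\<lambda>g. f g + f' g)" "finite {g. f g + f' g \<noteq> 0}"
proof -
  let ?G = "{g. f g \<noteq> 0} \<union> {g. f' g \<noteq> 0}"
  have G: "finite ?G" using assms by simp
  have s: "{g. f g + f' g \<noteq> 0} \<subseteq> ?G" by auto
  have eqs: "Lambda \<alpha> \<sigma> f = restr AS (\<lambda>\<xi>. \<Sum>g\<in>?G. mon (f g) g \<xi>)" "Lambda \<alpha> \<sigma> f' = restr AS (\<lambda>\<xi>. \<Sum>g\<in>?G. mon (f' g) g \<xi>)"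
    "Lambda \<alpha> \<sigma> (\<lambda>g. f g + f' g) = restr AS (\<lambda>\<xi>. \<Sum>g\<in>?G. mon (f g + f' g) g \<xi>)"
    using G s by (intro Lambda_eq_sum_mon; auto)+
  show "op_add AS (Lambda \<alpha> \<sigma> f) (Lambda \<alpha> \<sigma> f') = Lambda \<alpha> \<sigma> (\<lambda>g. f g + f' g)"
    unfolding eqs by (rule restr_eqI[of AS]) (auto simp: mon_add sum.distrib)
  show "finite {g. f g + f' g \<noteq> 0}" using G s by (rule finite_subset[rotated])
qed

lemma mon_eq_Lambda: "mon a g = Lambda \<alpha> \<sigma> (\<lambda>h. if h = g then a else 0)"
proof -
  have "Lambda \<alpha> \<sigma> (\<lambda>h. if h = g then a else 0) = restr AS (\<lambda>\<xi>. \<Sum>h\<in>{g}. mon (if h = g then a else 0) h \<xi>)"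
    by (rule Lambda_eq_sum_mon) auto
  then show ?thesis using opsD(2)[OF mon_ops, of a g] by simp
qed

lemma mon_mem_Lam_set: "mon a g \<in> Lam_set"
proof -
  have "{h. (if h = g then a else 0) \<noteq> 0} \<subseteq> {g}" by auto
  then have "finite {h. (if h = g then a else 0) \<noteq> 0}" using finite_subset by blast
  then show ?thesis unfolding Lam_set_def mon_eq_Lambda by blast
qed

lemma Lam_set_add: "T \<in> Lam_set \<Longrightarrow> S \<in> Lam_set \<Longrightarrow> op_add AS T S \<in> Lam_set"
  unfolding Lam_set_def using Lambda_add by blast

lemma zero_mem_Lam_set: "restr AS (\<lambda>\<xi>. 0) \<in> Lam_set"
proof -
  have "mon 0 0 = restr AS (\<lambda>\<xi>. 0)"
    by (rule restr_eqI[of AS]) (auto simp: mon_zero opsD(2)[OF mon_ops])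
  then show ?thesis using mon_mem_Lam_set[of 0 0] by simp
qed

lemma Lam_set_sum: "(\<And>k. k \<in> F \<Longrightarrow> T k \<in> Lam_set) \<Longrightarrow> restr AS (\<lambda>\<xi>. \<Sum>k\<in>F. T k \<xi>) \<in> Lam_set"
proof (induction F rule: infinite_finite_induct)
  case (insert k F)
  have eq: "restr AS (\<lambda>\<xi>. \<Sum>k\<in>insert k F. T k \<xi>) = op_add AS (T k) (restr AS (\<lambda>\<xi>. \<Sum>k\<in>F. T k \<xi>))"
    using insert.hyps by - (rule restr_eqI[of AS], auto)
  show ?case unfolding eq by (rule Lam_set_add) (use insert in auto)
qed (simp_all only: sum.empty sum.infinite zero_mem_Lam_set not_False_eq_True)

lemma Lam_setE:
  assumes "T \<in> Lam_set"
  obtains G f where "finite G" "T = restr AS (\<lambda>\<xi>. \<Sum>g\<in>G. mon (f g) g \<xi>)"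
proof -
  obtain f where f: "T = Lambda \<alpha> \<sigma> f" "finite {g. f g \<noteq> 0}" using assms by (auto simp: Lam_set_def)
  then show thesis using that[OF f(2), of f] Lambda_eq_sum_mon[OF f(2), of f] by blast
qed

lemma Lam_set_adj: "T \<in> Lam_set \<Longrightarrow> \<exists>T'\<in>Lam_set. adj_pair T T'"
proof -
  assume "T \<in> Lam_set"
  then obtain G f where G: "finite G" "T = restr AS (\<lambda>\<xi>. \<Sum>g\<in>G. mon (f g) g \<xi>)" by (rule Lam_setE)
  let ?m = "\<lambda>g. mon (invol (\<sigma> (- g) g) * \<alpha> (- g) (invol (f g))) (- g)"
  have "adj_pair T (restr AS (\<lambda>\<xi>. \<Sum>g\<in>G. ?m g \<xi>))" unfolding G(2) by (rule adj_pair_sum) (rule adj_pair_mon)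
  moreover have "restr AS (\<lambda>\<xi>. \<Sum>g\<in>G. ?m g \<xi>) \<in> Lam_set" by (intro Lam_set_sum mon_mem_Lam_set)
  ultimately show ?thesis by blast
qed

lemma Lam_set_ops: "Lam_set \<subseteq> ops"
proof
  fix T assume T: "T \<in> Lam_set"
  then obtain T' where "adj_pair T T'" using Lam_set_adj by blast
  moreover have "restr AS T = T" using T by (auto simp: Lam_set_def Lambda_def)
  ultimately show "T \<in> ops" unfolding ops_def adjointable_iff by blast
qed

lemma Lam_set_comp: "T \<in> Lam_set \<Longrightarrow> S \<in> Lam_set \<Longrightarrow> op_comp AS T S \<in> Lam_set"
proof -
  assume T: "T \<in> Lam_set" and S: "S \<in> Lam_set"
  obtain G f where G: "finite G" "T = restr AS (\<lambda>\<xi>. \<Sum>g\<in>G. mon (f g) g \<xi>)" using T by (rule Lam_setE)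
  obtain H f' where H: "finite H" "S = restr AS (\<lambda>\<xi>. \<Sum>h\<in>H. mon (f' h) h \<xi>)" using S by (rule Lam_setE)
  have "op_comp AS T S = restr AS (\<lambda>\<xi>. \<Sum>g\<in>G. restr AS (\<lambda>\<xi>. \<Sum>h\<in>H. mon (f g * (\<alpha> g (f' h) * \<sigma> g h)) (g + h) \<xi>) \<xi>)"
  proof (rule restr_eqI[of AS])
    fix \<xi> assume \<xi>: "\<xi> \<in> AS"
    have mem: "(\<Sum>h\<in>H. mon (f' h) h \<xi>) \<in> AS" using \<xi> by (intro sum_mem mon_linear)
    have "mon (f g) g (\<Sum>h\<in>H. mon (f' h) h \<xi>) = (\<Sum>h\<in>H. mon (f g * (\<alpha> g (f' h) * \<sigma> g h)) (g + h) \<xi>)" for g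
      using \<xi> by (subst mon_linear(6)) (auto simp: mon_linear(1) mon_mon)
    then show "op_comp AS T S \<xi> = restr AS (\<lambda>\<xi>. \<Sum>g\<in>G. restr AS (\<lambda>\<xi>. \<Sum>h\<in>H. mon (f g * (\<alpha> g (f' h) * \<sigma> g h)) (g + h) \<xi>) \<xi>) \<xi>"
      using \<xi> mem by (simp add: G(2) H(2))
  qed auto
  then show ?thesis by (simp only:) (intro Lam_set_sum mon_mem_Lam_set)
qed

lemma Lam_set_smul: "T \<in> Lam_set \<Longrightarrow> op_smul AS (as_rm \<alpha>) c T \<in> Lam_set"
proof -
  assume T: "T \<in> Lam_set"
  obtain G f where G: "finite G" "T = restr AS (\<lambda>\<xi>. \<Sum>g\<in>G. mon (f g) g \<xi>)" using T by (rule Lam_setE)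
  have "as_rm \<alpha> (mon a g \<xi>) (cscale c 1) = mon (a * cscale c 1) g \<xi>" if "\<xi> \<in> AS" for a g \<xi>
    using that by (auto simp: as_rm_def mon_apply leftop_apply lam_mem alpha mult.assoc cscale_one_central)
  then have "op_smul AS (as_rm \<alpha>) c T = restr AS (\<lambda>\<xi>. \<Sum>g\<in>G. mon (f g * cscale c 1) g \<xi>)"
    by - (rule restr_eqI[of AS], auto simp: G(2) rm_sum_left mon_linear(1))
  then show ?thesis by (simp only:) (intro Lam_set_sum mon_mem_Lam_set)
qed

lemma gen_subset_ops: "range (leftop \<alpha>) \<union> range (lam \<alpha> \<sigma>) \<subseteq> ops"
  using leftop_ops lam_ops by blast

lemmas Cr_subalg = cstar_subalg_generated(1)[OF gen_subset_ops, folded Cr_def]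
lemmas gen_subset_Cr = cstar_subalg_generated(2)[OF gen_subset_ops, folded Cr_def]
lemmas Cr_least = cstar_subalg_generated(3)[OF gen_subset_ops, folded Cr_def]
lemmas Cr_ops = cstar_subalgD(1)[OF Cr_subalg]

lemma mon_mem_Cr: "mon a g \<in> CR"
  unfolding mon_def by (rule cstar_subalgD(3)[OF Cr_subalg]) (use gen_subset_Cr in auto)

lemma id_mem_Cr: "restr AS (\<lambda>\<xi>. \<xi>) \<in> CR"
proof -
  have "leftop \<alpha> 1 = restr AS (\<lambda>\<xi>. \<xi>)"
    by (rule restr_eqI[of AS]) (auto simp: leftop_one opsD(2)[OF leftop_ops])
  then show ?thesis using gen_subset_Cr by (metis UnI1 rangeI subsetD)
qed

lemma Lambda_mem_Cr: "finite {g. f g \<noteq> 0} \<Longrightarrow> Lambda \<alpha> \<sigma> f \<in> CR"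
  unfolding Lambda_eq_sum_mon[OF _ order_refl, of f]
  by (intro cstar_subalg_sum[OF Cr_subalg cstar_subalg_zero[OF Cr_subalg id_mem_Cr]] mon_mem_Cr)

text \<open>The closure of \<open>Lam_set\<close> is a C*-subalgebra containing the generators
  \<open>mon a 0\<close> and \<open>mon 1 g\<close>, so it contains \<open>CR\<close> by
  minimality.\<close>

lemma Cr_approx:
  assumes "T \<in> CR" "r > 0"
  obtains f where "finite {g. f g \<noteq> 0}" "\<And>\<xi>. \<xi> \<in> AS \<Longrightarrow> hn (Lambda \<alpha> \<sigma> f \<xi> - T \<xi>) \<le> r * hn \<xi>"
proof -
  have "Lam_set \<subseteq> op_closure Lam_set" by (rule subset_op_closure[OF Lam_set_ops])
  moreover have "leftop \<alpha> a \<in> Lam_set" for a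
  proof -
    have "mon a 0 = leftop \<alpha> a"
      by (rule restr_eqI[of AS]) (auto simp: mon_apply lam_zero opsD(2)[OF mon_ops] opsD(2)[OF leftop_ops])
    then show ?thesis using mon_mem_Lam_set by metis
  qed
  moreover have "lam \<alpha> \<sigma> g \<in> Lam_set" for g
  proof -
    have "mon 1 g = lam \<alpha> \<sigma> g"
      by (rule restr_eqI[of AS]) (auto simp: mon_apply leftop_one lam_mem opsD(2)[OF mon_ops] opsD(2)[OF lam_ops])
    then show ?thesis using mon_mem_Lam_set by metis
  qed
  moreover have "cstar_subalg AS (as_rm \<alpha>) (as_ip \<alpha>) (op_closure Lam_set)"
    by (rule cstar_subalg_op_closure) (auto intro: Lam_set_ops[THEN subsetD] Lam_set_add Lam_set_comp Lam_set_smul Lam_set_adj)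
  ultimately have "CR \<subseteq> op_closure Lam_set" by (intro Cr_least) auto
  then obtain U where "U \<in> Lam_set" "\<And>\<xi>. \<xi> \<in> AS \<Longrightarrow> hn (U \<xi> - T \<xi>) \<le> r * hn \<xi>"
    using op_closureE[OF _ assms(2)] assms(1) by blast
  then show thesis using that by (auto simp: Lam_set_def)
qed

definition ent :: "(('g \<Rightarrow> 'a) \<Rightarrow> 'g \<Rightarrow> 'a) \<Rightarrow> 'g \<Rightarrow> 'g \<Rightarrow> 'a" where
  "ent T h k = as_ip \<alpha> (delta h) (T (delta k))"

lemma delta_mem: "delta g \<in> AS"
  by (rule e_mem) simp

lemma hn_delta: "hn (delta g) = 1"
  using e_orth[of g g] by (simp add: hnorm_def)

lemma ent_linear:
  assumes "T \<in> ops" "S \<in> ops"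
  shows "ent (op_add AS T S) h k = ent T h k + ent S h k" "ent (op_diff AS T S) h k = ent T h k - ent S h k"
  using adjointable_linear(1)[OF opsD(1)[OF assms(1)] delta_mem] adjointable_linear(1)[OF opsD(1)[OF assms(2)] delta_mem]
  by (simp_all add: ent_def delta_mem ip_add_right ip_diff_right)

lemma ent_smul: "T \<in> ops \<Longrightarrow> ent (op_smul AS (as_rm \<alpha>) c T) h k = ent T h k * cscale c 1"
  using adjointable_linear(1)[OF opsD(1) delta_mem] by (simp add: ent_def delta_mem ip_rm_right)

lemma tendsto_ent:
  assumes "\<And>n. T n \<in> ops" "S \<in> ops" "(\<lambda>n. hn (T n (delta k) - S (delta k))) \<longlonglongrightarrow> 0"
  shows "(\<lambda>n. ent (T n) h k) \<longlonglongrightarrow> ent S h k"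
  unfolding ent_def using assms adjointable_linear(1)[OF opsD(1) delta_mem]
  by (intro tendsto_ip) (auto simp: delta_mem)

text \<open>The vector \<lambda>(g) \<delta>(k) is supported at g + k, so only g = h - k contributes
  to the entry at h, k.\<close>

lemma ent_Lambda:
  assumes f: "finite {g. f g \<noteq> 0}"
  shows "ent (Lambda \<alpha> \<sigma> f) h k = \<beta> h (f (h - k) * \<sigma> (h - k) k)"
proof -
  have lam_delta: "lam \<alpha> \<sigma> g (delta k) h = (if g = h - k then \<sigma> (h - k) k else 0)" for g
  proof -
    have "lam \<alpha> \<sigma> g (delta k) h = (if - g + h = k then \<sigma> g k else 0)"
      by (simp add: lam_def delta_mem) (simp add: delta_def alpha)
    moreover have "- g + h = k \<longleftrightarrow> g = h - k" by (metis add_diff_cancel diff_add_cancel minus_add_cancel add_minus_cancel)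
    ultimately show ?thesis by simp
  qed
  have "Lambda \<alpha> \<sigma> f (delta k) h = (\<Sum>g\<in>{g. f g \<noteq> 0}. if g = h - k then f (h - k) * \<sigma> (h - k) k else 0)"
    by (simp add: Lambda_def delta_mem lam_delta if_distrib cong: if_cong sum.cong)
  also have "\<dots> = f (h - k) * \<sigma> (h - k) k" using f by simp
  finally show ?thesis by (simp add: ent_def as_ip_delta_left)
qed

end

section \<open>Matrix entries and equivariant representations\<close>

locale eqrep = tsys \<alpha> \<sigma>
  for \<alpha> :: "'g::group_add \<Rightarrow> 'a::cstar \<Rightarrow> 'a" and \<sigma> :: "'g \<Rightarrow> 'g \<Rightarrow> 'a" +
  fixes X :: "'x::ab_group_add set" and rm :: "'x \<Rightarrow> 'a \<Rightarrow> 'x" and ip :: "'x \<Rightarrow> 'x \<Rightarrow> 'a"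
    and \<rho> :: "'a \<Rightarrow> 'x \<Rightarrow> 'x" and v :: "'g \<Rightarrow> 'x \<Rightarrow> 'x"
  assumes hmX: "hilbert_module X rm ip" and eqrep: "equivariant_rep \<alpha> \<sigma> X rm ip \<rho> v"
begin

lemma star_rep: "star_rep X rm ip \<rho>"
proof -
  interpret H: hmod X rm ip by (rule hmod.intro[OF hmX])
  show ?thesis
    by unfold_locales (use eqrep in \<open>unfold equivariant_rep_def, elim conjE, simp\<close>)+
qed

sublocale schur "ASig \<alpha>" "as_rm \<alpha>" "as_ip \<alpha>" delta UNIV X rm ip \<rho>
  by (intro schur.intro hbasis_axioms star_rep)

lemma v_props:
  shows v_bij: "bij_betw (v g) X X"
    and v_rho: "x \<in> X \<Longrightarrow> \<rho> (\<alpha> g a) x = v g (\<rho> a (inv_into X (v g) x))"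
    and v_v: "x \<in> X \<Longrightarrow> v g (v h x) = rm (\<rho> (\<sigma> g h) (v (g + h) x)) (invol (\<sigma> g h))"
    and v_ip: "x \<in> X \<Longrightarrow> x' \<in> X \<Longrightarrow> \<alpha> g (ip x x') = ip (v g x) (v g x')"
  using eqrep unfolding equivariant_rep_def by (elim conjE; simp; fail)+

text \<open>The inverse map rather than \<open>v (- g)\<close>: under a twist the two agree only up
  to the operators ad of condition (ii).\<close>

definition vi :: "'g \<Rightarrow> 'x \<Rightarrow> 'x" where
  "vi g = inv_into X (v g)"

lemma vi: "x \<in> X \<Longrightarrow> vi g x \<in> X" "x \<in> X \<Longrightarrow> v g (vi g x) = x" "x \<in> X \<Longrightarrow> vi g (v g x) = x" "x \<in> X \<Longrightarrow> v g x \<in> X"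
  using v_bij[of g] bij_betw_inv_into_right[OF v_bij] bij_betw_inv_into_left[OF v_bij]
  by (auto simp: vi_def bij_betw_def inv_into_into)

lemma hn_vi: "x \<in> X \<Longrightarrow> hnorm ip (vi g x) = hnorm ip x"
  using v_ip[of "vi g x" "vi g x" g] is_aut_norm[OF aut, of g "ip (vi g x) (vi g x)"] by (simp add: vi hnorm_def)

lemma v_zero: "x \<in> X \<Longrightarrow> v 0 x = x"
proof -
  assume x: "x \<in> X"
  have "v 0 (v 0 x) = v 0 x" using v_v[OF x, of 0 0] x by (simp add: sigma_zero R.rho_one vi)
  then show ?thesis using vi(3)[of "v 0 x" 0] vi(3)[OF x, of 0] vi(4)[OF x, of 0] by simp
qed

text \<open>With g = h - k and w = \<open>vi k y\<close>, condition (ii) gives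
  \<open>rm (v g y) (\<sigma> g k) = \<rho> (\<sigma> g k) (v h w)\<close>. Thus the factor \<sigma>
  on the right of an entry becomes a factor inside \<rho>, and conditions (i) and (iii) move
  \<open>v h\<close> to the other side of the inner product.\<close>

lemma ent_Lambda_coefficient:
  assumes f: "finite {g. f g \<noteq> 0}" and xy: "x \<in> X" "y \<in> X"
  shows "finite {g. ip x (\<rho> (f g) (v g y)) \<noteq> 0}"
    "ent (Lambda \<alpha> \<sigma> (\<lambda>g. ip x (\<rho> (f g) (v g y)))) h k = ip (vi h x) (\<rho> (ent (Lambda \<alpha> \<sigma> f) h k) (vi k y))"
proof -
  have "{g. ip x (\<rho> (f g) (v g y)) \<noteq> 0} \<subseteq> {g. f g \<noteq> 0}" using xy by (auto simp: vi)
  then show fin: "finite {g. ip x (\<rho> (f g) (v g y)) \<noteq> 0}" using f finite_subset by blast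
  define g w c where "g = h - k" and "w = vi k y" and "c = f g * \<sigma> g k"
  have gk: "g + k = h" by (simp add: g_def)
  have w: "w \<in> X" "v k w = y" using xy by (auto simp: w_def vi)
  have vgy: "v g y = rm (\<rho> (\<sigma> g k) (v h w)) (invol (\<sigma> g k))" using v_v[OF w(1), of g k] by (simp add: w gk)
  then have vgy': "rm (v g y) (\<sigma> g k) = \<rho> (\<sigma> g k) (v h w)"
    using w by (simp add: R.rm_rm R.rho_linear vi sigma_unitary)
  have "\<alpha> h (ip (vi h x) (\<rho> (\<beta> h c) w)) = ip x (v h (\<rho> (\<beta> h c) w))"
    using v_ip[of "vi h x" "\<rho> (\<beta> h c) w" h] xy w by (simp add: vi R.rho_linear)
  also have "v h (\<rho> (\<beta> h c) w) = \<rho> c (v h w)"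
    using v_rho[of "v h w" h "\<beta> h c"] w by (simp add: vi flip: vi_def)
  also have "\<dots> = \<rho> (f g) (rm (v g y) (\<sigma> g k))" using w by (simp add: c_def R.rho_mult vi vgy')
  also have "ip x \<dots> = ip x (\<rho> (f g) (v g y)) * \<sigma> g k"
    using xy by (simp add: R.rho_linear R.ip_rm_right vi)
  finally have "ip (vi h x) (\<rho> (\<beta> h c) w) = \<beta> h (ip x (\<rho> (f g) (v g y)) * \<sigma> g k)"
    using beta_alpha by metis
  then show "ent (Lambda \<alpha> \<sigma> (\<lambda>g. ip x (\<rho> (f g) (v g y)))) h k = ip (vi h x) (\<rho> (ent (Lambda \<alpha> \<sigma> f) h k) (vi k y))"
    unfolding ent_Lambda[OF f] ent_Lambda[OF fin] by (simp add: g_def w_def c_def)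
qed

end

section \<open>Coefficient multipliers\<close>

locale coefficient = eqrep \<alpha> \<sigma> X rm ip \<rho> v
  for \<alpha> :: "'g::group_add \<Rightarrow> 'a::cstar \<Rightarrow> 'a" and \<sigma> :: "'g \<Rightarrow> 'g \<Rightarrow> 'a"
    and X :: "'x::ab_group_add set" and rm :: "'x \<Rightarrow> 'a \<Rightarrow> 'x" and ip :: "'x \<Rightarrow> 'x \<Rightarrow> 'a"
    and \<rho> :: "'a \<Rightarrow> 'x \<Rightarrow> 'x" and v :: "'g \<Rightarrow> 'x \<Rightarrow> 'x" +
  fixes x y :: 'x
  assumes x: "x \<in> X" and y: "y \<in> X"
begin

abbreviation T :: "'g \<Rightarrow> 'a \<Rightarrow> 'a" where
  "T \<equiv> \<lambda>g a. ip x (\<rho> a (v g y))"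

text \<open>A relation and not a function: that some operator in \<open>CR\<close> has the
  prescribed entries is known only after the limit argument in \<open>rel_exists\<close>.\<close>

definition rel :: "(('g \<Rightarrow> 'a) \<Rightarrow> 'g \<Rightarrow> 'a) \<Rightarrow> (('g \<Rightarrow> 'a) \<Rightarrow> 'g \<Rightarrow> 'a) \<Rightarrow> bool" where
  "rel S R \<longleftrightarrow> R \<in> CR \<and> (\<forall>h k. ent R h k = ip (vi h x) (\<rho> (ent S h k) (vi k y)))"

lemma rel_bound:
  assumes S: "S \<in> ops" and R: "R \<in> ops" and ent: "\<And>h k. ent R h k = ip (vi h x) (\<rho> (ent S h k) (vi k y))"
    and \<xi>: "\<xi> \<in> AS"
  shows "hn (R \<xi>) \<le> hnorm ip x * hnorm ip y * nrm S * hn \<xi>"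
  using ent x y
  by (intro schur_bound[OF R S, where x = "\<lambda>h. vi h x" and y = "\<lambda>h. vi h y"] \<xi>) (auto simp: vi hn_vi ent_def)

lemma rel_unique:
  assumes "rel S R" "rel S R'" shows "R = R'"
  using assms unfolding rel_def by (intro ops_eq_if_entries_eq) (auto simp: Cr_ops ent_def)

lemma rel_Lambda: "finite {g. f g \<noteq> 0} \<Longrightarrow> rel (Lambda \<alpha> \<sigma> f) (Lambda \<alpha> \<sigma> (\<lambda>g. T g (f g)))"
  unfolding rel_def by (intro conjI allI Lambda_mem_Cr ent_Lambda_coefficient[OF _ x y])

lemma Cr_approx_seq:
  assumes "S \<in> CR"
  obtains f where "\<And>n::nat. finite {g. f n g \<noteq> 0}"
    "\<And>n \<xi>. \<xi> \<in> AS \<Longrightarrow> hn (Lambda \<alpha> \<sigma> (f n) \<xi> - S \<xi>) \<le> inverse (real (Suc n)) * hn \<xi>"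
proof -
  have "\<exists>f. finite {g. f g \<noteq> 0} \<and> (\<forall>\<xi>\<in>AS. hn (Lambda \<alpha> \<sigma> f \<xi> - S \<xi>) \<le> inverse (real (Suc n)) * hn \<xi>)" for n
    using Cr_approx[OF assms, of "inverse (real (Suc n))"] by (metis inverse_positive_iff_positive of_nat_0_less_iff zero_less_Suc)
  then obtain f where "\<And>n. finite {g. f n g \<noteq> 0} \<and> (\<forall>\<xi>\<in>AS. hn (Lambda \<alpha> \<sigma> (f n) \<xi> - S \<xi>) \<le> inverse (real (Suc n)) * hn \<xi>)"
    by metis
  then show thesis by (intro that[of f]) auto
qed

lemma tendsto_approx_seq:
  assumes "\<And>n. hn (u n) \<le> K * inverse (real (Suc n))"
  shows "(\<lambda>n. hn (u n)) \<longlonglongrightarrow> 0"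
proof (rule tendsto_sandwich[OF _ _ tendsto_const])
  show "(\<lambda>n. K * inverse (real (Suc n))) \<longlonglongrightarrow> 0"
    using tendsto_mult_left[OF LIMSEQ_inverse_real_of_nat, of K] by simp
qed (use assms in auto)

text \<open>Entries see an operator only through its values on \<open>delta k\<close>, so
  convergence on these vectors suffices on both sides.\<close>

lemma rel_limit:
  assumes SC: "S \<in> CR" and f: "\<And>n::nat. finite {g. f n g \<noteq> 0}"
    and lim_S: "\<And>k. (\<lambda>n. hn (Lambda \<alpha> \<sigma> (f n) (delta k) - S (delta k))) \<longlonglongrightarrow> 0"
    and RC: "R \<in> CR" and lim_R: "\<And>k. (\<lambda>n. hn (Lambda \<alpha> \<sigma> (\<lambda>g. T g (f n g)) (delta k) - R (delta k))) \<longlonglongrightarrow> 0"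
  shows "rel S R"
  unfolding rel_def
proof (intro conjI allI RC)
  fix h k
  note fin = ent_Lambda_coefficient[OF f x y]
  have "(\<lambda>n. ent (Lambda \<alpha> \<sigma> (f n)) h k) \<longlonglongrightarrow> ent S h k"
    by (intro tendsto_ent lim_S Cr_ops Lambda_mem_Cr f SC)
  then have "(\<lambda>n. ip (vi h x) (\<rho> (ent (Lambda \<alpha> \<sigma> (f n)) h k) (vi k y))) \<longlonglongrightarrow> ip (vi h x) (\<rho> (ent S h k) (vi k y))"
    by (intro bounded_linear.tendsto[OF R.bounded_linear_coefficient] vi x y)
  moreover have "(\<lambda>n. ent (Lambda \<alpha> \<sigma> (\<lambda>g. T g (f n g))) h k) \<longlonglongrightarrow> ent R h k"
    by (intro tendsto_ent lim_R Cr_ops Lambda_mem_Cr fin RC)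
  ultimately show "ent R h k = ip (vi h x) (\<rho> (ent S h k) (vi k y))"
    unfolding fin(2) using LIMSEQ_unique by blast
qed

text \<open>The images of approximants of \<open>S\<close> are Cauchy, because
  \<open>rel_bound\<close> applies to their differences. Their limit stays in \<open>CR\<close> and
  inherits the entry formula.\<close>

lemma rel_exists:
  assumes S: "S \<in> CR" shows "\<exists>R. rel S R"
proof -
  obtain f where f: "\<And>n::nat. finite {g. f n g \<noteq> 0}"
    "\<And>n \<xi>. \<xi> \<in> AS \<Longrightarrow> hn (Lambda \<alpha> \<sigma> (f n) \<xi> - S \<xi>) \<le> inverse (real (Suc n)) * hn \<xi>"
    using Cr_approx_seq[OF S] by metis
  let ?L = "\<lambda>n. Lambda \<alpha> \<sigma> (f n)" and ?U = "\<lambda>n. Lambda \<alpha> \<sigma> (\<lambda>g. T g (f n g))"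
  define C where "C = hnorm ip x * hnorm ip y"
  have C: "C \<ge> 0" by (simp add: C_def)
  note fin = ent_Lambda_coefficient[OF f(1) x y]
  have L: "?L n \<in> ops" and U: "?U n \<in> ops" for n by (intro Cr_ops Lambda_mem_Cr f fin)+
  note Sl = adjointable_linear(1)[OF opsD(1)[OF Cr_ops[OF S]]]
    and Ll = adjointable_linear(1)[OF opsD(1)[OF L]] and Ul = adjointable_linear(1)[OF opsD(1)[OF U]]
  have diff: "hn (?U m \<xi> - ?U n \<xi>) \<le> C * (inverse (real (Suc m)) + inverse (real (Suc n))) * hn \<xi>" if \<xi>: "\<xi> \<in> AS" for m n \<xi>
  proof -
    have D: "op_diff AS (?L m) (?L n) \<in> ops" "op_diff AS (?U m) (?U n) \<in> ops" by (intro ops_closed L U)+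
    have "ent (op_diff AS (?U m) (?U n)) h k = ip (vi h x) (\<rho> (ent (op_diff AS (?L m) (?L n)) h k) (vi k y))" for h k
      using x y by (simp add: ent_linear L U fin(2) R.rho_diff R.ip_diff_right vi R.rho_linear)
    then have "hn (op_diff AS (?U m) (?U n) \<xi>) \<le> C * nrm (op_diff AS (?L m) (?L n)) * hn \<xi>"
      unfolding C_def by (rule rel_bound[OF D _ \<xi>])
    moreover have "nrm (op_diff AS (?L m) (?L n)) \<le> inverse (real (Suc m)) + inverse (real (Suc n))"
    proof (rule opnorm_leI)
      fix \<eta> assume \<eta>: "\<eta> \<in> AS"
      have "hn (?L m \<eta> - ?L n \<eta>) \<le> hn (?L m \<eta> - S \<eta>) + hn (?L n \<eta> - S \<eta>)"
        using hn_diff_triangle[of "?L m \<eta>" "S \<eta>" "?L n \<eta>"] hn_diff_commute[of "S \<eta>" "?L n \<eta>"] \<eta> Sl Ll by simp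
      also have "\<dots> \<le> inverse (real (Suc m)) * hn \<eta> + inverse (real (Suc n)) * hn \<eta>" by (intro add_mono f \<eta>)
      finally show "hn (op_diff AS (?L m) (?L n) \<eta>) \<le> (inverse (real (Suc m)) + inverse (real (Suc n))) * hn \<eta>"
        using \<eta> by (simp only: op_apply distrib_right)
    qed simp
    then have "C * nrm (op_diff AS (?L m) (?L n)) * hn \<xi>
        \<le> C * (inverse (real (Suc m)) + inverse (real (Suc n))) * hn \<xi>"
      using C by (intro mult_right_mono mult_left_mono) auto
    ultimately show ?thesis using \<xi> by simp
  qed
  obtain R where R: "R \<in> ops" "(\<lambda>n. nrm (op_diff AS (?U n) R)) \<longlonglongrightarrow> 0"
  proof (rule ops_complete[OF U])
    fix r :: real assume r: "r > 0"
    have "(\<lambda>n. C * (2 * inverse (real (Suc n)))) \<longlonglongrightarrow> C * (2 * 0)" by (intro tendsto_intros LIMSEQ_inverse_real_of_nat)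
    then have "(\<lambda>n. C * (2 * inverse (real (Suc n)))) \<longlonglongrightarrow> 0" by simp
    from order_tendstoD(2)[OF this r] obtain N where N: "C * (2 * inverse (real (Suc N))) < r"
      unfolding eventually_sequentially by blast
    have "hn (?U m \<xi> - ?U n \<xi>) \<le> r * hn \<xi>" if "m \<ge> N" "n \<ge> N" "\<xi> \<in> AS" for m n \<xi>
    proof -
      have "inverse (real (Suc m)) \<le> inverse (real (Suc N))" "inverse (real (Suc n)) \<le> inverse (real (Suc N))"
        using that by (intro le_imp_inverse_le; simp)+
      then have "inverse (real (Suc m)) + inverse (real (Suc n)) \<le> 2 * inverse (real (Suc N))" by linarith
      then have "C * (inverse (real (Suc m)) + inverse (real (Suc n))) \<le> C * (2 * inverse (real (Suc N)))"
        using C by (rule mult_left_mono)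
      then have "C * (inverse (real (Suc m)) + inverse (real (Suc n))) * hn \<xi> \<le> r * hn \<xi>"
        using N by (intro mult_right_mono) auto
      then show ?thesis using diff[OF that(3), of m n] by linarith
    qed
    then show "\<exists>N. \<forall>m\<ge>N. \<forall>n\<ge>N. \<forall>\<xi>\<in>AS. hn (?U m \<xi> - ?U n \<xi>) \<le> r * hn \<xi>" by blast
  qed blast
  have RC: "R \<in> CR" 
    by (rule cstar_subalgD(6)[OF Cr_subalg Lambda_mem_Cr[OF fin(1)] R])
  have lim_R: "(\<lambda>n. hn (?U n (delta k) - R (delta k))) \<longlonglongrightarrow> 0" for k
    by (rule op_limit_pointwise[OF opsD(1)[OF U] opsD(1)[OF R(1)] R(2) delta_mem])
  have lim_S: "(\<lambda>n. hn (?L n (delta k) - S (delta k))) \<longlonglongrightarrow> 0" for k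
    by (rule tendsto_approx_seq[of _ 1]) (use f(2)[OF delta_mem] in \<open>simp add: hn_delta\<close>)
  show ?thesis by (rule exI) (rule rel_limit[of S f, OF S f(1) lim_S RC lim_R])
qed

text \<open>Boundedness carries the known values of \<open>M\<close> on finitely supported functions
  to all of \<open>CR\<close>, so every admissible \<open>M\<close> is the Schur map and the later
  estimates need not refer to a particular construction.\<close>

lemma mult_map_rel:
  assumes M: "mult_map \<alpha> \<sigma> T M" and S: "S \<in> CR"
  shows "rel S (M S)"
proof -
  have M_C: "M U \<in> CR" if "U \<in> CR" for U
    using M that unfolding mult_map_def bounded_lin_on_def by blast
  have M_add: "M (op_add AS U V) = op_add AS (M U) (M V)" if "U \<in> CR" "V \<in> CR" for U V
    using M that unfolding mult_map_def bounded_lin_on_def by blast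
  have M_smul: "M (op_smul AS (as_rm \<alpha>) c U) = op_smul AS (as_rm \<alpha>) c (M U)" if "U \<in> CR" for U c
    using M that unfolding mult_map_def bounded_lin_on_def by blast
  obtain K where K: "\<And>U. U \<in> CR \<Longrightarrow> nrm (M U) \<le> K * nrm U"
    using M unfolding mult_map_def bounded_lin_on_def by blast
  have M_Lambda: "M (Lambda \<alpha> \<sigma> f) = Lambda \<alpha> \<sigma> (\<lambda>g. T g (f g))" if "finite {g. f g \<noteq> 0}" for f
    using M that unfolding mult_map_def by blast
  obtain f where f: "\<And>n::nat. finite {g. f n g \<noteq> 0}"
    "\<And>n \<xi>. \<xi> \<in> AS \<Longrightarrow> hn (Lambda \<alpha> \<sigma> (f n) \<xi> - S \<xi>) \<le> inverse (real (Suc n)) * hn \<xi>"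
    using Cr_approx_seq[OF S] by metis
  let ?L = "\<lambda>n. Lambda \<alpha> \<sigma> (f n)"
  have minus_one: "cscale (-1) 1 = (- 1 :: 'a)" by (simp add: cscale_def)
  have lim_S: "(\<lambda>n. hn (?L n (delta k) - S (delta k))) \<longlonglongrightarrow> 0" for k
    by (rule tendsto_approx_seq[of _ 1]) (use f(2)[OF delta_mem] in \<open>simp add: hn_delta\<close>)
  have lim_M: "(\<lambda>n. hn (Lambda \<alpha> \<sigma> (\<lambda>g. T g (f n g)) (delta k) - M S (delta k))) \<longlonglongrightarrow> 0" for k
  proof (rule tendsto_approx_seq[of _ "\<bar>K\<bar>"])
    fix n
    \<comment> \<open>\<open>bounded_lin_on\<close> speaks of sums and scalar multiples only, so the
      difference is formed with the scalar -1.\<close>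
    define D where "D = op_add AS (?L n) (op_smul AS (as_rm \<alpha>) (-1) S)"
    note Sl = adjointable_linear(1)[OF opsD(1)[OF Cr_ops[OF S]]]
    note MSl = adjointable_linear(1)[OF opsD(1)[OF Cr_ops[OF M_C[OF S]]]]
    have D: "D \<in> CR" unfolding D_def by (intro cstar_subalgD(2,4)[OF Cr_subalg] Lambda_mem_Cr f S)
    have "D \<xi> = ?L n \<xi> - S \<xi>" if "\<xi> \<in> AS" for \<xi>
      using that Sl by (simp add: D_def minus_one rm_minus_right)
    then have D_le: "nrm D \<le> inverse (real (Suc n))" using f(2) by (intro opnorm_leI) auto
    have D_ge: "0 \<le> nrm D" by (rule opnorm_nonneg[OF opsD(1)[OF Cr_ops[OF D]]])
    have "M D = op_add AS (M (?L n)) (op_smul AS (as_rm \<alpha>) (-1) (M S))"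
      unfolding D_def by (simp add: M_add M_smul Lambda_mem_Cr f S cstar_subalgD(4)[OF Cr_subalg])
    then have "M D (delta k) = Lambda \<alpha> \<sigma> (\<lambda>g. T g (f n g)) (delta k) - M S (delta k)"
      using MSl[OF delta_mem] by (simp add: M_Lambda f delta_mem minus_one rm_minus_right)
    then have "hn (Lambda \<alpha> \<sigma> (\<lambda>g. T g (f n g)) (delta k) - M S (delta k)) \<le> nrm (M D) * hn (delta k)"
      using opnorm_bound[OF opsD(1)[OF Cr_ops[OF M_C[OF D]]] delta_mem, of k] by simp
    also have "\<dots> \<le> K * nrm D" using K[OF D] by (simp add: hn_delta)
    \<comment> \<open>The sign of the bound \<open>K\<close> is unknown, hence the absolute
      value.\<close>
    also have "\<dots> \<le> \<bar>K\<bar> * inverse (real (Suc n))" using D_le D_ge by (intro mult_mono) auto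
    finally show "hn (Lambda \<alpha> \<sigma> (\<lambda>g. T g (f n g)) (delta k) - M S (delta k)) \<le> \<bar>K\<bar> * inverse (real (Suc n))" .
  qed
  show ?thesis by (rule rel_limit[of S f, OF S f(1) lim_S M_C[OF S] lim_M])
qed

text \<open>Additivity, homogeneity and the values on \<open>Lambda\<close> follow from uniqueness:
  in each case the proposed value has the right entries.\<close>

lemma mult_map_exists: "\<exists>M. mult_map \<alpha> \<sigma> T M"
proof -
  define M where "M S = (SOME R. rel S R)" for S
  have M: "rel S (M S)" if "S \<in> CR" for S unfolding M_def by (rule someI_ex[OF rel_exists[OF that]])
  have M_C: "M S \<in> CR" if "S \<in> CR" for S using M[OF that] by (simp add: rel_def)
  have M_ent: "ent (M S) h k = ip (vi h x) (\<rho> (ent S h k) (vi k y))" if "S \<in> CR" for S h k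
    using M[OF that] by (simp add: rel_def)
  have eqI: "M S = R" if "S \<in> CR" "R \<in> CR" "\<And>h k. ent R h k = ip (vi h x) (\<rho> (ent S h k) (vi k y))" for S R
    using that by (intro rel_unique[OF M]) (auto simp: rel_def)
  have cs: "a * cscale c 1 = cscale c a" for a :: 'a and c by (simp add: cscale_def distrib_left flip: iu_central)
  have "mult_map \<alpha> \<sigma> T M" unfolding mult_map_def bounded_lin_on_def
  proof (intro conjI ballI allI impI)
    show "S \<in> CR \<Longrightarrow> M S \<in> CR" for S by (rule M_C)
    show "M (op_add AS S S') = op_add AS (M S) (M S')" if SS: "S \<in> CR" "S' \<in> CR" for S S'
      using SS x y by (intro eqI cstar_subalgD(2)[OF Cr_subalg] M_C)
        (simp_all add: ent_linear Cr_ops M_C M_ent R.rho_add R.ip_add_right vi R.rho_linear)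
    show "M (op_smul AS (as_rm \<alpha>) c S) = op_smul AS (as_rm \<alpha>) c (M S)" if S: "S \<in> CR" for S c
      using S x y by (intro eqI cstar_subalgD(4)[OF Cr_subalg] M_C)
        (simp_all add: ent_smul Cr_ops M_C M_ent cs[of "ent _ _ _"] R.rho_cscale R.ip_rm_right vi R.rho_linear)
    show "\<exists>K. \<forall>S\<in>CR. nrm (M S) \<le> K * nrm S"
      using opnorm_nonneg[OF opsD(1)[OF Cr_ops]]
      by (intro exI[of _ "hnorm ip x * hnorm ip y"] ballI opnorm_leI rel_bound M_ent Cr_ops M_C) auto
    show "M (Lambda \<alpha> \<sigma> f) = Lambda \<alpha> \<sigma> (\<lambda>g. T g (f g))" if "finite {g. f g \<noteq> 0}" for f
      using that by (intro rel_unique[OF M rel_Lambda] Lambda_mem_Cr)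
  qed
  then show ?thesis by blast
qed

text \<open>Agreement on \<open>CR\<close> is all that can hold, as values elsewhere are
  unconstrained; it suffices to make the choice in \<open>triple_norm\<close> harmless.\<close>

lemma mult_map_unique: "mult_map \<alpha> \<sigma> T M \<Longrightarrow> mult_map \<alpha> \<sigma> T M' \<Longrightarrow> S \<in> CR \<Longrightarrow> M S = M' S"
  using rel_unique mult_map_rel by blast

section \<open>Matrix amplifications and the norms of the multiplier\<close>

lemma schur_pow: "schur (pow n) pow_rm (pow_ip n) (\<lambda>(i, l). emb i (delta l)) ({..<n} \<times> UNIV) X rm ip \<rho>"
  by (intro schur.intro hbasis_pow star_rep)

lemma pow_entries:
  assumes "\<And>i j. i < n \<Longrightarrow> j < n \<Longrightarrow> N i j \<in> ops" "i < n" "j < n"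
  shows "pow_ip n (emb i (delta h)) (matop n N (emb j (delta k))) = ent (N i j) h k"
proof -
  interpret P: hmod "pow n" pow_rm "pow_ip n" by (rule hmod_pow)
  have "matop n N (emb j (delta k)) \<in> pow n"
    using P.adjointable_linear(1)[OF P.opsD(1)[OF matop_ops]] assms by (simp add: emb_mem delta_mem)
  then show ?thesis using assms by (simp add: pow_ip_emb_left matop_emb delta_mem ent_def)
qed

text \<open>The vectors attached to an index (i, h) depend on h alone. Entrywise application of
  \<open>M\<close> is therefore again a Schur map, with the same constants for every n.\<close>

lemma matnorm_mult_map_le:
  assumes M: "mult_map \<alpha> \<sigma> T M" and Mat: "\<And>i j. i < n \<Longrightarrow> j < n \<Longrightarrow> Mat i j \<in> CR"
  shows "matnorm AS (as_ip \<alpha>) n (\<lambda>i j. M (Mat i j)) \<le> hnorm ip x * hnorm ip y * matnorm AS (as_ip \<alpha>) n Mat"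
proof -
  interpret P: schur "pow n" pow_rm "pow_ip n" "\<lambda>(i, l). emb i (delta l)" "{..<n} \<times> UNIV" X rm ip \<rho> by (rule schur_pow)
  have rel: "rel (Mat i j) (M (Mat i j))" if "i < n" "j < n" for i j by (rule mult_map_rel[OF M Mat[OF that]])
  have ops: "Mat i j \<in> ops" "M (Mat i j) \<in> ops" if "i < n" "j < n" for i j
    using rel[OF that] Mat[OF that] by (auto simp: rel_def Cr_ops)
  have S: "matop n Mat \<in> P.ops" by (rule matop_ops) (rule ops(1))
  have R: "matop n (\<lambda>i j. M (Mat i j)) \<in> P.ops" by (rule matop_ops) (rule ops(2))
  show ?thesis unfolding matnorm_eq_opnorm
  proof (rule P.opnorm_leI)
    show "0 \<le> hnorm ip x * hnorm ip y * opnorm (pow n) (pow_ip n) (matop n Mat)"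
      using P.opnorm_nonneg[OF P.opsD(1)[OF S]] by simp
    fix \<xi> assume "\<xi> \<in> pow n"
    then show "hnorm (pow_ip n) (matop n (\<lambda>i j. M (Mat i j)) \<xi>)
        \<le> hnorm ip x * hnorm ip y * opnorm (pow n) (pow_ip n) (matop n Mat) * hnorm (pow_ip n) \<xi>"
      using x y rel
      by (intro P.schur_bound[OF R S, where x = "\<lambda>(i, h). vi h x" and y = "\<lambda>(i, h). vi h y"])
        (auto simp: vi hn_vi pow_entries ops rel_def)
  qed
qed

lemma mult_map_props:
  assumes M: "mult_map \<alpha> \<sigma> T M"
  shows "cbounded AS (as_ip \<alpha>) CR M"
    "map_norm AS (as_ip \<alpha>) CR M \<le> cb_norm AS (as_ip \<alpha>) CR M"
    "cb_norm AS (as_ip \<alpha>) CR M \<le> hnorm ip x * hnorm ip y"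
    "bdd_above ((\<lambda>S. nrm (M S)) ` {S \<in> CR. nrm S \<le> 1})"
proof -
  let ?cb = "cb_set AS (as_ip \<alpha>) CR M" and ?C = "hnorm ip x * hnorm ip y"
  have le: "r \<le> ?C" if "r \<in> ?cb" for r
  proof -
    obtain n Mat where r: "r = matnorm AS (as_ip \<alpha>) n (\<lambda>i j. M (Mat i j))"
      and Mat: "\<forall>i<n. \<forall>j<n. Mat i j \<in> CR" "matnorm AS (as_ip \<alpha>) n Mat \<le> 1"
      using \<open>r \<in> ?cb\<close> unfolding cb_set_def by blast
    have "r \<le> ?C * matnorm AS (as_ip \<alpha>) n Mat" unfolding r by (rule matnorm_mult_map_le[OF M]) (use Mat in auto)
    also have "\<dots> \<le> ?C * 1" using Mat(2) by (intro mult_left_mono) auto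
    finally show ?thesis by simp
  qed
  then have bdd: "bdd_above ?cb" by (auto simp: bdd_above_def)
  then show "cbounded AS (as_ip \<alpha>) CR M" by (simp add: cbounded_def)
  \<comment> \<open>Matrices of size 1 place the values defining \<open>map_norm\<close> inside
    \<open>cb_set\<close>.\<close>
  have mem: "nrm (M S) \<in> ?cb" if S: "S \<in> CR" "nrm S \<le> 1" for S
  proof -
    have "nrm (M S) = matnorm AS (as_ip \<alpha>) 1 (\<lambda>i j. M S)" "matnorm AS (as_ip \<alpha>) 1 (\<lambda>i j. S) \<le> 1"
      using S by (simp_all only: matnorm_one)
    then show ?thesis unfolding cb_set_def using S(1)
      by (intro CollectI exI[of _ 1] exI[of _ "\<lambda>i j. S"]) simp
  qed
  \<comment> \<open>The identity shows that the sets under the suprema are nonempty.\<close>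
  have id: "restr AS (\<lambda>\<xi>. \<xi>) \<in> {S \<in> CR. nrm S \<le> 1}"
    using id_mem_Cr by (auto intro!: opnorm_leI)
  then have "?cb \<noteq> {}" using mem by blast
  then show "cb_norm AS (as_ip \<alpha>) CR M \<le> ?C" unfolding cb_norm_def by (rule cSup_least) (rule le)
  show "map_norm AS (as_ip \<alpha>) CR M \<le> cb_norm AS (as_ip \<alpha>) CR M"
    unfolding map_norm_def cb_norm_def using id mem bdd by (intro cSup_subset_mono) auto
  show "bdd_above ((\<lambda>S. nrm (M S)) ` {S \<in> CR. nrm S \<le> 1})"
    using mem by (intro bdd_above_mono[OF bdd]) auto
qed

lemma triple_norm_eq:
  assumes M: "mult_map \<alpha> \<sigma> T M"
  shows "triple_norm \<alpha> \<sigma> T = map_norm AS (as_ip \<alpha>) CR M"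
proof -
  define M' where "M' = (SOME M. mult_map \<alpha> \<sigma> T M)"
  have "mult_map \<alpha> \<sigma> T M'" unfolding M'_def using M by (rule someI[of "mult_map \<alpha> \<sigma> T"])
  then have "M' S = M S" if "S \<in> CR" for S using mult_map_unique M that by blast
  then show ?thesis unfolding triple_norm_def map_norm_def M'_def[symmetric]
    by (intro arg_cong[where f = Sup] image_cong refl) simp
qed

lemma mult_map_mon:
  assumes M: "mult_map \<alpha> \<sigma> T M"
  shows "M (mon a g) = mon (T g a) g"
proof -
  have "{h. (if h = g then a else 0) \<noteq> 0} \<subseteq> {g}" by auto
  then have "finite {h. (if h = g then a else 0) \<noteq> 0}" using finite_subset by blast
  moreover have "M (Lambda \<alpha> \<sigma> f) = Lambda \<alpha> \<sigma> (\<lambda>g. T g (f g))" if "finite {g. f g \<noteq> 0}" for f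
    using M that unfolding mult_map_def by blast
  ultimately have "M (mon a g) = Lambda \<alpha> \<sigma> (\<lambda>h. T h (if h = g then a else 0))"
    unfolding mon_eq_Lambda by simp
  also have "(\<lambda>h. T h (if h = g then a else 0)) = (\<lambda>h. if h = g then T g a else 0)"
    using x y by (auto simp: vi)
  finally show ?thesis by (simp only: mon_eq_Lambda)
qed

text \<open>Entries of a matrix satisfying \<open>matpos\<close> are Gram elements of the columns of
  some \<open>B\<close>, which is the hypothesis of \<open>schur_positive\<close>. Its conclusion
  concerns the form only, and \<open>form_matpos\<close> converts that into \<open>matpos\<close>
  over \<open>CR\<close>.\<close>

lemma comp_pos_mult_map:
  assumes M: "mult_map \<alpha> \<sigma> T M" and xy: "x = y"
  shows "comp_pos AS (as_ip \<alpha>) CR M"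
  unfolding comp_pos_def
proof (intro allI impI, elim conjE)
  fix n :: nat and Mat
  assume Mat: "\<forall>i<n. \<forall>j<n. Mat i j \<in> CR" and pos: "matpos AS (as_ip \<alpha>) CR n Mat"
  interpret P: schur "pow n" pow_rm "pow_ip n" "\<lambda>(i, l). emb i (delta l)" "{..<n} \<times> UNIV" X rm ip \<rho> by (rule schur_pow)
  have rel: "rel (Mat i j) (M (Mat i j))" if "i < n" "j < n" for i j using mult_map_rel[OF M] Mat that by blast
  have MC: "M (Mat i j) \<in> CR" if "i < n" "j < n" for i j using rel[OF that] by (simp add: rel_def)
  obtain B where B: "\<And>i j. i < n \<Longrightarrow> j < n \<Longrightarrow> B i j \<in> CR"
    "\<And>i j \<xi>. i < n \<Longrightarrow> j < n \<Longrightarrow> \<xi> \<in> AS \<Longrightarrow> Mat i j \<xi> = (\<Sum>k<n. op_adj AS (as_ip \<alpha>) (B k i) (B k j \<xi>))"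
    by (rule matposE[OF pos]) blast
  have Bops: "B i j \<in> ops" if "i < n" "j < n" for i j using B(1)[OF that] by (rule Cr_ops)
  have Bl: "B i j (delta k) \<in> AS" if "i < n" "j < n" for i j k
    by (rule adjointable_linear(1)[OF opsD(1)[OF Bops[OF that]] delta_mem])
  have ent_B: "ent (Mat i j) h k = pow_ip n (matop n B (emb i (delta h))) (matop n B (emb j (delta k)))"
    if ij: "i < n" "j < n" for i j h k
  proof -
    have adj_mem: "op_adj AS (as_ip \<alpha>) (B l i) (B l j (delta k)) \<in> AS" if "l < n" for l
      using adj_pairD(2)[OF op_adj_props(2)[OF Bops]] Bl ij that by blast
    have "ent (Mat i j) h k = (\<Sum>l<n. as_ip \<alpha> (delta h) (op_adj AS (as_ip \<alpha>) (B l i) (B l j (delta k))))"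
      unfolding ent_def B(2)[OF ij delta_mem] using adj_mem by (intro ip_sum_right) (auto simp: delta_mem)
    also have "\<dots> = (\<Sum>l<n. as_ip \<alpha> (B l i (delta h)) (B l j (delta k)))"
    proof (rule sum.cong[OF refl])
      fix l assume "l \<in> {..<n}"
      then show "as_ip \<alpha> (delta h) (op_adj AS (as_ip \<alpha>) (B l i) (B l j (delta k))) = as_ip \<alpha> (B l i (delta h)) (B l j (delta k))"
        using adj_pairD(3)[OF op_adj_props(2)[OF Bops], of l i "delta h" "B l j (delta k)"] Bl ij by (simp add: delta_mem)
    qed
    also have "\<dots> = pow_ip n (matop n B (emb i (delta h))) (matop n B (emb j (delta k)))"
      using ij by (simp add: pow_ip_def matop_emb Bops delta_mem)
    finally show ?thesis .
  qed
  have ent_M: "ent (M (Mat i j)) h k = ip (vi h x)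
      (\<rho> (pow_ip n (matop n B (emb i (delta h))) (matop n B (emb j (delta k)))) (vi k x))" if "i < n" "j < n" for i j h k
    using rel[OF that] xy unfolding ent_B[OF that, symmetric] rel_def by simp
  show "matpos AS (as_ip \<alpha>) CR n (\<lambda>i j. M (Mat i j))"
  proof (rule form_matpos[OF Cr_subalg id_mem_Cr MC])
    fix \<xi> assume \<xi>: "\<xi> \<in> pow n"
    have R: "matop n (\<lambda>i j. M (Mat i j)) \<in> P.ops" by (rule matop_ops) (rule Cr_ops[OF MC])
    have B': "matop n B \<in> P.ops" by (rule matop_ops) (rule Bops)
    show "cpos (pow_ip n \<xi> (matop n (\<lambda>i j. M (Mat i j)) \<xi>))"
      using x
      by (intro P.schur_positive[OF R B' _ _ \<xi>, where x = "\<lambda>(i, h). vi h x"])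
        (auto simp: vi pow_entries Cr_ops MC ent_M)
  qed
qed

text \<open>The test element is the identity, written \<open>mon 1 0\<close>. As \<open>v 0\<close>
  is the identity on \<open>X\<close>, its image is \<open>mon (ip x x) 0\<close>, whose norm is
  detected at \<open>delta 0\<close>.\<close>

lemma map_norm_ge:
  assumes M: "mult_map \<alpha> \<sigma> T M" and xy: "x = y"
  shows "(hnorm ip x)\<^sup>2 \<le> map_norm AS (as_ip \<alpha>) CR M"
proof -
  let ?a = "ip x x"
  have "hn (mon 1 0 \<xi>) \<le> 1 * hn \<xi>" if "\<xi> \<in> AS" for \<xi> using that by (simp add: mon_apply lam_zero leftop_one)
  then have one: "nrm (mon 1 0) \<le> 1" by (intro opnorm_leI) auto
  have M1: "M (mon 1 0) = mon ?a 0" using mult_map_mon[OF M, of 1 0] x xy by (simp add: v_zero R.rho_one)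
  have "norm ?a = norm (as_ip \<alpha> (delta 0) (mon ?a 0 (delta 0)))"
    by (simp add: as_ip_delta_left mon_apply delta_mem lam_zero leftop_apply is_aut_norm[OF aut_inv]) (simp add: delta_def)
  also have "\<dots> \<le> hn (delta 0) * hn (mon ?a 0 (delta 0))"
    by (intro norm_ip_le delta_mem mon_linear(1))
  also have "\<dots> \<le> nrm (M (mon 1 0))"
    using opnorm_bound[OF opsD(1)[OF mon_ops] delta_mem, of ?a 0 0] by (simp add: M1 hn_delta)
  also have "\<dots> \<le> map_norm AS (as_ip \<alpha>) CR M"
    unfolding map_norm_def using one mon_mem_Cr by (intro cSup_upper mult_map_props(4)[OF M]) auto
  finally show ?thesis by (simp add: hnorm_def)
qed

end

theorem theorem4p8:
  fixes \<alpha> :: "'g::group_add \<Rightarrow> 'a::cstar \<Rightarrow> 'a" and \<sigma> :: "'g \<Rightarrow> 'g \<Rightarrow> 'a"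
    and X :: "'x::ab_group_add set" and rm :: "'x \<Rightarrow> 'a \<Rightarrow> 'x" and ip :: "'x \<Rightarrow> 'x \<Rightarrow> 'a"
    and \<rho> :: "'a \<Rightarrow> 'x \<Rightarrow> 'x" and v :: "'g \<Rightarrow> 'x \<Rightarrow> 'x" and x y :: 'x
  assumes "twisted_system \<alpha> \<sigma>"
    and "hilbert_module X rm ip"
    and "equivariant_rep \<alpha> \<sigma> X rm ip \<rho> v"
    and "x \<in> X" and "y \<in> X"
  shows "in_M0A \<alpha> \<sigma> (\<lambda>g a. ip x (\<rho> a (v g y))) \<and>
    (\<forall>M. mult_map \<alpha> \<sigma> (\<lambda>g a. ip x (\<rho> a (v g y))) M \<longrightarrow>
       cbounded (ASig \<alpha>) (as_ip \<alpha>) (Cr \<alpha> \<sigma>) M \<and>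
       triple_norm \<alpha> \<sigma> (\<lambda>g a. ip x (\<rho> a (v g y))) = map_norm (ASig \<alpha>) (as_ip \<alpha>) (Cr \<alpha> \<sigma>) M \<and>
       map_norm (ASig \<alpha>) (as_ip \<alpha>) (Cr \<alpha> \<sigma>) M \<le> cb_norm (ASig \<alpha>) (as_ip \<alpha>) (Cr \<alpha> \<sigma>) M \<and>
       cb_norm (ASig \<alpha>) (as_ip \<alpha>) (Cr \<alpha> \<sigma>) M \<le> hnorm ip x * hnorm ip y \<and>
       (\<forall>a g. M (op_comp (ASig \<alpha>) (leftop \<alpha> a) (lam \<alpha> \<sigma> g))
              = op_comp (ASig \<alpha>) (leftop \<alpha> (ip x (\<rho> a (v g y)))) (lam \<alpha> \<sigma> g)) \<and>
       (x = y \<longrightarrow>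
          comp_pos (ASig \<alpha>) (as_ip \<alpha>) (Cr \<alpha> \<sigma>) M \<and>
          triple_norm \<alpha> \<sigma> (\<lambda>g a. ip x (\<rho> a (v g y))) = map_norm (ASig \<alpha>) (as_ip \<alpha>) (Cr \<alpha> \<sigma>) M \<and>
          map_norm (ASig \<alpha>) (as_ip \<alpha>) (Cr \<alpha> \<sigma>) M = cb_norm (ASig \<alpha>) (as_ip \<alpha>) (Cr \<alpha> \<sigma>) M \<and>
          cb_norm (ASig \<alpha>) (as_ip \<alpha>) (Cr \<alpha> \<sigma>) M = (hnorm ip x)\<^sup>2))"
proof -
  interpret C: coefficient \<alpha> \<sigma> X rm ip \<rho> v x y
    using assms by (intro coefficient.intro eqrep.intro tsys.intro eqrep_axioms.intro coefficient_axioms.intro)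
  \<comment> \<open>The chain runs from the square of \<open>hnorm ip x\<close> through both norms
    of \<open>M\<close> and back to \<open>hnorm ip x * hnorm ip y\<close>, the same number for x =
    y.\<close>
  have squeeze: "map_norm (ASig \<alpha>) (as_ip \<alpha>) (Cr \<alpha> \<sigma>) M = cb_norm (ASig \<alpha>) (as_ip \<alpha>) (Cr \<alpha> \<sigma>) M \<and>
      cb_norm (ASig \<alpha>) (as_ip \<alpha>) (Cr \<alpha> \<sigma>) M = (hnorm ip x)\<^sup>2"
    if "mult_map \<alpha> \<sigma> (\<lambda>g a. ip x (\<rho> a (v g y))) M" "x = y" for M
    using C.mult_map_props(2,3)[OF that(1)] C.map_norm_ge[OF that] that(2) by (simp add: power2_eq_square)
  show ?thesis unfolding in_M0A_def
    using C.mult_map_exists C.mult_map_props(1-3) C.triple_norm_eq C.mult_map_mon[unfolded C.mon_def]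
      C.comp_pos_mult_map squeeze by blast
qed

end
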